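(* Let $\boldsymbol{d}=\boldsymbol{d}(n)\in\{0,\ldots,n-1\}^n$ be a sequence of degree sequences (each realisable, i.e. $\mathcal{G}(n,\boldsymbol{d})\neq\emptyset$) which is near-regular and dense. Then there exist $p_1=(1-o(1))\Delta(\boldsymbol{d})/n$ and $p_2=(1+o(1))\Delta(\boldsymbol{d})/n$ and a coupling $(G^L,G,G^U)$ such that $G^L\sim\mathcal{G}(n,p_1)$, $G^U\sim\mathcal{G}(n,p_2)$, $G\sim\mathcal{G}(n,\boldsymbol{d})$ and $\mathbb{P}(G^L\subseteq G\subseteq G^U)=1-o(1)$.
   Context: All asymptotics are as $n\to\infty$. $\mathcal{G}(n,p)$ is the binomial random graph on vertex set $[n]$ in which each of the $\binom n2$ possible edges is present independently with probability $p$. For a vector $\boldsymbol{d}=(d_1,\ldots,d_n)$ of nonnegative integers with even sum, $\mathcal{G}(n,\boldsymbol{d})$ is the uniformly random simple graph on $[n]$ in which vertex $j$ has degree $d_j$ for every $j$. $\Delta(\boldsymbol{d})=\max_j d_j$ and $\mathrm{range}(\boldsymbol{d})=\max_j d_j-\min_j d_j$. The sequence $\boldsymbol{d}(n)$ is near-regular if $\mathrm{range}(\boldsymbol{d})=o(\Delta(\boldsymbol{d}))$ and $\mathrm{range}(\boldsymbol{d})=o(n-\Delta(\boldsymbol{d}))$; it is dense if $\min\{\Delta(\boldsymbol{d}),n-\Delta(\boldsymbol{d})\}=\Theta(n)$. A coupling of random graphs $Z_1,\ldots,Z_k$ is a random tuple whose marginal distributions coincide with those of $Z_1,\ldots,Z_k$;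 graphs on $[n]$ are compared via their edge sets. *)

theory Defs
  imports
    "HOL-Probability.Probability"
    "HOL-Probability.Product_PMF"
    "HOL-Library.Landau_Symbols"
begin

text \<open>A simple graph on \<open>[n] = {1..n}\<close> is represented by its edge set, a set of
  two-element subsets of \<open>{1..n}\<close>; thus \<open>\<subseteq>\<close> is the subgraph order.\<close>

type_synonym graph = "nat set set"

definition all_edges :: "nat \<Rightarrow> nat set set" where
  "all_edges n = {e. e \<subseteq> {1..n} \<and> card e = 2}"

definition vertex_degree :: "graph \<Rightarrow> nat \<Rightarrow> nat" where
  "vertex_degree E j = card {e \<in> E. j \<in> e}"

definition graphs_with_degrees :: "nat \<Rightarrow> (nat \<Rightarrow> nat) \<Rightarrow> graph set" where
  "graphs_with_degrees n d =
     {E. E \<subseteq> all_edges n \<and> (\<forall>j\<in>{1..n}. vertex_degree E j = d j)}"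

text \<open>As \<^const>\<open>pmf_of_set\<close> is specified for finite nonempty sets only, this is meaningful
  when the degree sequence is realisable.\<close>

definition degree_random_graph :: "nat \<Rightarrow> (nat \<Rightarrow> nat) \<Rightarrow> graph pmf" where
  "degree_random_graph n d = pmf_of_set (graphs_with_degrees n d)"

text \<open>Meaningful for \<open>0 \<le> p \<le> 1\<close>, like \<^const>\<open>bernoulli_pmf\<close>.\<close>

definition binomial_random_graph :: "nat \<Rightarrow> real \<Rightarrow> graph pmf" where
  "binomial_random_graph n p =
     map_pmf (\<lambda>X. {e \<in> all_edges n. X e})
       (Pi_pmf (all_edges n) False (\<lambda>_. bernoulli_pmf p))"

text \<open>\<open>d j\<close> is the degree of vertex \<open>j\<close>; values outside \<open>{1..n}\<close> play no role. For
  \<open>n = 0\<close> the maximum and minimum are unspecified, which is harmless for asymptotics.\<close>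

definition max_degree :: "nat \<Rightarrow> (nat \<Rightarrow> nat) \<Rightarrow> nat" where
  "max_degree n d = Max (d ` {1..n})"

definition min_degree :: "nat \<Rightarrow> (nat \<Rightarrow> nat) \<Rightarrow> nat" where
  "min_degree n d = Min (d ` {1..n})"

definition degree_range :: "nat \<Rightarrow> (nat \<Rightarrow> nat) \<Rightarrow> real" where
  "degree_range n d = real (max_degree n d) - real (min_degree n d)"

definition near_regular :: "(nat \<Rightarrow> nat \<Rightarrow> nat) \<Rightarrow> bool" where
  "near_regular d \<longleftrightarrow>
     (\<lambda>n. degree_range n (d n)) \<in> o(\<lambda>n. real (max_degree n (d n))) \<and>
     (\<lambda>n. degree_range n (d n)) \<in> o(\<lambda>n. real n - real (max_degree n (d n)))"

definition dense_degrees :: "(nat \<Rightarrow> nat \<Rightarrow> nat) \<Rightarrow> bool" where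
  "dense_degrees d \<longleftrightarrow>
     (\<lambda>n. min (real (max_degree n (d n))) (real n - real (max_degree n (d n))))
       \<in> \<Theta>(\<lambda>n. real n)"

text \<open>A coupling, given by its joint distribution. There are only finitely many graphs on
  \<open>[n]\<close>, so joint distributions of random graphs are always discrete.\<close>

definition is_coupling3 ::
  "('a \<times> 'b \<times> 'c) pmf \<Rightarrow> 'a pmf \<Rightarrow> 'b pmf \<Rightarrow> 'c pmf \<Rightarrow> bool" where
  "is_coupling3 C P Q R \<longleftrightarrow>
     map_pmf (\<lambda>(x, y, z). x) C = P \<and>
     map_pmf (\<lambda>(x, y, z). y) C = Q \<and>
     map_pmf (\<lambda>(x, y, z). z) C = R"

end

theory Submission
  imports Defs "HOL-Probability.Hoeffding" "HOL-Real_Asymp.Real_Asymp"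
begin

text \<open>
  Put \<open>p = \<Delta>/n\<close>, give the pairs independent uniform labels in \<open>{0..<K\<^sup>2}\<close> and expose the status of
  the pairs in the uniform random graph \<open>G\<close> with degrees \<open>d\<close> in the order of their labels. As long
  as the labels are below \<open>K\<^sup>2 - K\<close>, the conditional probability that the next pair is an edge is
  \<open>p + o(1)\<close>, so that its status can be coupled monotonically with Bernoulli variables of
  parameters \<open>p - \<theta>\<close> and \<open>p + \<theta>\<close>. The remaining pairs, a random set of density \<open>1/K\<close> which is
  independent of \<open>G\<close>, are left out of \<open>G\<^sup>L\<close> and put into \<open>G\<^sup>U\<close>; averaged over the labels, \<open>G\<^sup>L\<close> and
  \<open>G\<^sup>U\<close> are exactly binomial.

  The conditional probability is estimated by switching along 4-cycles \<open>j k v u\<close> of unexposed pairs.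
  The numbers of switchings are determined up to a factor \<open>1 + o(1)\<close> if \<open>G\<close> and the unexposed
  pairs are cut-quasirandom. For \<open>G(n,p)\<close>, Hoeffding's inequality and a union bound over \<open>4\<^sup>n\<close> pairs of
  vertex sets give this up to probability \<open>exp(-\<Omega>(n\<^sup>2))\<close>. It carries over to \<open>G\<close> because \<open>G(n,p)\<close> has
  degree sequence \<open>d\<close> with probability \<open>exp(-o(n\<^sup>2))\<close>: every cut-quasirandom graph is within \<open>o(n\<^sup>2)\<close>
  edge changes of a graph with degrees \<open>d\<close>.
\<close>

text \<open>The exposure has to stop early because a switching count is of order
  \<open>r ^ 3 * n\<^sup>2\<close>, with \<open>r\<close> the density of the unexposed pairs, while
  its error is a fixed multiple of \<open>n\<^sup>2\<close>: the estimate is useful only while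
  \<open>r\<close> is bounded below, here by \<open>1 / K\<close>. With \<open>K\<^sup>2\<close>
  labels, one label class is thin even against that rest, by a factor \<open>1 / K\<close>, so ties
  between labels may be broken arbitrarily. Quasirandomness fails only for a small proportion of all
  graphs with degrees \<open>d\<close>, but a conditional probability needs it for most members of
  one history class. Markov's inequality bridges this at the price of a factor
  \<open>n\<^sup>2 / \<eta>\<close>, which failure probabilities exponentially small in
  \<open>n\<close> absorb. The random order makes the unexposed pairs quasirandom relative to
  \<open>G\<close>: for each fixed graph the labels are independent of it, so concentration applies
  to the graph and to its complement alike. The constants are chosen in the order
  \<open>\<gamma>\<close>, \<open>\<theta>\<close>, \<open>K\<close>, \<open>\<eta>\<close>,
  \<open>\<epsilon>\<close>, \<open>\<delta>\<close>, and \<open>n\<close> last.\<close>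

section \<open>Concentration of edge counts\<close>

text \<open>Ordered pairs are counted, so an edge inside \<open>A \<inter> B\<close> contributes 2.\<close>

definition ecount :: "graph \<Rightarrow> nat set \<Rightarrow> nat set \<Rightarrow> nat" where
  "ecount W A B = card {(u, v) \<in> A \<times> B. {u, v} \<in> W}"

lemma finite_all_edges [simp]: "finite (all_edges n)"
  by (rule finite_subset[of _ "Pow {1..n}"]) (auto simp: all_edges_def)

lemma ecount_eq_sum:
  assumes "finite F" "finite A" "finite B"
  shows "ecount F A B = (\<Sum>e\<in>F. card {(u, v) \<in> A \<times> B. {u, v} = e})"
proof -
  have "{(u, v) \<in> A \<times> B. {u, v} \<in> F} = (\<Union>e\<in>F. {(u, v) \<in> A \<times> B. {u, v} = e})"
    by auto
  moreover have "card (\<Union>e\<in>F. {(u, v) \<in> A \<times> B. {u, v} = e}) =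
      (\<Sum>e\<in>F. card {(u, v) \<in> A \<times> B. {u, v} = e})"
    using assms by (intro card_UN_disjoint) (auto intro: finite_subset[of _ "A \<times> B"])
  ultimately show ?thesis
    unfolding ecount_def by simp
qed

lemma ecount_le: "finite A \<Longrightarrow> finite B \<Longrightarrow> ecount W A B \<le> card A * card B"
  unfolding ecount_def card_cartesian_product[symmetric] by (intro card_mono) auto

lemma card_ordered_pairs_le:
  assumes "card e = 2"
  shows "card {(u, v) \<in> A \<times> B. {u, v} = e} \<le> 2"
proof -
  obtain a b where e: "e = {a, b}" using assms by (meson card_2_iff)
  have "{(u, v) \<in> A \<times> B. {u, v} = e} \<subseteq> {(a, b), (b, a)}"
    unfolding e by (auto simp: doubleton_eq_iff)
  then have "card {(u, v) \<in> A \<times> B. {u, v} = e} \<le> card {(a, b), (b, a)}"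
    by (intro card_mono) auto
  also have "\<dots> \<le> 2"
    using card_length[of "[(a, b), (b, a)]"] by simp
  finally show ?thesis .
qed

text \<open>Hoeffding's inequality for the independent variables
  \<open>w e * of_bool (e \<in> R)\<close>, each confined to an interval of length
  \<open>w e\<close>.\<close>

lemma weighted_edges_concentration:
  fixes w :: "nat set \<Rightarrow> real"
  assumes r: "0 \<le> r" "r \<le> 1" and w: "\<And>e. e \<in> all_edges n \<Longrightarrow> 0 \<le> w e"
    and M: "(\<Sum>e\<in>all_edges n. (w e)\<^sup>2) \<le> M" and t: "0 < t"
  shows "measure_pmf.prob (binomial_random_graph n r)
           {R. t \<le> \<bar>(\<Sum>e\<in>R. w e) - r * (\<Sum>e\<in>all_edges n. w e)\<bar>} \<le> 2 * exp (- 2 * t\<^sup>2 / M)"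
proof -
  define D where "D = Pi_pmf (all_edges n) False (\<lambda>_. bernoulli_pmf r)"
  define X where "X = (\<lambda>e f. w e * of_bool (f e) :: real)"
  have sum_eq: "(\<Sum>e\<in>{e \<in> all_edges n. f e}. w e) = (\<Sum>e\<in>all_edges n. X e f)" for f
    by (rule sum.mono_neutral_cong_left) (auto simp: X_def)
  have exp_X: "measure_pmf.expectation D (X e) = r * w e" if "e \<in> all_edges n" for e
  proof -
    have "measure_pmf.expectation D (X e) =
        measure_pmf.expectation (map_pmf (\<lambda>f. f e) D) (\<lambda>b. w e * of_bool b)"
      by (simp add: X_def)
    also have "map_pmf (\<lambda>f. f e) D = bernoulli_pmf r"
      unfolding D_def using that by (subst Pi_pmf_component) auto
    finally show ?thesis using r by simp
  qed
  have prob_eq: "measure_pmf.prob (binomial_random_graph n r)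
        {R. t \<le> \<bar>(\<Sum>e\<in>R. w e) - r * (\<Sum>e\<in>all_edges n. w e)\<bar>}
      = measure_pmf.prob D {f. t \<le> \<bar>(\<Sum>e\<in>all_edges n. X e f) - r * (\<Sum>e\<in>all_edges n. w e)\<bar>}"
    unfolding binomial_random_graph_def D_def[symmetric] by (simp add: vimage_def sum_eq)
  show ?thesis
  \<comment> \<open>Hoeffding's inequality requires a positive sum of squared ranges. If all weights
    vanish, both sums are \<open>0\<close> and the event is impossible because
    \<open>t > 0\<close>.\<close>
  proof (cases "(\<Sum>e\<in>all_edges n. (w e)\<^sup>2) = 0")
    case True
    then have "w e = 0" if "e \<in> all_edges n" for e
      using that by (subst (asm) sum_nonneg_eq_0_iff) auto
    then show ?thesis unfolding prob_eq using t by (simp add: X_def)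
  next
    case False
    then have pos: "(\<Sum>e\<in>all_edges n. (w e - 0)\<^sup>2) > 0"
      by (simp add: order_less_le sum_nonneg)
    interpret H: Hoeffding_ineq "measure_pmf D" "all_edges n" X "\<lambda>_. 0" w
      "\<Sum>e\<in>all_edges n. measure_pmf.expectation D (X e)"
    proof unfold_locales
      show "prob_space.indep_vars (measure_pmf D) (\<lambda>_. borel) X (all_edges n)"
        unfolding D_def X_def
        by (intro prob_space.indep_vars_compose2[OF _ indep_vars_Pi_pmf])
           (auto simp: measure_pmf.prob_space_axioms)
    qed (auto simp: X_def w)
    have "measure_pmf.prob D {f. t \<le> \<bar>(\<Sum>e\<in>all_edges n. X e f) - r * (\<Sum>e\<in>all_edges n. w e)\<bar>}
       \<le> 2 * exp (- 2 * t\<^sup>2 / (\<Sum>e\<in>all_edges n. (w e - 0)\<^sup>2))"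
      using H.Hoeffding_ineq_abs_ge[of t] t pos by (simp add: exp_X sum_distrib_left)
    also have "\<dots> \<le> 2 * exp (- 2 * t\<^sup>2 / M)"
      using pos M by (simp add: divide_left_mono_neg frac_le)
    finally show ?thesis unfolding prob_eq .
  qed
qed

text \<open>A pair is weighted by the number of its orderings in \<open>A \<times> B\<close>. This
  is at most 2, so squares are at most twice the weights and their sum is at most
  \<open>2 * card A * card B\<close>. Keeping the product of the cardinalities, rather than
  \<open>n\<^sup>2\<close>, lets the bound serve both cuts, with deviation of order
  \<open>n\<^sup>2\<close>, and single rows \<open>{j} \<times> {1..n}\<close>, with deviation of
  order \<open>n\<close>.\<close>

lemma ecount_concentration:
  assumes r: "0 \<le> r" "r \<le> 1" and fin: "finite A" "finite B"
    and M: "real (card A * card B) \<le> M" and t: "0 < t" and E: "E \<subseteq> all_edges n"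
  shows "measure_pmf.prob (binomial_random_graph n r)
           {R. t \<le> \<bar>real (ecount (E \<inter> R) A B) - r * real (ecount E A B)\<bar>} \<le> 2 * exp (- t\<^sup>2 / M)"
proof -
  define c where "c = (\<lambda>e. card {(u, v) \<in> A \<times> B. {u, v} = e})"
  define w where "w = (\<lambda>e. of_bool (e \<in> E) * real (c e))"
  have cnt: "real (ecount (E \<inter> R) A B) = (\<Sum>e\<in>R. w e)" if "R \<subseteq> all_edges n" for R
  proof -
    have "finite R" using that finite_subset finite_all_edges by blast
    then have "real (ecount (E \<inter> R) A B) = (\<Sum>e\<in>E \<inter> R. real (c e))"
      using fin by (subst ecount_eq_sum) (auto simp: c_def)
    also have "\<dots> = (\<Sum>e\<in>R. w e)"
      using \<open>finite R\<close> by (intro sum.mono_neutral_cong_left) (auto simp: w_def)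
    finally show ?thesis .
  qed
  have tot: "real (ecount E A B) = (\<Sum>e\<in>all_edges n. w e)"
    using cnt[of "all_edges n"] E by (simp add: Int_absorb2)
  have "(\<Sum>e\<in>all_edges n. (w e)\<^sup>2) \<le> (\<Sum>e\<in>all_edges n. 2 * w e)"
  proof (rule sum_mono)
    fix e assume "e \<in> all_edges n"
    then have "c e \<le> 2" unfolding c_def by (intro card_ordered_pairs_le) (auto simp: all_edges_def)
    then show "(w e)\<^sup>2 \<le> 2 * w e"
      by (auto simp: w_def power2_eq_square intro!: mult_right_mono)
  qed
  also have "\<dots> = 2 * real (ecount E A B)"
    by (simp add: tot sum_distrib_left)
  also have "\<dots> \<le> 2 * M"
    using ecount_le[OF fin, of E] M by linarith
  finally have M2: "(\<Sum>e\<in>all_edges n. (w e)\<^sup>2) \<le> 2 * M" .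
  have "measure_pmf.prob (binomial_random_graph n r)
           {R. t \<le> \<bar>real (ecount (E \<inter> R) A B) - r * real (ecount E A B)\<bar>} =
        measure_pmf.prob (binomial_random_graph n r)
           {R. t \<le> \<bar>(\<Sum>e\<in>R. w e) - r * (\<Sum>e\<in>all_edges n. w e)\<bar>}"
    by (intro measure_pmf.finite_measure_eq_AE)
       (auto simp: AE_measure_pmf_iff cnt tot binomial_random_graph_def)
  also have "\<dots> \<le> 2 * exp (- 2 * t\<^sup>2 / (2 * M))"
    by (intro weighted_edges_concentration r M2 t) (auto simp: w_def)
  finally show ?thesis by simp
qed

section \<open>Sequential coupling\<close>

lemma prob_bind_pmf:
  "measure_pmf.prob (bind_pmf M f) S = measure_pmf.expectation M (\<lambda>x. measure_pmf.prob (f x) S)"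
proof -
  have "ennreal (measure_pmf.prob (bind_pmf M f) S) = (\<integral>\<^sup>+x. measure_pmf.prob (f x) S \<partial>M)"
    by (simp add: measure_pmf.emeasure_eq_measure[symmetric])
  also have "\<dots> = ennreal (measure_pmf.expectation M (\<lambda>x. measure_pmf.prob (f x) S))"
    by (intro nn_integral_eq_integral measure_pmf.integrable_const_bound[where B = 1]) auto
  finally show ?thesis
    by (simp add: integral_nonneg_AE)
qed

lemma bind_bernoulli_pmf_thin:
  assumes "0 \<le> q" "q \<le> 1" "0 \<le> s" "s \<le> 1"
  shows "bind_pmf (bernoulli_pmf q) (\<lambda>z. bernoulli_pmf (if z then s else 0)) = bernoulli_pmf (q * s)"
proof (rule pmf_eqI)
  fix b
  show "pmf (bernoulli_pmf q \<bind> (\<lambda>z. bernoulli_pmf (if z then s else 0))) b =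
      pmf (bernoulli_pmf (q * s)) b"
    using assms by (cases b) (auto simp: pmf_bind mult_le_one algebra_simps)
qed

text \<open>Thinning from the top: \<open>y\<close> keeps a success of \<open>z\<close> with
  probability \<open>a / q2\<close>, and \<open>x\<close> keeps one of \<open>y\<close> with
  probability \<open>q1 / a\<close>. If a denominator is 0, all smaller parameters are 0 as well, so
  the products still come out right.\<close>

lemma monotone_bernoulli_triple:
  fixes q1 a q2 :: real
  assumes "0 \<le> q1" "q1 \<le> a" "a \<le> q2" "q2 \<le> 1"
  obtains T where "is_coupling3 T (bernoulli_pmf q1) (bernoulli_pmf a) (bernoulli_pmf q2)"
    "\<And>x y z. (x, y, z) \<in> set_pmf T \<Longrightarrow> (x \<longrightarrow> y) \<and> (y \<longrightarrow> z)"
proof -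
  define Y where "Y = (\<lambda>z. bernoulli_pmf (if z then a / q2 else 0))"
  define X where "X = (\<lambda>y. bernoulli_pmf (if y then q1 / a else 0))"
  define T where "T = do {z \<leftarrow> bernoulli_pmf q2; y \<leftarrow> Y z; x \<leftarrow> X y; return_pmf (x, y, z)}"
  have eqs: "q2 * (a / q2) = a" "a * (q1 / a) = q1" "a / q2 \<le> 1" "q1 / a \<le> 1"
    using assms by (auto simp: divide_le_eq_1)
  have Yb: "bind_pmf (bernoulli_pmf q2) Y = bernoulli_pmf a"
    unfolding Y_def using assms eqs bind_bernoulli_pmf_thin[of q2 "a / q2"] by simp
  have Xb: "bind_pmf (bernoulli_pmf a) X = bernoulli_pmf q1"
    unfolding X_def using assms eqs bind_bernoulli_pmf_thin[of a "q1 / a"] by simp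
  have "map_pmf (\<lambda>(x, y, z). x) T = bernoulli_pmf q2 \<bind> (\<lambda>z. Y z \<bind> X)"
    by (simp add: T_def map_bind_pmf bind_return_pmf')
  also have "\<dots> = bernoulli_pmf q1"
    by (simp add: bind_assoc_pmf[symmetric] Yb Xb)
  finally have "is_coupling3 T (bernoulli_pmf q1) (bernoulli_pmf a) (bernoulli_pmf q2)"
    unfolding is_coupling3_def by (simp add: T_def map_bind_pmf bind_return_pmf' Yb)
  moreover have False_0: "bernoulli_pmf 0 = return_pmf False"
    by (rule pmf_eqI) (auto simp: indicator_def pmf_bernoulli_True)
  have "(x \<longrightarrow> y) \<and> (y \<longrightarrow> z)" if "(x, y, z) \<in> set_pmf T" for x y z
    using that by (auto simp: T_def X_def Y_def False_0 split: if_splits)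
  ultimately show thesis using that by blast
qed

lemma is_coupling3_independent:
  "is_coupling3 (pair_pmf P (pair_pmf Q R)) P Q R"
proof -
  have "map_pmf (\<lambda>(x, y, z). y) (pair_pmf P (pair_pmf Q R)) =
      map_pmf fst (map_pmf snd (pair_pmf P (pair_pmf Q R)))"
    unfolding pmf.map_comp by (rule pmf.map_cong) auto
  moreover have "map_pmf (\<lambda>(x, y, z). z) (pair_pmf P (pair_pmf Q R)) =
      map_pmf snd (map_pmf snd (pair_pmf P (pair_pmf Q R)))"
    unfolding pmf.map_comp by (rule pmf.map_cong) auto
  moreover have "map_pmf (\<lambda>(x, y, z). x) (pair_pmf P (pair_pmf Q R)) =
      map_pmf fst (pair_pmf P (pair_pmf Q R))"
    by (rule pmf.map_cong) auto
  ultimately show ?thesis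
    unfolding is_coupling3_def by (simp add: map_fst_pair_pmf map_snd_pair_pmf)
qed

text \<open>The probabilities depend on the element because a labelling decides which pairs are
  compared with \<open>p - \<theta>\<close> and \<open>p + \<theta>\<close> and which with 0 and
  1.\<close>

definition random_subset :: "'e set \<Rightarrow> ('e \<Rightarrow> real) \<Rightarrow> 'e set pmf" where
  "random_subset A q = map_pmf (\<lambda>f. {e \<in> A. f e}) (Pi_pmf A False (\<lambda>e. bernoulli_pmf (q e)))"

lemma binomial_random_graph_eq: "binomial_random_graph n p = random_subset (all_edges n) (\<lambda>_. p)"
  by (simp add: binomial_random_graph_def random_subset_def)

lemma random_subset_empty [simp]: "random_subset {} q = return_pmf {}"
  by (simp add: random_subset_def)

lemma random_subset_insert:
  assumes "finite A" "e \<notin> A"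
  shows "random_subset (insert e A) q =
    do {x \<leftarrow> bernoulli_pmf (q e);
        map_pmf (\<lambda>X. if x then insert e X else X) (random_subset A q)}"
  unfolding random_subset_def using assms
  by (auto simp: Pi_pmf_insert' map_bind_pmf pmf.map_comp map_pmf_def[symmetric] o_def
      intro!: bind_pmf_cong pmf.map_cong split: if_splits)

text \<open>The information available once the pairs in \<open>T\<close> have been exposed: given
  it, a uniform graph from \<open>\<G>\<close> is uniform on this class.\<close>

definition history_class :: "'e set set \<Rightarrow> 'e set \<Rightarrow> 'e set \<Rightarrow> 'e set set" where
  "history_class \<G> T g = {G \<in> \<G>. G \<inter> T = g \<inter> T}"

text \<open>The quotient is the conditional probability, given the exposed history, that the next
  element belongs to a uniform member of \<open>\<G>\<close>. A monotone Bernoulli triple is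
  available exactly when it lies in the window.\<close>

definition deviating ::
  "'e set set \<Rightarrow> ('e \<Rightarrow> real) \<Rightarrow> ('e \<Rightarrow> real) \<Rightarrow> 'e list \<Rightarrow> 'e set set" where
  "deviating \<G> q1 q2 es = {g \<in> \<G>. \<exists>i<length es.
     real (card {G \<in> history_class \<G> (set (take i es)) g. es ! i \<in> G}) /
     real (card (history_class \<G> (set (take i es)) g)) \<notin> {q1 (es ! i)..q2 (es ! i)}}"

text \<open>Induction on the exposure list: the class is split by the status of its first element,
  the remaining elements are coupled inside each half, and the halves are glued by a Bernoulli
  triple. A failure needs a deviation somewhere along the history. Weighted by the probabilities of
  the halves, the bounds for the halves add up to the number of deviating graphs over
  \<open>card \<G>\<close>.\<close>

lemma sequential_coupling:
  fixes \<G> :: "'e set set"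
  assumes "finite \<G>" "\<G> \<noteq> {}" "distinct es"
    and "\<And>e. e \<in> set es \<Longrightarrow> 0 \<le> q1 e \<and> q2 e \<le> 1"
  shows "\<exists>J. is_coupling3 J (random_subset (set es) q1) (pmf_of_set \<G>) (random_subset (set es) q2) \<and>
    measure_pmf.prob J {(X, G, Y). \<not> (X \<subseteq> G \<and> G \<inter> set es \<subseteq> Y)}
      \<le> real (card (deviating \<G> q1 q2 es)) / real (card \<G>)"
  using assms
proof (induction es arbitrary: \<G>)
  case Nil
  have "is_coupling3 (pair_pmf (return_pmf {}) (pair_pmf (pmf_of_set \<G>) (return_pmf {})))
     (random_subset (set []) q1) (pmf_of_set \<G>) (random_subset (set []) q2)"
    using is_coupling3_independent by simp
  moreover have "measure_pmf.prob (pair_pmf (return_pmf {}) (pair_pmf (pmf_of_set \<G>) (return_pmf {})))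
      {(X, G, Y). \<not> (X \<subseteq> G \<and> G \<inter> set [] \<subseteq> Y)} = 0"
    by (subst measure_pmf_zero_iff) auto
  ultimately show ?case
    by (intro exI[of _ "pair_pmf (return_pmf {}) (pair_pmf (pmf_of_set \<G>) (return_pmf {}))"]) auto
next
  case (Cons e es)
  define \<G>b where "\<G>b = (\<lambda>b. {G \<in> \<G>. (e \<in> G) = b})"
  \<comment> \<open>The induction hypothesis needs a nonempty class. An empty half is replaced by
    \<open>\<G>\<close> itself; that branch has probability 0.\<close>
  define \<G>' where "\<G>' = (\<lambda>b. if \<G>b b = {} then \<G> else \<G>b b)"
  define a where "a = real (card (\<G>b True)) / real (card \<G>)"
  have fin: "finite (\<G>b b)" for b unfolding \<G>b_def using Cons.prems by auto
  have cardG: "real (card \<G>) > 0" using Cons.prems by (simp add: card_gt_0_iff)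
  have G_split: "\<G> = \<G>b True \<union> \<G>b False" "\<G>b True \<inter> \<G>b False = {}"
    unfolding \<G>b_def by auto
  have card_split: "card \<G> = card (\<G>b True) + card (\<G>b False)"
    using card_Un_disjoint[OF fin fin G_split(2)] G_split(1) by simp
  have a01: "0 \<le> a" "a \<le> 1"
    unfolding a_def using cardG card_split by (auto simp: field_simps)
  have a': "1 - a = real (card (\<G>b False)) / real (card \<G>)"
    unfolding a_def using cardG card_split by (simp add: field_simps)
  define IHP where "IHP = (\<lambda>b J. is_coupling3 J (random_subset (set es) q1) (pmf_of_set (\<G>' b))
      (random_subset (set es) q2) \<and>
    measure_pmf.prob J {(X, G, Y). \<not> (X \<subseteq> G \<and> G \<inter> set es \<subseteq> Y)}
      \<le> real (card (deviating (\<G>' b) q1 q2 es)) / real (card (\<G>' b)))"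
  have "\<exists>J. IHP b J" for b
    unfolding IHP_def using Cons.prems fin by (intro Cons.IH) (auto simp: \<G>'_def)
  then have "\<exists>J. \<forall>b. IHP b (J b)"
    by (intro choice allI)
  then obtain J where
    J: "\<And>b. is_coupling3 (J b) (random_subset (set es) q1) (pmf_of_set (\<G>' b)) (random_subset (set es) q2)"
    and J_fail: "\<And>b. measure_pmf.prob (J b) {(X, G, Y). \<not> (X \<subseteq> G \<and> G \<inter> set es \<subseteq> Y)}
      \<le> real (card (deviating (\<G>' b) q1 q2 es)) / real (card (\<G>' b))"
    unfolding IHP_def by blast
  \<comment> \<open>Outside the window no monotone triple exists and the independent coupling is
    taken; the marginals stay correct and only the failure bound is affected.\<close>
  obtain T where T: "is_coupling3 T (bernoulli_pmf (q1 e)) (bernoulli_pmf a) (bernoulli_pmf (q2 e))"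
    and T_mono: "a \<in> {q1 e..q2 e} \<Longrightarrow> (\<forall>(x, y, z)\<in>set_pmf T. (x \<longrightarrow> y) \<and> (y \<longrightarrow> z))"
  proof (cases "a \<in> {q1 e..q2 e}")
    case True
    then show ?thesis
      using monotone_bernoulli_triple[of "q1 e" a "q2 e"] that Cons.prems(4)[of e]
      by (metis (mono_tags, lifting) atLeastAtMost_iff case_prodI2 list.set_intros(1))
  next
    case False
    then show ?thesis using that is_coupling3_independent by blast
  qed
  define ins where "ins = (\<lambda>x X. if x then insert e X else X :: 'e set)"
  define K where "K = do {(x, b, y) \<leftarrow> T; map_pmf (\<lambda>(X, G, Y). (ins x X, G, ins y Y)) (J b)}"
  \<comment> \<open>The outer marginals of \<open>J b\<close> do not depend on \<open>b\<close>.
    Hence the rest of \<open>X\<close> is independent of its first coordinate although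
    \<open>b\<close> is correlated with it, and the same holds for \<open>Y\<close>.\<close>
  have J1: "map_pmf (\<lambda>(X, G, Y). f X) (J b) = map_pmf f (random_subset (set es) q1)" for f b
    using J[of b] unfolding is_coupling3_def
    by (auto simp: pmf.map_comp o_def split_def dest!: arg_cong[where f = "map_pmf f"])
  have J2: "map_pmf (\<lambda>(X, G, Y). G) (J b) = pmf_of_set (\<G>' b)" for b
    using J[of b] unfolding is_coupling3_def by simp
  have J3: "map_pmf (\<lambda>(X, G, Y). f Y) (J b) = map_pmf f (random_subset (set es) q2)" for f b
    using J[of b] unfolding is_coupling3_def
    by (auto simp: pmf.map_comp o_def split_def dest!: arg_cong[where f = "map_pmf f"])
  have T1: "bind_pmf T (\<lambda>(x, b, y). f x) = bind_pmf (bernoulli_pmf (q1 e)) f" for f :: "bool \<Rightarrow> 'e set pmf"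
    using T unfolding is_coupling3_def by (auto simp: bind_map_pmf split_def dest!: sym[where s = "map_pmf _ _"])
  have T2: "bind_pmf T (\<lambda>(x, b, y). f b) = bind_pmf (bernoulli_pmf a) f" for f :: "bool \<Rightarrow> 'e set pmf"
    using T unfolding is_coupling3_def by (auto simp: bind_map_pmf split_def dest!: sym[where s = "map_pmf _ _"])
  have T3: "bind_pmf T (\<lambda>(x, b, y). f y) = bind_pmf (bernoulli_pmf (q2 e)) f" for f :: "bool \<Rightarrow> 'e set pmf"
    using T unfolding is_coupling3_def by (auto simp: bind_map_pmf split_def dest!: sym[where s = "map_pmf _ _"])
  have set_T: "b \<in> set_pmf (bernoulli_pmf a)" if "(x, b, y) \<in> set_pmf T" for x b y
  proof -
    have "b \<in> set_pmf (map_pmf (\<lambda>(x, y, z). y) T)" using that by force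
    then show ?thesis using T unfolding is_coupling3_def by simp
  qed
  have G'_eq: "\<G>' b = \<G>b b \<and> \<G>b b \<noteq> {}" if "b \<in> set_pmf (bernoulli_pmf a)" for b
  proof -
    have "pmf (bernoulli_pmf a) b \<noteq> 0" using that by (simp add: set_pmf_iff)
    then have "\<G>b b \<noteq> {}"
      using a01 a' by (cases b) (auto simp: a_def)
    then show ?thesis by (simp add: \<G>'_def)
  qed
  have "is_coupling3 K (random_subset (set (e # es)) q1) (pmf_of_set \<G>) (random_subset (set (e # es)) q2)"
    unfolding is_coupling3_def
  proof (intro conjI)
    have "map_pmf (\<lambda>(x, y, z). x) K =
        bind_pmf T (\<lambda>(x, b, y). map_pmf (\<lambda>(X, G, Y). ins x X) (J b))"
      unfolding K_def map_bind_pmf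
      by (intro bind_pmf_cong refl) (auto simp: pmf.map_comp o_def split_def)
    also have "\<dots> = random_subset (set (e # es)) q1"
      unfolding J1 T1 using Cons.prems(3) by (simp add: random_subset_insert ins_def)
    finally show "map_pmf (\<lambda>(x, y, z). x) K = random_subset (set (e # es)) q1" .
    have "map_pmf (\<lambda>(x, y, z). z) K =
        bind_pmf T (\<lambda>(x, b, y). map_pmf (\<lambda>(X, G, Y). ins y Y) (J b))"
      unfolding K_def map_bind_pmf
      by (intro bind_pmf_cong refl) (auto simp: pmf.map_comp o_def split_def)
    also have "\<dots> = random_subset (set (e # es)) q2"
      unfolding J3 T3 using Cons.prems(3) by (simp add: random_subset_insert ins_def)
    finally show "map_pmf (\<lambda>(x, y, z). z) K = random_subset (set (e # es)) q2" .
    have "map_pmf (\<lambda>(x, y, z). y) K = bind_pmf (bernoulli_pmf a) (\<lambda>b. pmf_of_set (\<G>' b))"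
      using T2[of "\<lambda>b. pmf_of_set (\<G>' b)"]
      by (simp add: K_def map_bind_pmf pmf.map_comp o_def split_def J2[unfolded split_def])
    also have "\<dots> = pmf_of_set \<G>"
    proof (rule pmf_eqI)
      fix g
      have pos: "card (\<G>' b) > 0" "finite (\<G>' b)" "\<G>' b \<noteq> {}" for b
        using Cons.prems fin[of b] by (auto simp: \<G>'_def card_gt_0_iff)
      have *: "a * (indicator (\<G>' True) g / real (card (\<G>' True))) = indicator (\<G>b True) g / real (card \<G>)"
        using pos[of True] by (cases "\<G>b True = {}") (auto simp: \<G>'_def a_def)
      have **: "(1 - a) * (indicator (\<G>' False) g / real (card (\<G>' False))) =
          indicator (\<G>b False) g / real (card \<G>)"
        unfolding a' using pos[of False] by (cases "\<G>b False = {}") (auto simp: \<G>'_def)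
      have "pmf (bernoulli_pmf a \<bind> (\<lambda>b. pmf_of_set (\<G>' b))) g =
        a * (indicator (\<G>' True) g / real (card (\<G>' True))) +
        (1 - a) * (indicator (\<G>' False) g / real (card (\<G>' False)))"
        using a01 pos by (simp add: pmf_bind mult.commute)
      also have "\<dots> = indicator \<G> g / real (card \<G>)"
        unfolding * ** by (auto simp: \<G>b_def indicator_def)
      finally show "pmf (bernoulli_pmf a \<bind> (\<lambda>b. pmf_of_set (\<G>' b))) g = pmf (pmf_of_set \<G>) g"
        using Cons.prems by simp
    qed
    finally show "map_pmf (\<lambda>(x, y, z). y) K = pmf_of_set \<G>" .
  qed
  moreover have "measure_pmf.prob K {(X, G, Y). \<not> (X \<subseteq> G \<and> G \<inter> set (e # es) \<subseteq> Y)}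
      \<le> real (card (deviating \<G> q1 q2 (e # es))) / real (card \<G>)" (is "measure_pmf.prob K ?F \<le> ?rhs")
  proof (cases "a \<in> {q1 e..q2 e}")
    case False
    \<comment> \<open>Before anything is exposed the history class is all of \<open>\<G>\<close>, so
      a bad initial probability makes every graph deviating and the claimed bound is the trivial
      1.\<close>
    have "deviating \<G> q1 q2 (e # es) = \<G>"
      using False unfolding deviating_def history_class_def a_def \<G>b_def by fastforce
    then have "?rhs = 1" using cardG by simp
    then show ?thesis by simp
  next
    case True
    define F where "F = {(X, G, Y). \<not> (X \<subseteq> G \<and> G \<inter> set es \<subseteq> (Y :: 'e set))}"
    define h where "h = (\<lambda>b. measure_pmf.prob (J b) F)"
    have "measure_pmf.prob K ?F = measure_pmf.expectation T
       (\<lambda>(x, b, y). measure_pmf.prob (map_pmf (\<lambda>(X, G, Y). (ins x X, G, ins y Y)) (J b)) ?F)"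
      unfolding K_def prob_bind_pmf by (simp add: split_def)
    also have "\<dots> \<le> measure_pmf.expectation T (\<lambda>(x, b, y). h b)"
    proof (rule integral_mono_AE)
      show "integrable (measure_pmf T) (\<lambda>(x, b, y). h b)"
        by (rule measure_pmf.integrable_const_bound[where B = 1]) (auto simp: h_def)
      show "integrable (measure_pmf T)
        (\<lambda>(x, b, y). measure_pmf.prob (map_pmf (\<lambda>(X, G, Y). (ins x X, G, ins y Y)) (J b)) ?F)"
        by (rule measure_pmf.integrable_const_bound[where B = 1]) (auto simp: h_def)
      have "measure_pmf.prob (map_pmf (\<lambda>(X, G, Y). (ins x X, G, ins y Y)) (J b)) ?F \<le> h b"
        if xby: "(x, b, y) \<in> set_pmf T" for x b y
      proof -
        have key: "(X, G, Y) \<in> F"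
          if "(X, G, Y) \<in> set_pmf (J b)" "(ins x X, G, ins y Y) \<in> ?F" for X G Y
        proof -
          have "G \<in> set_pmf (map_pmf (\<lambda>(X, G, Y). G) (J b))"
            using imageI[OF that(1), of "\<lambda>(X, G, Y). G"] by simp
          then have "G \<in> \<G>b b"
            unfolding J2 using G'_eq[OF set_T[OF xby]] fin[of b] by simp
          then have "(e \<in> G) = b" by (simp add: \<G>b_def)
          moreover have "x \<longrightarrow> b" "b \<longrightarrow> y" using T_mono[OF True] xby by auto
          ultimately show ?thesis using that(2) unfolding F_def ins_def
            by (cases x; cases y) auto
        qed
        have "measure_pmf.prob (J b) ((\<lambda>(X, G, Y). (ins x X, G, ins y Y)) -` ?F)
           \<le> measure_pmf.prob (J b) F"
        proof (rule measure_pmf.finite_measure_mono_AE)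
          show "AE z in measure_pmf (J b).
              z \<in> (\<lambda>(X, G, Y). (ins x X, G, ins y Y)) -` ?F \<longrightarrow> z \<in> F"
            unfolding AE_measure_pmf_iff
          proof (intro ballI impI)
            fix z assume z: "z \<in> set_pmf (J b)" "z \<in> (\<lambda>(X, G, Y). (ins x X, G, ins y Y)) -` ?F"
            obtain X G Y where "z = (X, G, Y)" by (cases z)
            then show "z \<in> F" using key[of X G Y] z by simp
          qed
        qed simp
        then show ?thesis by (simp add: h_def)
      qed
      then show "AE x in measure_pmf T. (case x of (x, b, y) \<Rightarrow>
          measure_pmf.prob (map_pmf (\<lambda>(X, G, Y). (ins x X, G, ins y Y)) (J b)) ?F)
          \<le> (case x of (x, b, y) \<Rightarrow> h b)"
        by (auto simp: AE_measure_pmf_iff)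
    qed
    also have "\<dots> = measure_pmf.expectation (map_pmf (\<lambda>(x, b, y). b) T) h"
      by (simp add: split_def)
    also have "\<dots> = a * h True + (1 - a) * h False"
      using T a01 unfolding is_coupling3_def by simp
    also have "\<dots> \<le> real (card (deviating (\<G>b True) q1 q2 es)) / real (card \<G>) +
        real (card (deviating (\<G>b False) q1 q2 es)) / real (card \<G>)"
    proof (rule add_mono)
      show "a * h True \<le> real (card (deviating (\<G>b True) q1 q2 es)) / real (card \<G>)"
      proof (cases "\<G>b True = {}")
        case False
        then have "h True \<le> real (card (deviating (\<G>b True) q1 q2 es)) / real (card (\<G>b True))"
          using J_fail[of True] unfolding h_def F_def by (simp add: \<G>'_def)
        then have "a * h True \<le> a * (real (card (deviating (\<G>b True) q1 q2 es)) / real (card (\<G>b True)))"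
          using a01 by (intro mult_left_mono) auto
        then show ?thesis using False fin[of True] by (simp add: a_def)
      qed (simp add: a_def)
      show "(1 - a) * h False \<le> real (card (deviating (\<G>b False) q1 q2 es)) / real (card \<G>)"
      proof (cases "\<G>b False = {}")
        case False
        then have "h False \<le> real (card (deviating (\<G>b False) q1 q2 es)) / real (card (\<G>b False))"
          using J_fail[of False] unfolding h_def F_def by (simp add: \<G>'_def)
        then have "(1 - a) * h False \<le>
            (1 - a) * (real (card (deviating (\<G>b False) q1 q2 es)) / real (card (\<G>b False)))"
          using a01 by (intro mult_left_mono) auto
        then show ?thesis using False fin[of False] by (simp add: a')
      qed (simp add: a')
    qed
    also have "\<dots> = real (card (deviating (\<G>b True) q1 q2 es \<union> deviating (\<G>b False) q1 q2 es)) / real (card \<G>)"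
      using G_split(2) fin
      by (subst card_Un_disjoint) (auto simp: deviating_def add_divide_distrib)
    also have "\<dots> \<le> ?rhs"
    proof -
      \<comment> \<open>Restricting to one half is the same as having exposed \<open>e\<close>, so a
        deviation at step \<open>i\<close> of \<open>es\<close> is one at step \<open>Suc i\<close>
        of \<open>e # es\<close>.\<close>
      have "deviating (\<G>b b) q1 q2 es \<subseteq> deviating \<G> q1 q2 (e # es)" for b
      proof
        fix g assume g: "g \<in> deviating (\<G>b b) q1 q2 es"
        then obtain i where i: "i < length es" "real (card {G \<in> history_class (\<G>b b) (set (take i es)) g. es ! i \<in> G}) /
            real (card (history_class (\<G>b b) (set (take i es)) g)) \<notin> {q1 (es ! i)..q2 (es ! i)}"
          unfolding deviating_def by blast
        have gb: "g \<in> \<G>" "(e \<in> g) = b" using g by (auto simp: deviating_def \<G>b_def)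
        have "history_class (\<G>b b) (set (take i es)) g = history_class \<G> (set (take (Suc i) (e # es))) g"
          using gb unfolding history_class_def \<G>b_def by auto
        then show "g \<in> deviating \<G> q1 q2 (e # es)"
          unfolding deviating_def using i gb by (auto intro!: exI[of _ "Suc i"])
      qed
      then have "card (deviating (\<G>b True) q1 q2 es \<union> deviating (\<G>b False) q1 q2 es)
          \<le> card (deviating \<G> q1 q2 (e # es))"
        using Cons.prems(1) by (intro card_mono) (auto simp: deviating_def)
      then show ?thesis by (intro divide_right_mono) auto
    qed
    finally show ?thesis .
  qed
  ultimately show ?case by blast
qed

section \<open>Switchings\<close>

text \<open>With \<open>P\<close> the unexposed edges of \<open>G\<close> and \<open>Q\<close> its unexposed non-edges, these are the switchings that
  remove the edge \<open>{j, k}\<close>; with \<open>P\<close> and \<open>Q\<close> exchanged, those that create it.\<close>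

definition alternating_pairs :: "graph \<Rightarrow> graph \<Rightarrow> nat \<Rightarrow> nat \<Rightarrow> (nat \<times> nat) set" where
  "alternating_pairs P Q j k = {(u, v). {u, v} \<in> P \<and> {j, u} \<in> Q \<and> {k, v} \<in> Q}"

lemma card_alternating_pairs:
  "card (alternating_pairs P Q j k) = ecount P {u. {j, u} \<in> Q} {v. {k, v} \<in> Q}"
  unfolding alternating_pairs_def ecount_def by (rule arg_cong[where f = card]) auto

lemma all_edges_iff: "{u, v} \<in> all_edges n \<longleftrightarrow> u \<in> {1..n} \<and> v \<in> {1..n} \<and> u \<noteq> v"
  by (auto simp: all_edges_def card_insert_if)

lemma finite_graph: "G \<subseteq> all_edges n \<Longrightarrow> finite G"
  using finite_subset finite_all_edges by blast

lemma alternating_pairs_subset: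
  assumes "Q \<subseteq> all_edges n"
  shows "alternating_pairs P Q j k \<subseteq> {1..n} \<times> {1..n}"
proof
  fix x assume "x \<in> alternating_pairs P Q j k"
  then obtain u v where x: "x = (u, v)" "{j, u} \<in> Q" "{k, v} \<in> Q"
    by (auto simp: alternating_pairs_def)
  then have "{j, u} \<in> all_edges n" "{k, v} \<in> all_edges n" using assms by auto
  then show "x \<in> {1..n} \<times> {1..n}" unfolding x all_edges_iff by auto
qed

lemma finite_alternating_pairs:
  "Q \<subseteq> all_edges n \<Longrightarrow> finite (alternating_pairs P Q j k)"
  using finite_subset[OF alternating_pairs_subset] by blast

lemma alternating_pairs_mono:
  assumes "P \<subseteq> P'" "Q \<subseteq> Q'" "Q' \<subseteq> all_edges n"
  shows "card (alternating_pairs P Q j k) \<le> card (alternating_pairs P' Q' j k)"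
  by (rule card_mono[OF finite_alternating_pairs[OF assms(3)]])
     (use assms in \<open>auto simp: alternating_pairs_def\<close>)

lemma card_alternating_pairs_le:
  assumes "Q \<subseteq> all_edges n"
  shows "card (alternating_pairs P Q j k) \<le> n\<^sup>2"
  using card_mono[OF _ alternating_pairs_subset[OF assms]] by (simp add: power2_eq_square)

lemma vertex_degree_exchange:
  assumes "finite G" "P \<subseteq> G" "finite Q" "Q \<inter> G = {}"
    and "card {e \<in> P. x \<in> e} = card {e \<in> Q. x \<in> e}"
  shows "vertex_degree (G - P \<union> Q) x = vertex_degree G x"
proof -
  have fP: "finite P" using assms finite_subset by blast
  have "{e \<in> G - P \<union> Q. x \<in> e} = {e \<in> G - P. x \<in> e} \<union> {e \<in> Q. x \<in> e}" by auto
  then have "vertex_degree (G - P \<union> Q) x = card {e \<in> G - P. x \<in> e} + card {e \<in> Q. x \<in> e}"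
    unfolding vertex_degree_def using assms by (subst card_Un_disjoint[symmetric]) auto
  also have "\<dots> = card {e \<in> G - P. x \<in> e} + card {e \<in> P. x \<in> e}" using assms by simp
  also have "\<dots> = card ({e \<in> G - P. x \<in> e} \<union> {e \<in> P. x \<in> e})"
    using assms fP by (subst card_Un_disjoint) auto
  also have "{e \<in> G - P. x \<in> e} \<union> {e \<in> P. x \<in> e} = {e \<in> G. x \<in> e}" using assms by auto
  finally show ?thesis unfolding vertex_degree_def .
qed

lemma card_incident_pair:
  assumes "{a, b} \<inter> {c, d} = {}"
  shows "card {e \<in> {{a, b}, {c, d}}. x \<in> e} = of_bool (x \<in> {a, b, c, d})"
proof -
  consider "x \<in> {a, b}" | "x \<in> {c, d}" | "x \<notin> {a, b, c, d}" by blast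
  then show ?thesis
  proof cases
    case 1
    then have "{e \<in> {{a, b}, {c, d}}. x \<in> e} = {{a, b}}" using assms by blast
    then show ?thesis using 1 by auto
  next
    case 2
    then have "{e \<in> {{a, b}, {c, d}}. x \<in> e} = {{c, d}}" using assms by blast
    then show ?thesis using 2 by auto
  next
    case 3
    then have "{e \<in> {{a, b}, {c, d}}. x \<in> e} = {}" by blast
    then show ?thesis using 3 by auto
  qed
qed

text \<open>Both edge pairs are perfect matchings of the same four vertices, so exchanging them
  preserves all degrees; and as neither meets \<open>T\<close>, the history is preserved
  too.\<close>

lemma switching_in_class:
  assumes G: "G \<in> history_class (graphs_with_degrees n d) T g"
    and dist: "distinct [j, k, u, v]"
    and PQ: "P = {{j, k}, {u, v}} \<and> Q = {{j, u}, {k, v}} \<or> P = {{j, u}, {k, v}} \<and> Q = {{j, k}, {u, v}}"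
    and P: "P \<subseteq> G" "P \<inter> T = {}" and Q: "Q \<subseteq> all_edges n" "Q \<inter> G = {}" "Q \<inter> T = {}"
  shows "G - P \<union> Q \<in> history_class (graphs_with_degrees n d) T g"
proof -
  have Gs: "G \<subseteq> all_edges n" using G by (auto simp: history_class_def graphs_with_degrees_def)
  have "card {e \<in> P. x \<in> e} = card {e \<in> Q. x \<in> e}" for x
  proof -
    have "{j, k} \<inter> {u, v} = {}" "{j, u} \<inter> {k, v} = {}" "{j, k, u, v} = {j, u, k, v}"
      using dist by auto
    then have "card {e \<in> {{j, k}, {u, v}}. x \<in> e} = card {e \<in> {{j, u}, {k, v}}. x \<in> e}"
      by (simp only: card_incident_pair)
    then show ?thesis using PQ by (elim disjE conjE) (simp_all only:)
  qed
  moreover have "finite Q" using Q(1) finite_graph by blast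
  ultimately have "vertex_degree (G - P \<union> Q) x = vertex_degree G x" for x
    by (intro vertex_degree_exchange finite_graph[OF Gs] P Q)
  moreover have "(G - P \<union> Q) \<inter> T = G \<inter> T" using P Q by auto
  ultimately show ?thesis
    using G Q Gs by (auto simp: history_class_def graphs_with_degrees_def)
qed

text \<open>Since there are no loops, the only possible coincidences are \<open>u = k\<close> and
  \<open>v = j\<close>, and either would put \<open>{j, k}\<close> into \<open>Q\<close>.\<close>

lemma alternating_pairs_distinct:
  assumes "(u, v) \<in> alternating_pairs P Q j k" "P \<subseteq> all_edges n" "Q \<subseteq> all_edges n" "{j, k} \<notin> Q" "j \<noteq> k"
  shows "distinct [j, k, u, v]"
proof -
  have *: "{u, v} \<in> all_edges n" "{j, u} \<in> all_edges n" "{k, v} \<in> all_edges n" "{j, u} \<in> Q" "{k, v} \<in> Q"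
    using assms by (auto simp: alternating_pairs_def)
  have "u \<noteq> k" "v \<noteq> j" using * assms(4) by (auto simp: insert_commute)
  then show ?thesis using * assms(5) by (auto simp: all_edges_iff)
qed

text \<open>Both sides count pairs of a graph and a 4-cycle on which it alternates. Toggling the
  four pairs of the cycle while remembering \<open>(u, v)\<close> is a bijection between
  them.\<close>

lemma switching_double_count:
  fixes d g T n
  defines "C \<equiv> history_class (graphs_with_degrees n d) T g" and "U \<equiv> all_edges n - T"
  assumes jk: "{j, k} \<in> U"
  shows "(\<Sum>G | G \<in> C \<and> {j, k} \<in> G. card (alternating_pairs (U \<inter> G) (U - G) j k)) =
         (\<Sum>G | G \<in> C \<and> {j, k} \<notin> G. card (alternating_pairs (U - G) (U \<inter> G) j k))"
proof -
  define A where "A = {G \<in> C. {j, k} \<in> G}"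
  define B where "B = {G \<in> C. {j, k} \<notin> G}"
  define S where "S = (\<lambda>(u, v). {{j, k}, {u, v}, {j, u}, {k, v :: nat}})"
  \<comment> \<open>Written as a symmetric difference, one map serves both directions and is its own
    inverse.\<close>
  define f where "f = (\<lambda>(G, uv). ((G - S uv) \<union> (S uv - G), uv))"
  define F1 where "F1 = (\<lambda>G. alternating_pairs (U \<inter> G) (U - G) j k)"
  define F2 where "F2 = (\<lambda>G. alternating_pairs (U - G) (U \<inter> G) j k)"
  have jnk: "j \<noteq> k" using jk by (auto simp: U_def all_edges_iff)
  have ne: "{j, k} \<noteq> {u, v}" "{j, k} \<noteq> {j, u}" "{j, k} \<noteq> {k, v}" "{u, v} \<noteq> {j, u}"
    "{u, v} \<noteq> {k, v}" "{j, u} \<noteq> {k, v}" if "distinct [j, k, u, v]" for u v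
    using that by (auto simp: doubleton_eq_iff)
  have fwd: "f (G, uv) \<in> Sigma B F2" if GA: "G \<in> A" and uv: "uv \<in> F1 G" for G uv
  proof -
    obtain u v where [simp]: "uv = (u, v)" by (cases uv)
    have m: "{u, v} \<in> U \<inter> G" "{j, u} \<in> U - G" "{k, v} \<in> U - G" "{j, k} \<in> G"
      using uv GA by (auto simp: F1_def alternating_pairs_def A_def)
    have dist: "distinct [j, k, u, v]"
      using uv m(4) jnk by (intro alternating_pairs_distinct[of u v "U \<inter> G" "U - G" j k n])
         (auto simp: F1_def U_def)
    have eq: "(G - S uv) \<union> (S uv - G) = G - {{j, k}, {u, v}} \<union> {{j, u}, {k, v}}"
      using m by (auto simp: S_def)
    have "(G - S uv) \<union> (S uv - G) \<in> C"
      unfolding eq C_def using GA dist m jk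
      by (intro switching_in_class[of _ _ _ _ _ j k u v]) (auto simp: A_def C_def U_def)
    moreover define G' where "G' = (G - S uv) \<union> (S uv - G)"
    moreover have "{j, k} \<notin> G'" "{u, v} \<in> U - G'" "{j, u} \<in> U \<inter> G'" "{k, v} \<in> U \<inter> G'"
      unfolding G'_def eq using m jk ne[OF dist] by blast+
    ultimately have "G' \<in> B" "uv \<in> F2 G'"
      by (simp_all add: B_def F2_def alternating_pairs_def)
    then show ?thesis by (simp add: f_def G'_def)
  qed
  have bwd: "f (G, uv) \<in> Sigma A F1" if GB: "G \<in> B" and uv: "uv \<in> F2 G" for G uv
  proof -
    obtain u v where [simp]: "uv = (u, v)" by (cases uv)
    have m: "{u, v} \<in> U - G" "{j, u} \<in> U \<inter> G" "{k, v} \<in> U \<inter> G" "{j, k} \<notin> G"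
      using uv GB by (auto simp: F2_def alternating_pairs_def B_def)
    have dist: "distinct [j, k, u, v]"
      using uv m(4) jnk by (intro alternating_pairs_distinct[of u v "U - G" "U \<inter> G" j k n])
         (auto simp: F2_def U_def)
    have eq: "(G - S uv) \<union> (S uv - G) = G - {{j, u}, {k, v}} \<union> {{j, k}, {u, v}}"
      using m by (auto simp: S_def)
    have "(G - S uv) \<union> (S uv - G) \<in> C"
      unfolding eq C_def using GB dist m jk
      by (intro switching_in_class[of _ _ _ _ _ j k u v]) (auto simp: B_def C_def U_def)
    moreover define G' where "G' = (G - S uv) \<union> (S uv - G)"
    moreover have "{j, k} \<in> G'" "{u, v} \<in> U \<inter> G'" "{j, u} \<in> U - G'" "{k, v} \<in> U - G'"
      unfolding G'_def eq using m jk ne[OF dist] by blast+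
    ultimately have "G' \<in> A" "uv \<in> F1 G'"
      by (simp_all add: A_def F1_def alternating_pairs_def)
    then show ?thesis by (simp add: f_def G'_def)
  qed
  have ff: "f (f x) = x" for x
    by (cases x) (auto simp: f_def)
  have "bij_betw f (Sigma A F1) (Sigma B F2)"
    by (rule bij_betwI[where g = f]) (auto simp: ff intro: fwd bwd)
  then have card_eq: "card (Sigma A F1) = card (Sigma B F2)" by (rule bij_betw_same_card)
  have "C \<subseteq> Pow (all_edges n)" unfolding C_def by (auto simp: history_class_def graphs_with_degrees_def)
  then have fC: "finite C" using finite_subset by (metis finite_Pow_iff finite_all_edges)
  have fin: "finite (F1 G)" "finite (F2 G)" for G
    unfolding F1_def F2_def U_def by (rule finite_alternating_pairs[of _ n]; blast)+
  have "(\<Sum>G\<in>A. card (F1 G)) = (\<Sum>G\<in>B. card (F2 G))"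
    using card_eq fC by (subst (asm) (1 2) card_SigmaI) (auto simp: A_def B_def fin)
  then show ?thesis
    unfolding A_def B_def F1_def F2_def .
qed

text \<open>Good elements obey the sharp bounds \<open>lo\<close> and \<open>hi\<close>; bad ones
  only the trivial bound \<open>M\<close>, and there are too few of them to matter.
  \<open>lo \<le> M\<close> is what allows bad elements of \<open>B\<close> to be charged with
  \<open>M\<close> as well.\<close>

lemma double_count_bound:
  fixes f b :: "'a \<Rightarrow> real"
  assumes "finite A" "finite B" "A \<inter> B = {}"
    and eq: "(\<Sum>x\<in>A. f x) = (\<Sum>x\<in>B. b x)"
    and bad: "real (card ((A \<union> B) \<inter> bad)) \<le> \<eta> * real (card (A \<union> B))"
    and lo: "\<And>x. x \<in> B \<Longrightarrow> x \<notin> bad \<Longrightarrow> lo \<le> b x" and b0: "\<And>x. x \<in> B \<Longrightarrow> 0 \<le> b x"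
    and hi: "\<And>x. x \<in> A \<Longrightarrow> x \<notin> bad \<Longrightarrow> f x \<le> hi" and fM: "\<And>x. x \<in> A \<Longrightarrow> f x \<le> M"
    and "0 \<le> hi" "lo \<le> M" "0 \<le> M"
  shows "real (card B) * lo \<le> real (card A) * hi + \<eta> * real (card (A \<union> B)) * M"
proof -
  have "real (card B) * lo = real (card (B - bad)) * lo + real (card (B \<inter> bad)) * lo"
    using assms(2) by (metis Diff_Int_distrib2 card_Int_Diff distrib_right of_nat_add add.commute)
  also have "\<dots> \<le> (\<Sum>x\<in>B - bad. b x) + real (card (B \<inter> bad)) * M"
    using sum_mono[of "B - bad" "\<lambda>_. lo" b] lo assms by (intro add_mono mult_left_mono) auto
  also have "(\<Sum>x\<in>B - bad. b x) \<le> (\<Sum>x\<in>B. b x)"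
    using assms(2) b0 by (intro sum_mono2) auto
  also have "(\<Sum>x\<in>B. b x) = (\<Sum>x\<in>A - bad. f x) + (\<Sum>x\<in>A \<inter> bad. f x)"
    using eq assms(1) by (metis add.commute sum.Int_Diff)
  also have "(\<Sum>x\<in>A - bad. f x) \<le> (\<Sum>x\<in>A - bad. hi)"
    using hi by (intro sum_mono) auto
  also have "\<dots> \<le> real (card A) * hi"
    using assms by (auto intro!: mult_right_mono card_mono)
  also have "(\<Sum>x\<in>A \<inter> bad. f x) \<le> (\<Sum>x\<in>A \<inter> bad. M)"
    using fM by (intro sum_mono) auto
  finally have "real (card B) * lo \<le> real (card A) * hi +
      (real (card (A \<inter> bad)) + real (card (B \<inter> bad))) * M"
    by (simp add: algebra_simps)
  also have "real (card (A \<inter> bad)) + real (card (B \<inter> bad)) = real (card ((A \<union> B) \<inter> bad))"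
    using assms(1-3) by (subst Int_Un_distrib2, subst card_Un_disjoint) auto
  also have "real (card A) * hi + real (card ((A \<union> B) \<inter> bad)) * M \<le>
      real (card A) * hi + \<eta> * real (card (A \<union> B)) * M"
    using bad assms by (intro add_left_mono mult_right_mono) auto
  finally show ?thesis .
qed

text \<open>Without errors and with \<open>\<sigma> = \<tau>\<close>, the hypothesis reduces to
  \<open>(1 - a) * p \<le> a * (1 - p)\<close>, that is \<open>p \<le> a\<close>; the remaining
  terms track the errors. The opposite bound arises by replacing \<open>a\<close> and
  \<open>p\<close> with their complements.\<close>

lemma balance_arith:
  fixes a p \<sigma> \<tau> \<epsilon> \<eta> :: real
  assumes "(1 - a) * (p\<^sup>2 * (1 - p) * \<tau> - \<epsilon>) \<le> a * (p * (1 - p)\<^sup>2 * \<sigma> + \<epsilon>) + \<eta>"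
    and "0 \<le> a" "a \<le> 1" "0 \<le> p" "p \<le> 1" "\<tau> \<le> \<sigma>"
  shows "p * (1 - p) * \<sigma> * (p - a) \<le> \<epsilon> + \<eta> + (\<sigma> - \<tau>)"
proof -
  have "(1 - a) * p\<^sup>2 * (1 - p) \<le> 1"
    using assms by (intro mult_le_one) (auto simp: power_le_one)
  then have z: "(1 - a) * p\<^sup>2 * (1 - p) * (\<sigma> - \<tau>) \<le> \<sigma> - \<tau>"
    using assms mult_right_mono[of "(1 - a) * p\<^sup>2 * (1 - p)" 1 "\<sigma> - \<tau>"] by simp
  define x y z where "x = (1 - a) * (p\<^sup>2 * (1 - p) * \<tau> - \<epsilon>)"
    and "y = a * (p * (1 - p)\<^sup>2 * \<sigma> + \<epsilon>)" and "z = (1 - a) * p\<^sup>2 * (1 - p) * (\<sigma> - \<tau>)"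
  have "p * (1 - p) * \<sigma> * (p - a) = x - y + \<epsilon> + z"
    by (simp add: x_def y_def z_def algebra_simps power2_eq_square)
  then show ?thesis using assms(1) z unfolding x_def[symmetric] y_def[symmetric] z_def[symmetric]
    by linarith
qed

text \<open>The numbers of switchings are monotone in the set \<open>U\<close> of unexposed pairs, so it is enough to
  control them at the two label levels \<open>Ulo\<close> and \<open>Uhi\<close> around \<open>U\<close>.\<close>

lemma class_edge_ratio:
  fixes d g T n
  defines "C \<equiv> history_class (graphs_with_degrees n d) T g" and "U \<equiv> all_edges n - T"
  assumes jk: "{j, k} \<in> U" and C: "C \<noteq> {}" and n: "n > 0"
    and U: "Ulo \<subseteq> U" "U \<subseteq> Uhi" "Uhi \<subseteq> all_edges n"
    and bad: "real (card (C \<inter> bad)) \<le> \<eta> * real (card C)"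
    and p: "0 \<le> p" "p \<le> 1" and st: "0 \<le> \<tau>" "\<tau> \<le> \<sigma>" "\<sigma> \<le> 1" and \<epsilon>: "0 \<le> \<epsilon>"
    and f_hi: "\<And>G. G \<in> C - bad \<Longrightarrow> real (card (alternating_pairs (Uhi \<inter> G) (Uhi - G) j k))
                   \<le> (p * (1 - p)\<^sup>2 * \<sigma> + \<epsilon>) * (real n)\<^sup>2"
    and f_lo: "\<And>G. G \<in> C - bad \<Longrightarrow> real (card (alternating_pairs (Ulo \<inter> G) (Ulo - G) j k))
                   \<ge> (p * (1 - p)\<^sup>2 * \<tau> - \<epsilon>) * (real n)\<^sup>2"
    and b_hi: "\<And>G. G \<in> C - bad \<Longrightarrow> real (card (alternating_pairs (Uhi - G) (Uhi \<inter> G) j k))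
                   \<le> (p\<^sup>2 * (1 - p) * \<sigma> + \<epsilon>) * (real n)\<^sup>2"
    and b_lo: "\<And>G. G \<in> C - bad \<Longrightarrow> real (card (alternating_pairs (Ulo - G) (Ulo \<inter> G) j k))
                   \<ge> (p\<^sup>2 * (1 - p) * \<tau> - \<epsilon>) * (real n)\<^sup>2"
  shows "p * (1 - p) * \<sigma> * \<bar>real (card {G \<in> C. {j, k} \<in> G}) / real (card C) - p\<bar>
           \<le> \<epsilon> + \<eta> + (\<sigma> - \<tau>)"
proof -
  define A where "A = {G \<in> C. {j, k} \<in> G}"
  define B where "B = {G \<in> C. {j, k} \<notin> G}"
  define f where "f = (\<lambda>G. real (card (alternating_pairs (U \<inter> G) (U - G) j k)))"
  define b where "b = (\<lambda>G. real (card (alternating_pairs (U - G) (U \<inter> G) j k)))"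
  have "C \<subseteq> Pow (all_edges n)" unfolding C_def by (auto simp: history_class_def graphs_with_degrees_def)
  then have fC: "finite C" using finite_subset by (metis finite_Pow_iff finite_all_edges)
  have fin: "finite A" "finite B" "A \<inter> B = {}" "B \<inter> A = {}" and un: "A \<union> B = C" "B \<union> A = C"
    using fC by (auto simp: A_def B_def)
  have cC: "real (card C) > 0" using fC C by (simp add: card_gt_0_iff)
  have cAB: "real (card B) = real (card C) - real (card A)"
    using card_Un_disjoint[OF fin(1-3)] un by simp
  have eq: "(\<Sum>G\<in>A. f G) = (\<Sum>G\<in>B. b G)"
    using switching_double_count[of j k n T d g] jk
    unfolding A_def B_def f_def b_def C_def U_def by (simp flip: of_nat_sum)
  have Us: "U \<subseteq> all_edges n" "U - G \<subseteq> all_edges n" "U \<inter> G \<subseteq> all_edges n"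
    "Uhi - G \<subseteq> all_edges n" "Uhi \<inter> G \<subseteq> all_edges n" for G
    using U by (auto simp: U_def)
  have M: "f G \<le> (real n)\<^sup>2" "b G \<le> (real n)\<^sup>2" for G
    unfolding f_def b_def using card_alternating_pairs_le[OF Us(2), of "U \<inter> G" G j k]
      card_alternating_pairs_le[OF Us(3), of "U - G" G j k] by (simp_all flip: of_nat_power)
  have mono: "real (card (alternating_pairs (Ulo \<inter> G) (Ulo - G) j k)) \<le> f G"
    "f G \<le> real (card (alternating_pairs (Uhi \<inter> G) (Uhi - G) j k))"
    "real (card (alternating_pairs (Ulo - G) (Ulo \<inter> G) j k)) \<le> b G"
    "b G \<le> real (card (alternating_pairs (Uhi - G) (Uhi \<inter> G) j k))" for G
    unfolding f_def b_def of_nat_le_iff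
    by (rule alternating_pairs_mono[where n = n]; use U Us in blast)+
  have pp: "0 \<le> p * (1 - p)\<^sup>2 * \<sigma>" "0 \<le> p\<^sup>2 * (1 - p) * \<sigma>" using p st by auto
  have "p * (1 - p)\<^sup>2 * \<tau> \<le> 1" "p\<^sup>2 * (1 - p) * \<tau> \<le> 1"
    using p st by (auto intro!: mult_le_one simp: power_le_one)
  then have loM: "(p * (1 - p)\<^sup>2 * \<tau> - \<epsilon>) * (real n)\<^sup>2 \<le> (real n)\<^sup>2"
    "(p\<^sup>2 * (1 - p) * \<tau> - \<epsilon>) * (real n)\<^sup>2 \<le> (real n)\<^sup>2"
    using mult_right_mono[of "p * (1 - p)\<^sup>2 * \<tau> - \<epsilon>" 1 "(real n)\<^sup>2"]
      mult_right_mono[of "p\<^sup>2 * (1 - p) * \<tau> - \<epsilon>" 1 "(real n)\<^sup>2"] \<epsilon> by auto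
  have 1: "real (card B) * ((p\<^sup>2 * (1 - p) * \<tau> - \<epsilon>) * (real n)\<^sup>2) \<le>
      real (card A) * ((p * (1 - p)\<^sup>2 * \<sigma> + \<epsilon>) * (real n)\<^sup>2) + \<eta> * real (card (A \<union> B)) * (real n)\<^sup>2"
  proof (rule double_count_bound[OF fin(1-3) eq])
    show "(p\<^sup>2 * (1 - p) * \<tau> - \<epsilon>) * (real n)\<^sup>2 \<le> b G" if "G \<in> B" "G \<notin> bad" for G
      using b_lo[of G] mono(3)[of G] that by (auto simp: B_def)
    show "f G \<le> (p * (1 - p)\<^sup>2 * \<sigma> + \<epsilon>) * (real n)\<^sup>2" if "G \<in> A" "G \<notin> bad" for G
      using f_hi[of G] mono(2)[of G] that by (auto simp: A_def)
    show "0 \<le> (p * (1 - p)\<^sup>2 * \<sigma> + \<epsilon>) * (real n)\<^sup>2" using pp \<epsilon> by (intro mult_nonneg_nonneg) auto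
    show "real (card ((A \<union> B) \<inter> bad)) \<le> \<eta> * real (card (A \<union> B))" using bad un by simp
  qed (use M loM in \<open>simp_all add: b_def\<close>)
  have 2: "real (card A) * ((p * (1 - p)\<^sup>2 * \<tau> - \<epsilon>) * (real n)\<^sup>2) \<le>
      real (card B) * ((p\<^sup>2 * (1 - p) * \<sigma> + \<epsilon>) * (real n)\<^sup>2) + \<eta> * real (card (B \<union> A)) * (real n)\<^sup>2"
  proof (rule double_count_bound[OF fin(2,1,4) eq[symmetric]])
    show "(p * (1 - p)\<^sup>2 * \<tau> - \<epsilon>) * (real n)\<^sup>2 \<le> f G" if "G \<in> A" "G \<notin> bad" for G
      using f_lo[of G] mono(1)[of G] that by (auto simp: A_def)
    show "b G \<le> (p\<^sup>2 * (1 - p) * \<sigma> + \<epsilon>) * (real n)\<^sup>2" if "G \<in> B" "G \<notin> bad" for G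
      using b_hi[of G] mono(4)[of G] that by (auto simp: B_def)
    show "0 \<le> (p\<^sup>2 * (1 - p) * \<sigma> + \<epsilon>) * (real n)\<^sup>2" using pp \<epsilon> by (intro mult_nonneg_nonneg) auto
    show "real (card ((B \<union> A) \<inter> bad)) \<le> \<eta> * real (card (B \<union> A))" using bad un by simp
  qed (use M loM in \<open>simp_all add: f_def\<close>)
  define a where "a = real (card A) / real (card C)"
  have a: "real (card A) = a * real (card C)" "real (card B) = (1 - a) * real (card C)"
    unfolding a_def cAB using cC by (auto simp: field_simps)
  have a01: "0 \<le> a" "a \<le> 1"
    unfolding a_def using cC cAB by (auto simp: field_simps)
  have pos: "real (card C) * (real n)\<^sup>2 > 0" using cC n by simp
  have "((1 - a) * (p\<^sup>2 * (1 - p) * \<tau> - \<epsilon>)) * (real (card C) * (real n)\<^sup>2) \<le>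
      (a * (p * (1 - p)\<^sup>2 * \<sigma> + \<epsilon>) + \<eta>) * (real (card C) * (real n)\<^sup>2)"
    using 1 unfolding un a by (simp add: algebra_simps)
  then have "(1 - a) * (p\<^sup>2 * (1 - p) * \<tau> - \<epsilon>) \<le> a * (p * (1 - p)\<^sup>2 * \<sigma> + \<epsilon>) + \<eta>"
    using pos by (simp add: mult_le_cancel_right)
  then have b1: "p * (1 - p) * \<sigma> * (p - a) \<le> \<epsilon> + \<eta> + (\<sigma> - \<tau>)"
    using a01 p st by (intro balance_arith) auto
  have "(a * (p * (1 - p)\<^sup>2 * \<tau> - \<epsilon>)) * (real (card C) * (real n)\<^sup>2) \<le>
      ((1 - a) * (p\<^sup>2 * (1 - p) * \<sigma> + \<epsilon>) + \<eta>) * (real (card C) * (real n)\<^sup>2)"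
    using 2 unfolding un a by (simp add: algebra_simps)
  then have "a * (p * (1 - p)\<^sup>2 * \<tau> - \<epsilon>) \<le> (1 - a) * (p\<^sup>2 * (1 - p) * \<sigma> + \<epsilon>) + \<eta>"
    using pos by (simp add: mult_le_cancel_right)
  \<comment> \<open>The second double count is the first one with edges and non-edges exchanged,
    hence with \<open>1 - p\<close> and \<open>1 - a\<close> for \<open>p\<close> and
    \<open>a\<close>.\<close>
  then have "(1 - p) * (1 - (1 - p)) * \<sigma> * ((1 - p) - (1 - a)) \<le> \<epsilon> + \<eta> + (\<sigma> - \<tau>)"
    using a01 p st by (intro balance_arith) (auto simp: mult.commute mult.left_commute)
  then have b2: "p * (1 - p) * \<sigma> * (a - p) \<le> \<epsilon> + \<eta> + (\<sigma> - \<tau>)"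
    by (simp add: mult.commute mult.left_commute)
  show ?thesis
    using b1 b2 unfolding a_def A_def by (cases "p \<le> real (card {G \<in> C. {j, k} \<in> G}) / real (card C)") (auto simp: abs_if)
qed

section \<open>Repairing degree sequences\<close>

lemma ecount_eq_sum_rows:
  assumes "finite A" "finite B"
  shows "ecount W A B = (\<Sum>a\<in>A. card {b \<in> B. {a, b} \<in> W})"
proof -
  have "{(u, v) \<in> A \<times> B. {u, v} \<in> W} = (SIGMA a:A. {b \<in> B. {a, b} \<in> W})" by auto
  then show ?thesis unfolding ecount_def using assms by simp
qed

lemma vertex_degree_eq_card:
  assumes "W \<subseteq> all_edges n" "x \<in> {1..n}"
  shows "vertex_degree W x = card {v \<in> {1..n}. {x, v} \<in> W}"
proof -
  have "bij_betw (\<lambda>v. {x, v}) {v \<in> {1..n}. {x, v} \<in> W} {e \<in> W. x \<in> e}"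
  proof (rule bij_betw_imageI)
    show "inj_on (\<lambda>v. {x, v}) {v \<in> {1..n}. {x, v} \<in> W}"
      by (auto simp: inj_on_def doubleton_eq_iff)
    have "e \<in> (\<lambda>v. {x, v}) ` {v \<in> {1..n}. {x, v} \<in> W}" if "e \<in> W" "x \<in> e" for e
    proof -
      have e: "e \<subseteq> {1..n}" "card e = 2" using that assms by (auto simp: all_edges_def)
      then obtain v where "e = {x, v}" using \<open>x \<in> e\<close>
        by (metis card_2_iff doubleton_eq_iff insertE singletonD)
      then show ?thesis using e that by auto
    qed
    moreover have "(\<lambda>v. {x, v}) ` {v \<in> {1..n}. {x, v} \<in> W} \<subseteq> {e \<in> W. x \<in> e}"
      by (rule image_subsetI) simp
    ultimately show "(\<lambda>v. {x, v}) ` {v \<in> {1..n}. {x, v} \<in> W} = {e \<in> W. x \<in> e}"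
      by (metis (no_types, lifting) mem_Collect_eq subsetI subset_antisym)
  qed
  from bij_betw_same_card[OF this] show ?thesis by (simp only: vertex_degree_def)
qed

lemma sum_vertex_degree:
  assumes "W \<subseteq> all_edges n" "A \<subseteq> {1..n}"
  shows "(\<Sum>x\<in>A. vertex_degree W x) = ecount W A {1..n}"
  using assms finite_subset[OF assms(2)]
  by (auto simp: ecount_eq_sum_rows vertex_degree_eq_card intro!: sum.cong)

lemma card_ordered_pairs_eq:
  assumes "e \<in> all_edges n"
  shows "card {(u, v) \<in> {1..n} \<times> {1..n}. {u, v} = e} = 2"
proof -
  obtain a b where e: "e = {a, b}" "a \<noteq> b" using assms by (auto simp: all_edges_def card_2_iff)
  have "{(u, v) \<in> {1..n} \<times> {1..n}. {u, v} = e} = {(a, b), (b, a)}"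
    using assms unfolding e by (auto simp: doubleton_eq_iff all_edges_def)
  then show ?thesis using e by simp
qed

lemma ecount_full:
  assumes "W \<subseteq> all_edges n"
  shows "ecount W {1..n} {1..n} = 2 * card W"
proof -
  have "ecount W {1..n} {1..n} = (\<Sum>e\<in>W. 2)"
    unfolding ecount_eq_sum[OF finite_graph[OF assms] finite_atLeastAtMost finite_atLeastAtMost]
    by (rule sum.cong[OF refl], rule card_ordered_pairs_eq) (use assms in blast)
  then show ?thesis by simp
qed

lemma handshake:
  assumes "W \<subseteq> all_edges n"
  shows "(\<Sum>x\<in>{1..n}. vertex_degree W x) = 2 * card W"
  using sum_vertex_degree[OF assms order_refl] ecount_full[OF assms] by simp

lemma ecount_mono_add:
  assumes "W \<subseteq> all_edges n" "finite A" "finite B"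
  shows "ecount W A B \<le> ecount W' A B + 2 * card (W - W')"
proof -
  have "ecount W A B \<le> card ({(u, v) \<in> A \<times> B. {u, v} \<in> W'} \<union> {(u, v) \<in> A \<times> B. {u, v} \<in> W - W'})"
    unfolding ecount_def using assms
    by (intro card_mono finite_UnI) (auto intro: finite_subset[of _ "A \<times> B"])
  also have "\<dots> \<le> ecount W' A B + ecount (W - W') A B"
    unfolding ecount_def by (rule card_Un_le)
  also have "ecount (W - W') A B = (\<Sum>e\<in>W - W'. card {(u, v) \<in> A \<times> B. {u, v} = e})"
    using finite_graph[OF assms(1)] assms(2,3) by (intro ecount_eq_sum) auto
  also have "\<dots> \<le> (\<Sum>e\<in>W - W'. 2)"
    by (rule sum_mono, rule card_ordered_pairs_le) (use assms(1) in \<open>auto simp: all_edges_def\<close>)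
  finally show ?thesis by simp
qed

text \<open>Each vertex gives up as many incident edges as it has in excess. The choices at
  different vertices are not coordinated, so a degree may drop below its target; such deficits are
  repaired afterwards.\<close>

lemma delete_excess:
  assumes "finite W" "finite V"
  obtains W1 where "W1 \<subseteq> W" "\<And>j. j \<in> V \<Longrightarrow> vertex_degree W1 j \<le> d j"
    "card (W - W1) \<le> (\<Sum>j\<in>V. vertex_degree W j - d j)"
proof -
  have "\<exists>F\<subseteq>{e \<in> W. j \<in> e}. card F = vertex_degree W j - d j" for j
    by (metis obtain_subset_with_card_n vertex_degree_def diff_le_self)
  then obtain F where F: "\<And>j. F j \<subseteq> {e \<in> W. j \<in> e}" "\<And>j. card (F j) = vertex_degree W j - d j"
    by metis
  define W1 where "W1 = W - (\<Union>j\<in>V. F j)"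
  have "vertex_degree W1 j \<le> d j" if "j \<in> V" for j
  proof -
    have "vertex_degree W1 j \<le> card ({e \<in> W. j \<in> e} - F j)"
      unfolding vertex_degree_def W1_def using assms that by (intro card_mono) auto
    also have "\<dots> = vertex_degree W j - (vertex_degree W j - d j)"
      using F[of j] assms by (subst card_Diff_subset) (auto simp: vertex_degree_def intro: finite_subset)
    finally show ?thesis by simp
  qed
  moreover have "card (W - W1) \<le> (\<Sum>j\<in>V. vertex_degree W j - d j)"
  proof -
    have "card (W - W1) \<le> card (\<Union>j\<in>V. F j)"
      unfolding W1_def using assms F by (intro card_mono) (auto intro: finite_subset[of _ W])
    also have "\<dots> \<le> (\<Sum>j\<in>V. card (F j))" using assms(2) by (rule card_UN_le)
    finally show ?thesis using F by simp
  qed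
  ultimately show thesis using that[of W1] by (auto simp: W1_def)
qed

lemma vertex_degree_insert:
  assumes "finite W" "e \<notin> W"
  shows "vertex_degree (insert e W) x = vertex_degree W x + of_bool (x \<in> e)"
proof -
  have "{f \<in> insert e W. x \<in> f} = (if x \<in> e then insert e {f \<in> W. x \<in> f} else {f \<in> W. x \<in> f})"
    by auto
  then show ?thesis unfolding vertex_degree_def using assms by simp
qed

lemma card_sym_diff_triangle:
  assumes "finite A" "finite B" "finite C"
  shows "card (sym_diff A C) \<le> card (sym_diff A B) + card (sym_diff B C)"
proof -
  have "card (sym_diff A C) \<le> card (sym_diff A B \<union> sym_diff B C)"
    using assms by (intro card_mono) auto
  also have "\<dots> \<le> card (sym_diff A B) + card (sym_diff B C)" by (rule card_Un_le)
  finally show ?thesis .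
qed

text \<open>Two units of deficit, at \<open>v\<close> and \<open>v'\<close>, are removed by replacing an edge \<open>{w, w'}\<close> with
  \<open>{v, w}\<close> and \<open>{v', w'}\<close>, where \<open>w\<close> and \<open>w'\<close> are non-neighbours of \<open>v\<close> and \<open>v'\<close>.\<close>

lemma repair_deficit:
  fixes x :: real
  assumes "W \<subseteq> all_edges n" "\<And>j. j \<in> {1..n} \<Longrightarrow> vertex_degree W j \<le> d j"
    "(\<Sum>j\<in>{1..n}. d j - vertex_degree W j) = 2 * k"
    "\<And>j. j \<in> {1..n} \<Longrightarrow> x \<le> real n - real (d j)"
    "\<And>A B. A \<subseteq> {1..n} \<Longrightarrow> B \<subseteq> {1..n} \<Longrightarrow> x \<le> real (card A) \<Longrightarrow> x \<le> real (card B) \<Longrightarrow> 2 * k < ecount W A B"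
  shows "\<exists>H\<in>graphs_with_degrees n d. card (sym_diff W H) \<le> 3 * k"
  using assms
proof (induction k arbitrary: W)
  case 0
  then have "\<forall>j\<in>{1..n}. d j - vertex_degree W j = 0" by simp
  then have "W \<in> graphs_with_degrees n d"
    using 0 by (fastforce simp: graphs_with_degrees_def intro: antisym)
  then show ?case by force
next
  case (Suc k)
  note W = Suc.prems(1)
  define def where "def = (\<lambda>j. d j - vertex_degree W j)"
  have sum_def: "(\<Sum>j\<in>{1..n}. def j) = 2 * k + 2" using Suc.prems(3) by (simp add: def_def)
  then obtain v where v: "v \<in> {1..n}" "def v > 0"
    by (metis add_is_0 neq0_conv sum.neutral zero_neq_numeral)
  \<comment> \<open>The total deficit is even, so if \<open>v\<close> lacks a single edge some other
    vertex is deficient as well; otherwise \<open>v\<close> itself can take both new edges.\<close>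
  obtain v' where v': "v' \<in> {1..n}" "def v' > 0" "v = v' \<Longrightarrow> def v \<ge> 2"
  proof (cases "def v \<ge> 2")
    case True then show ?thesis using that v by blast
  next
    case False
    then have "def v = 1" using v by simp
    then have "(\<Sum>j\<in>{1..n} - {v}. def j) = 2 * k + 1"
      using sum_def v by (simp add: sum.remove[of _ v])
    then obtain v' where "v' \<in> {1..n} - {v}" "def v' > 0"
      by (metis add_is_0 neq0_conv sum.neutral zero_neq_one)
    then show ?thesis using that by auto
  qed
  define nb where "nb = (\<lambda>v. {w \<in> {1..n}. w \<noteq> v \<and> {v, w} \<notin> W})"
  \<comment> \<open>The missing degree at \<open>v\<close> makes up for the exclusion of
    \<open>v\<close> from its own non-neighbours, so \<open>n - d v\<close> choices remain.\<close>
  have nb: "x \<le> real (card (nb v))" if "v \<in> {1..n}" "def v > 0" for v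
  proof -
    have "{1..n} - {v} = nb v \<union> {w \<in> {1..n}. {v, w} \<in> W}"
      using W that by (auto simp: nb_def dest!: subsetD simp: all_edges_def)
    then have "card ({1..n} - {v}) \<le> card (nb v) + card {w \<in> {1..n}. {v, w} \<in> W}"
      by (metis card_Un_le)
    then have "n - 1 \<le> card (nb v) + vertex_degree W v"
      using that vertex_degree_eq_card[OF W] by simp
    moreover have "vertex_degree W v < d v" using that by (simp add: def_def)
    ultimately have "real n \<le> real (card (nb v)) + real (d v)" by linarith
    then show ?thesis using Suc.prems(4)[OF that(1)] by linarith
  qed
  have "2 * Suc k < ecount W (nb v) (nb v')"
    using nb v v' by (intro Suc.prems(5)) (auto simp: nb_def)
  then have "{(u, w) \<in> nb v \<times> nb v'. {u, w} \<in> W} \<noteq> {}"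
    unfolding ecount_def by (metis card.empty not_less_zero)
  then obtain w w' where w: "w \<in> nb v" "w' \<in> nb v'" "{w, w'} \<in> W" by auto
  have wne: "w \<noteq> v" "w' \<noteq> v'" "{v, w} \<notin> W" "{v', w'} \<notin> W" "w \<in> {1..n}" "w' \<in> {1..n}"
    using w by (auto simp: nb_def)
  have ww: "w \<noteq> w'" using w(3) W by (auto simp: all_edges_def)
  have ne: "{v, w} \<noteq> {v', w'}"
    using wne ww w(3) by (auto simp: doubleton_eq_iff insert_commute)
  define W0 where "W0 = W - {{w, w'}}"
  define W' where "W' = insert {v, w} (insert {v', w'} W0)"
  have fW: "finite W" "finite W0" using finite_graph[OF W] by (auto simp: W0_def)
  have W's: "W' \<subseteq> all_edges n"
    using W wne v v' by (auto simp: W'_def W0_def all_edges_iff)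
  have deg: "vertex_degree W' y = vertex_degree W y + of_bool (y = v) + of_bool (y = v')" for y
  proof -
    have "vertex_degree W y = vertex_degree W0 y + of_bool (y \<in> {w, w'})"
      using vertex_degree_insert[of W0 "{w, w'}" y] fW w(3) by (simp add: W0_def insert_absorb)
    moreover have "vertex_degree W' y = vertex_degree W0 y + of_bool (y \<in> {v', w'}) + of_bool (y \<in> {v, w})"
      unfolding W'_def using fW wne ne
      by (subst vertex_degree_insert, simp, simp add: W0_def)
         (subst vertex_degree_insert, simp, simp add: W0_def, simp)
    ultimately show ?thesis using wne ww by auto
  qed
  have def': "d y - vertex_degree W' y + of_bool (y = v) + of_bool (y = v') = def y"
    and le': "vertex_degree W' y \<le> d y" if "y \<in> {1..n}" for y
    using v v' Suc.prems(2)[OF that] unfolding deg def_def by auto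
  have "\<exists>H\<in>graphs_with_degrees n d. card (sym_diff W' H) \<le> 3 * k"
  proof (rule Suc.IH[OF W's le'])
    have "(\<Sum>j\<in>{1..n}. d j - vertex_degree W' j) + 2 =
        (\<Sum>j\<in>{1..n}. d j - vertex_degree W' j + of_bool (j = v) + of_bool (j = v'))"
      using v v' by (simp add: sum.distrib of_bool_def)
    also have "\<dots> = 2 * k + 2" using def' sum_def by simp
    finally show "(\<Sum>j\<in>{1..n}. d j - vertex_degree W' j) = 2 * k" by simp
    show "2 * k < ecount W' A B"
      if "A \<subseteq> {1..n}" "B \<subseteq> {1..n}" "x \<le> real (card A)" "x \<le> real (card B)" for A B
    proof -
      \<comment> \<open>The one deleted edge accounts for at most 2 ordered pairs, which is exactly
        what the required bound drops from \<open>2 * Suc k\<close> to \<open>2 * k\<close>.\<close>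
      have "W - W' \<subseteq> {{w, w'}}" by (auto simp: W'_def W0_def)
      then have "card (W - W') \<le> 1" using card_mono[of "{{w, w'}}"] by simp
      moreover have "ecount W A B \<le> ecount W' A B + 2 * card (W - W')"
        using that W by (intro ecount_mono_add) (auto intro: finite_subset)
      moreover have "2 * Suc k < ecount W A B" using that by (rule Suc.prems(5))
      ultimately show ?thesis by simp
    qed
  qed (use Suc.prems in auto)
  then obtain H where H: "H \<in> graphs_with_degrees n d" "card (sym_diff W' H) \<le> 3 * k" by blast
  have fH: "finite H" "finite W'" using H finite_graph W's by (auto simp: graphs_with_degrees_def)
  have "sym_diff W W' \<subseteq> {{w, w'}, {v, w}, {v', w'}}" by (auto simp: W'_def W0_def)
  then have "card (sym_diff W W') \<le> card {{w, w'}, {v, w}, {v', w'}}" by (intro card_mono) auto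
  also have "\<dots> \<le> 3" using card_length[of "[{w, w'}, {v, w}, {v', w'}]"] by simp
  finally have "card (sym_diff W H) \<le> 3 + 3 * k"
    using card_sym_diff_triangle[OF fW(1) fH(2,1)] H(2) by linarith
  then show ?case using H by (intro bexI[of _ H]) auto
qed

text \<open>Closeness in cut norm to the constant density \<open>p\<close>. The main term includes
  the diagonal of \<open>A \<times> B\<close>, whose at most \<open>n\<close> entries are always
  absorbed by the tolerance.\<close>

definition cut_regular :: "nat \<Rightarrow> real \<Rightarrow> real \<Rightarrow> graph \<Rightarrow> bool" where
  "cut_regular n p \<epsilon> W \<longleftrightarrow> (\<forall>A B. A \<subseteq> {1..n} \<longrightarrow> B \<subseteq> {1..n} \<longrightarrow>
     \<bar>real (ecount W A B) - p * real (card A) * real (card B)\<bar> \<le> \<epsilon> * (real n)\<^sup>2)"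

text \<open>Cut regularity bounds the total excess by \<open>2 * \<epsilon> * n\<^sup>2\<close>;
  together with the edge count this leaves a deficit \<open>2 * k\<close> of at most
  \<open>5 * \<epsilon> * n\<^sup>2\<close>. Deletions and \<open>3 * k\<close> repair edits stay
  below \<open>10 * \<epsilon> * n\<^sup>2\<close>. The repair also needs edges between sets of size
  \<open>c * n\<close>: these have at least \<open>c ^ 3 * n\<^sup>2\<close> ordered pairs minus
  \<open>\<epsilon> * n\<^sup>2\<close> for irregularity and
  \<open>4 * \<epsilon> * n\<^sup>2\<close> for deletions, which exceeds the deficit as
  \<open>10 * \<epsilon> < c ^ 3\<close>.\<close>

lemma cut_regular_near_degree_graph:
  assumes W: "W \<subseteq> all_edges n" and cut: "cut_regular n p \<epsilon> W"
    and d: "\<And>j. j \<in> {1..n} \<Longrightarrow> (p - \<epsilon>) * real n \<le> real (d j) \<and> real (d j) \<le> p * real n"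
    and ev: "even (\<Sum>j\<in>{1..n}. d j)"
    and p: "c \<le> p" "p \<le> 1 - c" "0 < c" and \<epsilon>: "0 < \<epsilon>" "10 * \<epsilon> < c ^ 3" and n: "0 < n"
  shows "\<exists>H\<in>graphs_with_degrees n d. real (card (sym_diff W H)) \<le> 10 * \<epsilon> * (real n)\<^sup>2"
proof -
  define V where "V = {1..n}"
  have V: "finite V" "card V = n" by (auto simp: V_def)
  have cutD: "\<bar>real (ecount W A B) - p * real (card A) * real (card B)\<bar> \<le> \<epsilon> * (real n)\<^sup>2"
    if "A \<subseteq> V" "B \<subseteq> V" for A B
    using cut that unfolding cut_regular_def V_def by blast
  obtain W1 where W1: "W1 \<subseteq> W" "\<And>j. j \<in> V \<Longrightarrow> vertex_degree W1 j \<le> d j"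
    "card (W - W1) \<le> (\<Sum>j\<in>V. vertex_degree W j - d j)"
    using delete_excess[OF finite_graph[OF W] V(1), of d] by metis
  have W1s: "W1 \<subseteq> all_edges n" using W1(1) W by blast
  \<comment> \<open>On the vertices with positive excess truncated subtraction is exact, so the
    excess is governed by the single cut \<open>A \<times> V\<close>.\<close>
  define A where "A = {j \<in> V. d j < vertex_degree W j}"
  have AV: "A \<subseteq> V" "card A \<le> n" using card_mono[of V A] V by (auto simp: A_def)
  have "real (\<Sum>j\<in>V. vertex_degree W j - d j) = real (\<Sum>j\<in>A. vertex_degree W j - d j)"
    using V by (intro arg_cong[where f = real] sum.mono_neutral_right) (auto simp: A_def)
  also have "\<dots> = (\<Sum>j\<in>A. real (vertex_degree W j) - real (d j))"
    unfolding of_nat_sum by (rule sum.cong) (auto simp: A_def)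
  also have "\<dots> = real (ecount W A V) - (\<Sum>j\<in>A. real (d j))"
    using sum_vertex_degree[OF W, of A] AV unfolding V_def sum_subtractf
    by (metis of_nat_sum)
  also have "\<dots> \<le> (p * real (card A) * real n + \<epsilon> * (real n)\<^sup>2) - (\<Sum>j\<in>A. (p - \<epsilon>) * real n)"
    using cutD[OF AV(1), of V] V d AV(1) by (intro diff_mono sum_mono) (auto simp: V_def)
  also have "\<dots> = \<epsilon> * (real n)\<^sup>2 + \<epsilon> * real n * real (card A)"
    by (simp add: algebra_simps)
  also have "\<epsilon> * real n * real (card A) \<le> \<epsilon> * real n * real n"
    using AV \<epsilon> by (intro mult_left_mono) auto
  finally have "real (\<Sum>j\<in>V. vertex_degree W j - d j) \<le> 2 * \<epsilon> * (real n)\<^sup>2"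
    by (simp add: power2_eq_square)
  then have del: "real (card (W - W1)) \<le> 2 * \<epsilon> * (real n)\<^sup>2"
    using W1(3) by (meson of_nat_mono order_trans)
  have sum_eq: "(\<Sum>j\<in>V. d j - vertex_degree W1 j) + 2 * card W1 = (\<Sum>j\<in>V. d j)"
  proof -
    have "(\<Sum>j\<in>V. d j - vertex_degree W1 j) + (\<Sum>j\<in>V. vertex_degree W1 j) = (\<Sum>j\<in>V. d j)"
      unfolding sum.distrib[symmetric] by (rule sum.cong) (auto simp: W1(2))
    then show ?thesis using handshake[OF W1s] by (simp add: V_def)
  qed
  then have "even (\<Sum>j\<in>V. d j - vertex_degree W1 j)"
    using ev unfolding V_def by (metis dvd_triv_left even_add)
  then obtain k where k: "(\<Sum>j\<in>V. d j - vertex_degree W1 j) = 2 * k" by blast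
  have "card W = card W1 + card (W - W1)"
    using finite_graph[OF W] W1(1) by (metis card_Diff_subset card_mono finite_subset le_add_diff_inverse)
  moreover have "real (\<Sum>j\<in>V. d j) \<le> p * (real n)\<^sup>2"
    using sum_mono[of V "\<lambda>j. real (d j)" "\<lambda>_. p * real n"] d V
    by (simp add: V_def power2_eq_square algebra_simps)
  moreover have "p * (real n)\<^sup>2 - \<epsilon> * (real n)\<^sup>2 \<le> 2 * real (card W)"
    using cutD[of V V] ecount_full[OF W] V by (simp add: V_def power2_eq_square algebra_simps)
  moreover have "real (\<Sum>j\<in>V. d j) = 2 * real k + 2 * real (card W1)"
    using arg_cong[OF sum_eq[unfolded k], of real]
    by (simp only: of_nat_add of_nat_mult of_nat_numeral)
  ultimately have k_le: "2 * real k \<le> 5 * \<epsilon> * (real n)\<^sup>2"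
    using del by simp
  have "\<exists>H\<in>graphs_with_degrees n d. card (sym_diff W1 H) \<le> 3 * k"
  proof (rule repair_deficit[OF W1s, where x = "c * real n"])
    show "vertex_degree W1 j \<le> d j" if "j \<in> {1..n}" for j using W1(2) that by (simp add: V_def)
    show "(\<Sum>j = 1..n. d j - vertex_degree W1 j) = 2 * k" using k by (simp add: V_def)
    show "c * real n \<le> real n - real (d j)" if "j \<in> {1..n}" for j
    proof -
      have "p * real n \<le> (1 - c) * real n" using p by (intro mult_right_mono) auto
      then show ?thesis using d[OF that] by (simp add: algebra_simps)
    qed
    show "2 * k < ecount W1 A B"
      if "A \<subseteq> {1..n}" "B \<subseteq> {1..n}" "c * real n \<le> real (card A)" "c * real n \<le> real (card B)" for A B
    proof -
      have "c * (c * real n) * (c * real n) \<le> p * real (card A) * real (card B)"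
        using that p by (intro mult_mono) auto
      then have "c ^ 3 * (real n)\<^sup>2 \<le> real (ecount W A B) + \<epsilon> * (real n)\<^sup>2"
        using cutD[of A B] that by (simp add: V_def power2_eq_square power3_eq_cube algebra_simps)
      moreover have "ecount W A B \<le> ecount W1 A B + 2 * card (W - W1)"
        using that W by (intro ecount_mono_add) (auto intro: finite_subset)
      moreover have "10 * \<epsilon> * (real n)\<^sup>2 < c ^ 3 * (real n)\<^sup>2"
        using \<epsilon> n by (intro mult_strict_right_mono) auto
      ultimately have "2 * real k < real (ecount W1 A B)"
        using del k_le by linarith
      then show ?thesis by simp
    qed
  qed
  then obtain H where H: "H \<in> graphs_with_degrees n d" "card (sym_diff W1 H) \<le> 3 * k" by blast
  have "card (sym_diff W H) \<le> card (sym_diff W W1) + card (sym_diff W1 H)"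
    using H finite_graph W W1s by (intro card_sym_diff_triangle) (auto simp: graphs_with_degrees_def)
  also have "sym_diff W W1 = W - W1" using W1(1) by blast
  finally have "real (card (sym_diff W H)) \<le> 10 * \<epsilon> * (real n)\<^sup>2"
    using H(2) del k_le by linarith
  then show ?thesis using H(1) by blast
qed

section \<open>Cut regularity\<close>

lemma set_pmf_binomial_random_graph: "W \<in> set_pmf (binomial_random_graph n p) \<Longrightarrow> W \<subseteq> all_edges n"
  by (auto simp: binomial_random_graph_def)

lemma pmf_binomial_random_graph:
  assumes "0 \<le> p" "p \<le> 1" and W: "W \<subseteq> all_edges n"
  shows "pmf (binomial_random_graph n p) W = (\<Prod>e\<in>all_edges n. if e \<in> W then p else 1 - p)"
proof -
  define D where "D = Pi_pmf (all_edges n) False (\<lambda>_. bernoulli_pmf p)"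
  have "pmf (binomial_random_graph n p) W = measure_pmf.prob D ((\<lambda>X. {e \<in> all_edges n. X e}) -` {W})"
    unfolding binomial_random_graph_def D_def by (rule pmf_map)
  also have "\<dots> = measure_pmf.prob D {\<lambda>e. e \<in> W}"
  proof (rule measure_pmf.finite_measure_eq_AE)
    have "X \<in> (\<lambda>X. {e \<in> all_edges n. X e}) -` {W} \<longleftrightarrow> X \<in> {\<lambda>e. e \<in> W}" if "X \<in> set_pmf D" for X
    proof -
      have "\<forall>e. e \<notin> all_edges n \<longrightarrow> X e = False"
        using subsetD[OF set_Pi_pmf_subset[OF finite_all_edges[of n]] that[unfolded D_def]] by simp
      then show ?thesis using W by auto
    qed
    then show "AE X in measure_pmf D. (X \<in> (\<lambda>X. {e \<in> all_edges n. X e}) -` {W}) = (X \<in> {\<lambda>e. e \<in> W})"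
      by (auto simp: AE_measure_pmf_iff)
  qed auto
  also have "\<dots> = pmf D (\<lambda>e. e \<in> W)" by (rule measure_pmf_single)
  also have "\<dots> = (\<Prod>e\<in>all_edges n. pmf (bernoulli_pmf p) (e \<in> W))"
    unfolding D_def using W by (intro pmf_Pi') auto
  also have "\<dots> = (\<Prod>e\<in>all_edges n. if e \<in> W then p else 1 - p)"
    using assms by (intro prod.cong) auto
  finally show ?thesis .
qed

lemma pmf_binomial_random_graph_card:
  assumes "0 \<le> p" "p \<le> 1" and W: "W \<subseteq> all_edges n"
  shows "pmf (binomial_random_graph n p) W = p ^ card W * (1 - p) ^ (card (all_edges n) - card W)"
proof -
  have "(\<Prod>e\<in>all_edges n. if e \<in> W then p else 1 - p) =
      (\<Prod>e\<in>W. p) * (\<Prod>e\<in>all_edges n - W. 1 - p)"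
    using prod.If_cases[of "all_edges n" "\<lambda>e. e \<in> W" "\<lambda>_. p" "\<lambda>_. 1 - p"] W
    by (simp add: Int_absorb1 Diff_eq)
  then show ?thesis
    unfolding pmf_binomial_random_graph[OF assms] using card_Diff_subset[OF finite_graph[OF W] W] by simp
qed

text \<open>Toggling one pair multiplies the probability by \<open>p / (1 - p)\<close> or its
  inverse, and both are at least \<open>c\<close>.\<close>

lemma pmf_binomial_random_graph_edit:
  assumes "0 < c" "c \<le> p" "p \<le> 1 - c" and W: "W \<subseteq> all_edges n" and D: "D \<subseteq> all_edges n"
  shows "c ^ card D * pmf (binomial_random_graph n p) W \<le> pmf (binomial_random_graph n p) (sym_diff W D)"
proof -
  have WD: "sym_diff W D \<subseteq> all_edges n" using W D by auto
  have "c ^ card D = (\<Prod>e\<in>all_edges n. if e \<in> D then c else 1)"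
    using prod.If_cases[of "all_edges n" "\<lambda>e. e \<in> D" "\<lambda>_. c" "\<lambda>_. 1"] D
    by (simp add: Int_absorb1)
  then have "c ^ card D * pmf (binomial_random_graph n p) W =
      (\<Prod>e\<in>all_edges n. (if e \<in> D then c else 1) * (if e \<in> W then p else 1 - p))"
    using assms by (simp add: pmf_binomial_random_graph prod.distrib)
  also have "\<dots> \<le> (\<Prod>e\<in>all_edges n. if e \<in> sym_diff W D then p else 1 - p)"
  proof (rule prod_mono)
    fix e
    have "c * p \<le> 1 - p" "c * (1 - p) \<le> p"
      using assms(1-3) mult_left_mono[of p 1 c] mult_left_mono[of "1 - p" 1 c] by linarith+
    then show "0 \<le> (if e \<in> D then c else 1) * (if e \<in> W then p else 1 - p) \<and>
       (if e \<in> D then c else 1) * (if e \<in> W then p else 1 - p) \<le> (if e \<in> sym_diff W D then p else 1 - p)"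
      using assms by auto
  qed
  also have "\<dots> = pmf (binomial_random_graph n p) (sym_diff W D)"
    using assms WD by (subst pmf_binomial_random_graph) auto
  finally show ?thesis .
qed

lemma sum_power_card_Pow:
  fixes x :: real
  assumes "finite A"
  shows "(\<Sum>D\<in>Pow A. x ^ card D) = (1 + x) ^ card A"
proof -
  have "(\<Prod>e\<in>A. x + 1) = (\<Sum>D\<in>Pow A. (\<Prod>e\<in>D. x) * (\<Prod>e\<in>A - D. 1))"
    by (rule prod_add[OF assms])
  then show ?thesis by (simp add: add.commute)
qed

text \<open>The factor \<open>c ^ k\<close> pays for changing the probability of a graph by \<open>k\<close> edits, and
  \<open>(1 + x) ^ N / x ^ k\<close> bounds the number of edit sets of size at most \<open>k\<close>.\<close>

lemma edit_distance_prob: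
  assumes c: "0 < c" "c \<le> p" "p \<le> 1 - c" and x: "0 < x" "x \<le> 1"
    and \<G>: "\<G> \<subseteq> Pow (all_edges n)"
    and near: "\<And>W. W \<subseteq> all_edges n \<Longrightarrow> R W \<Longrightarrow> \<exists>H\<in>\<G>. card (sym_diff W H) \<le> k"
  shows "(c * x) ^ k * measure_pmf.prob (binomial_random_graph n p) {W. R W} \<le>
     (1 + x) ^ card (all_edges n) * measure_pmf.prob (binomial_random_graph n p) \<G>"
proof -
  define M where "M = binomial_random_graph n p"
  define \<D> where "\<D> = {D \<in> Pow (all_edges n). card D \<le> k}"
  have fG: "finite \<G>" using \<G> by (simp add: finite_subset)
  have fD: "finite \<D>" by (auto simp: \<D>_def)
  have c1: "c \<le> 1" using c by linarith
  \<comment> \<open>Union bound over the set \<open>D\<close> of pairs whose status has to be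
    changed to reach \<open>\<G>\<close>.\<close>
  have "measure_pmf.prob M {W. R W} \<le> measure_pmf.prob M (\<Union>D\<in>\<D>. {W. sym_diff W D \<in> \<G>})"
  proof (rule measure_pmf.finite_measure_mono_AE)
    have "\<exists>D\<in>\<D>. sym_diff W D \<in> \<G>" if WM: "W \<in> set_pmf M" "R W" for W
    proof -
      have W: "W \<subseteq> all_edges n" using WM set_pmf_binomial_random_graph by (auto simp: M_def)
      obtain H where H: "H \<in> \<G>" "card (sym_diff W H) \<le> k" using near[OF W WM(2)] by (elim bexE)
      have "sym_diff W (sym_diff W H) = H" by auto
      then have "sym_diff W (sym_diff W H) \<in> \<G>" using H by (simp only:)
      moreover have "H \<subseteq> all_edges n" using H \<G> by blast
      then have "sym_diff W H \<subseteq> all_edges n" using W by (intro Un_least) (simp_all add: le_infI1 Diff_subset_conv le_supI2)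
      then have "sym_diff W H \<in> \<D>" unfolding \<D>_def using H(2) by (intro CollectI conjI PowI)
      ultimately show ?thesis by (rule bexI)
    qed
    then show "AE W in measure_pmf M. W \<in> {W. R W} \<longrightarrow> W \<in> (\<Union>D\<in>\<D>. {W. sym_diff W D \<in> \<G>})"
      unfolding AE_measure_pmf_iff by simp
  qed simp
  also have "\<dots> \<le> (\<Sum>D\<in>\<D>. measure_pmf.prob M {W. sym_diff W D \<in> \<G>})"
    by (rule measure_pmf.finite_measure_subadditive_finite) (use fD in auto)
  finally have "(c * x) ^ k * measure_pmf.prob M {W. R W} \<le>
      (c * x) ^ k * (\<Sum>D\<in>\<D>. measure_pmf.prob M {W. sym_diff W D \<in> \<G>})"
    using c x by (intro mult_left_mono) auto
  also have "\<dots> = (\<Sum>D\<in>\<D>. x ^ k * (c ^ k * measure_pmf.prob M {W. sym_diff W D \<in> \<G>}))"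
    by (simp add: sum_distrib_left power_mult_distrib mult_ac)
  also have "\<dots> \<le> (\<Sum>D\<in>\<D>. x ^ card D * measure_pmf.prob M \<G>)"
  proof (rule sum_mono, rule mult_mono)
    fix D assume D: "D \<in> \<D>"
    then have Ds: "D \<subseteq> all_edges n" "card D \<le> k" by (auto simp: \<D>_def)
    \<comment> \<open>Spending \<open>x ^ k\<close> weights each edit set by its own power of
      \<open>x\<close>, so the sum over small edit sets can be extended to all of them and evaluated
      in closed form.\<close>
    show "x ^ k \<le> x ^ card D" using Ds x by (intro power_decreasing) auto
    have invol: "sym_diff (sym_diff W D) D = W" for W :: graph by auto
    have eq: "{W. sym_diff W D \<in> \<G>} = (\<lambda>H. sym_diff H D) ` \<G>"
    proof (intro equalityI subsetI)
      fix W assume "W \<in> {W. sym_diff W D \<in> \<G>}"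
      then have "sym_diff W D \<in> \<G>" by simp
      then show "W \<in> (\<lambda>H. sym_diff H D) ` \<G>"
        by (rule image_eqI[where f = "\<lambda>H. sym_diff H D" and x = "sym_diff W D", OF invol[symmetric]])
    next
      fix W assume "W \<in> (\<lambda>H. sym_diff H D) ` \<G>"
      then obtain H where "H \<in> \<G>" "W = sym_diff H D" by blast
      then show "W \<in> {W. sym_diff W D \<in> \<G>}" by (simp only: invol mem_Collect_eq)
    qed
    have inj: "inj_on (\<lambda>H. sym_diff H D) \<G>" by (rule inj_on_inverseI[where g = "\<lambda>H. sym_diff H D"]) (rule invol)
    have "measure_pmf.prob M {W. sym_diff W D \<in> \<G>} = (\<Sum>H\<in>\<G>. pmf M (sym_diff H D))"
      unfolding eq using fG inj by (subst measure_measure_pmf_finite) (auto simp: sum.reindex)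
    then have "c ^ k * measure_pmf.prob M {W. sym_diff W D \<in> \<G>} = (\<Sum>H\<in>\<G>. c ^ k * pmf M (sym_diff H D))"
      by (simp add: sum_distrib_left)
    also have "\<dots> \<le> (\<Sum>H\<in>\<G>. pmf M H)"
    proof (rule sum_mono)
      fix H assume H: "H \<in> \<G>"
      have "c ^ k * pmf M (sym_diff H D) \<le> c ^ card D * pmf M (sym_diff H D)"
        using Ds c c1 by (intro mult_right_mono power_decreasing) auto
      also have "\<dots> \<le> pmf M (sym_diff (sym_diff H D) D)"
        unfolding M_def using H \<G> Ds c by (intro pmf_binomial_random_graph_edit) auto
      finally show "c ^ k * pmf M (sym_diff H D) \<le> pmf M H" unfolding invol .
    qed
    also have "\<dots> = measure_pmf.prob M \<G>" using fG by (simp add: measure_measure_pmf_finite)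
    finally show "c ^ k * measure_pmf.prob M {W. sym_diff W D \<in> \<G>} \<le> measure_pmf.prob M \<G>" .
  qed (use c x in auto)
  also have "\<dots> = (\<Sum>D\<in>\<D>. x ^ card D) * measure_pmf.prob M \<G>" by (simp add: sum_distrib_right)
  also have "\<dots> \<le> (\<Sum>D\<in>Pow (all_edges n). x ^ card D) * measure_pmf.prob M \<G>"
    using x by (intro mult_right_mono sum_mono2) (auto simp: \<D>_def)
  finally show ?thesis unfolding sum_power_card_Pow[OF finite_all_edges] M_def .
qed

section \<open>Cut regularity of the binomial graph and its transfer to fixed degrees\<close>

lemma ecount_all_edges:
  assumes "A \<subseteq> {1..n}" "B \<subseteq> {1..n}"
  shows "real (card A) * real (card B) - real n \<le> real (ecount (all_edges n) A B)"
    "real (ecount (all_edges n) A B) \<le> real (card A) * real (card B)"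
proof -
  have fin: "finite A" "finite B" using assms finite_subset by auto
  have "A \<times> B \<subseteq> {(u, v) \<in> A \<times> B. {u, v} \<in> all_edges n} \<union> (\<lambda>u. (u, u)) ` {1..n}"
    using assms by (auto simp: all_edges_iff)
  then have "card (A \<times> B) \<le> card ({(u, v) \<in> A \<times> B. {u, v} \<in> all_edges n} \<union> (\<lambda>u. (u, u)) ` {1..n})"
    using fin by (intro card_mono) (auto intro: finite_subset[of _ "A \<times> B"])
  also have "\<dots> \<le> ecount (all_edges n) A B + card ((\<lambda>u. (u, u)) ` {1..n})"
    unfolding ecount_def by (rule card_Un_le)
  also have "card ((\<lambda>u. (u, u)) ` {1..n}) \<le> n" using card_image_le[of "{1..n}" "\<lambda>u. (u, u)"] by simp
  finally have "card A * card B \<le> ecount (all_edges n) A B + n" by (simp add: card_cartesian_product)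
  then have "real (card A * card B) \<le> real (ecount (all_edges n) A B + n)" by (simp only: of_nat_le_iff)
  then show "real (card A) * real (card B) - real n \<le> real (ecount (all_edges n) A B)" by simp
  show "real (ecount (all_edges n) A B) \<le> real (card A) * real (card B)"
    using ecount_le[OF fin, of "all_edges n"] by (simp flip: of_nat_mult)
qed

lemma card_subset_interval_le: "A \<subseteq> {1..n} \<Longrightarrow> card A \<le> n"
  using card_mono[of "{1..n}" A] by simp

text \<open>The host graph \<open>E\<close> is kept general for two uses: the complete graph gives
  cut regularity of the binomial graph, and a fixed graph or its complement gives the effect of the
  random labels.\<close>

lemma ecount_concentration_uniform:
  assumes r: "0 \<le> r" "r \<le> 1" and \<epsilon>: "0 < \<epsilon>" and n: "0 < n" and E: "E \<subseteq> all_edges n"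
  shows "measure_pmf.prob (binomial_random_graph n r)
      {R. \<exists>A B. A \<subseteq> {1..n} \<and> B \<subseteq> {1..n} \<and>
        \<epsilon> * (real n)\<^sup>2 \<le> \<bar>real (ecount (E \<inter> R) A B) - r * real (ecount E A B)\<bar>}
     \<le> 2 * 4 ^ n * exp (- \<epsilon>\<^sup>2 * (real n)\<^sup>2)" (is "measure_pmf.prob ?M ?S \<le> _")
proof -
  define I where "I = Pow {1..n} \<times> Pow {1..n}"
  define F where "F = (\<lambda>(A, B). {R. \<epsilon> * (real n)\<^sup>2 \<le> \<bar>real (ecount (E \<inter> R) A B) - r * real (ecount E A B)\<bar>})"
  have S: "?S = (\<Union>AB\<in>I. F AB)" unfolding I_def F_def by auto
  have "measure_pmf.prob ?M ?S \<le> (\<Sum>AB\<in>I. measure_pmf.prob ?M (F AB))"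
    unfolding S by (rule measure_pmf.finite_measure_subadditive_finite) (auto simp: I_def)
  also have "\<dots> \<le> (\<Sum>AB\<in>I. 2 * exp (- \<epsilon>\<^sup>2 * (real n)\<^sup>2))"
  proof (rule sum_mono)
    fix AB assume "AB \<in> I"
    then obtain A B where AB: "AB = (A, B)" "A \<subseteq> {1..n}" "B \<subseteq> {1..n}" by (auto simp: I_def)
    have "real (card A * card B) \<le> real (n * n)"
      using AB card_subset_interval_le by (simp only: of_nat_le_iff) (intro mult_le_mono; blast)
    then have "measure_pmf.prob ?M (F AB) \<le> 2 * exp (- (\<epsilon> * (real n)\<^sup>2)\<^sup>2 / (real n)\<^sup>2)"
      unfolding F_def AB(1) prod.case using AB r \<epsilon> n E
      by (intro ecount_concentration) (auto intro: finite_subset simp: power2_eq_square)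
    also have "- (\<epsilon> * (real n)\<^sup>2)\<^sup>2 / (real n)\<^sup>2 = - \<epsilon>\<^sup>2 * (real n)\<^sup>2"
      using n by (simp add: power2_eq_square)
    finally show "measure_pmf.prob ?M (F AB) \<le> 2 * exp (- \<epsilon>\<^sup>2 * (real n)\<^sup>2)" .
  qed
  also have "\<dots> = 2 * 4 ^ n * exp (- \<epsilon>\<^sup>2 * (real n)\<^sup>2)"
    by (simp add: I_def card_cartesian_product card_Pow power_mult_distrib[symmetric])
  finally show ?thesis .
qed

text \<open>Half of the tolerance goes to the concentration bound; the other half covers the missing
  diagonal, as \<open>2 / \<epsilon> \<le> n\<close> gives
  \<open>n \<le> \<epsilon> / 2 * n\<^sup>2\<close>.\<close>

lemma cut_regular_whp:
  assumes p: "0 \<le> p" "p \<le> 1" and \<epsilon>: "0 < \<epsilon>" and n: "2 / \<epsilon> \<le> real n" "0 < n"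
  shows "measure_pmf.prob (binomial_random_graph n p) {W. \<not> cut_regular n p \<epsilon> W}
     \<le> 2 * 4 ^ n * exp (- (\<epsilon> / 2)\<^sup>2 * (real n)\<^sup>2)"
proof -
  have "measure_pmf.prob (binomial_random_graph n p) {W. \<not> cut_regular n p \<epsilon> W} \<le>
    measure_pmf.prob (binomial_random_graph n p) {R. \<exists>A B. A \<subseteq> {1..n} \<and> B \<subseteq> {1..n} \<and>
        \<epsilon> / 2 * (real n)\<^sup>2 \<le> \<bar>real (ecount (all_edges n \<inter> R) A B) - p * real (ecount (all_edges n) A B)\<bar>}"
  proof (rule measure_pmf.finite_measure_mono_AE)
    have "\<exists>A B. A \<subseteq> {1..n} \<and> B \<subseteq> {1..n} \<and>
        \<epsilon> / 2 * (real n)\<^sup>2 \<le> \<bar>real (ecount (all_edges n \<inter> W) A B) - p * real (ecount (all_edges n) A B)\<bar>"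
      if W: "W \<in> set_pmf (binomial_random_graph n p)" "\<not> cut_regular n p \<epsilon> W" for W
    proof -
      have W': "all_edges n \<inter> W = W" using set_pmf_binomial_random_graph[OF W(1)] by blast
      obtain A B where AB: "A \<subseteq> {1..n}" "B \<subseteq> {1..n}"
        "\<epsilon> * (real n)\<^sup>2 < \<bar>real (ecount W A B) - p * real (card A) * real (card B)\<bar>"
        using W(2) unfolding cut_regular_def by (meson not_le)
      define x where "x = real (card A) * real (card B) - real (ecount (all_edges n) A B)"
      have x: "0 \<le> x" "x \<le> real n" using ecount_all_edges[OF AB(1,2)] by (auto simp: x_def)
      have "p * x \<le> 1 * real n" using p x by (intro mult_mono) auto
      moreover have "0 \<le> p * x" using p x by auto
      moreover have "real n \<le> \<epsilon> / 2 * (real n)\<^sup>2"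
        using n \<epsilon> mult_right_mono[of "2 / \<epsilon>" "real n" "real n"]
        by (simp add: field_simps power2_eq_square)
      moreover have "real (ecount W A B) - p * real (card A) * real (card B) =
          (real (ecount W A B) - p * real (ecount (all_edges n) A B)) - p * x"
        by (simp add: x_def algebra_simps)
      ultimately have "\<epsilon> / 2 * (real n)\<^sup>2 \<le> \<bar>real (ecount W A B) - p * real (ecount (all_edges n) A B)\<bar>"
        using AB(3) by linarith
      then show ?thesis using AB W' by auto
    qed
    then show "AE W in measure_pmf (binomial_random_graph n p). W \<in> {W. \<not> cut_regular n p \<epsilon> W} \<longrightarrow>
       W \<in> {R. \<exists>A B. A \<subseteq> {1..n} \<and> B \<subseteq> {1..n} \<and>
        \<epsilon> / 2 * (real n)\<^sup>2 \<le> \<bar>real (ecount (all_edges n \<inter> R) A B) - p * real (ecount (all_edges n) A B)\<bar>}"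
      unfolding AE_measure_pmf_iff by blast
  qed simp
  also have "\<dots> \<le> 2 * 4 ^ n * exp (- (\<epsilon> / 2)\<^sup>2 * (real n)\<^sup>2)"
    using p \<epsilon> n by (intro ecount_concentration_uniform) auto
  finally show ?thesis .
qed

text \<open>Graphs with the same degrees have the same number of edges and hence the same binomial
  probability. The binomial graph conditioned on its degrees is therefore uniform; the resulting
  bound on conditional probability is stated without division.\<close>

lemma uniform_vs_binomial:
  assumes p: "0 < p" "p < 1"
  shows "real (card {G \<in> graphs_with_degrees n d. B G}) * measure_pmf.prob (binomial_random_graph n p) (graphs_with_degrees n d)
    \<le> real (card (graphs_with_degrees n d)) * measure_pmf.prob (binomial_random_graph n p) {G. B G}"
proof -
  define \<G> where "\<G> = graphs_with_degrees n d"
  define m where "m = (\<Sum>j\<in>{1..n}. d j) div 2"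
  define P0 where "P0 = p ^ m * (1 - p) ^ (card (all_edges n) - m)"
  have fG: "finite \<G>" unfolding \<G>_def graphs_with_degrees_def
    by (rule finite_subset[of _ "Pow (all_edges n)"]) auto
  have pmf: "pmf (binomial_random_graph n p) H = P0" if "H \<in> \<G>" for H
  proof -
    have H: "H \<subseteq> all_edges n" "\<And>j. j \<in> {1..n} \<Longrightarrow> vertex_degree H j = d j"
      using that by (auto simp: \<G>_def graphs_with_degrees_def)
    then have "card H = m" using handshake[OF H(1)] by (simp add: m_def)
    then show ?thesis using pmf_binomial_random_graph_card[of p H n] H p by (simp add: P0_def)
  qed
  have "measure_pmf.prob (binomial_random_graph n p) \<G> = real (card \<G>) * P0"
    using fG pmf by (simp add: measure_measure_pmf_finite)
  moreover have "real (card {G \<in> \<G>. B G}) * P0 = measure_pmf.prob (binomial_random_graph n p) {G \<in> \<G>. B G}"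
    using fG pmf by (simp add: measure_measure_pmf_finite)
  moreover have "\<dots> \<le> measure_pmf.prob (binomial_random_graph n p) {G. B G}"
    by (rule measure_pmf.finite_measure_mono) auto
  ultimately have "real (card \<G>) * (real (card {G \<in> \<G>. B G}) * P0) \<le>
      real (card \<G>) * measure_pmf.prob (binomial_random_graph n p) {G. B G}"
    and "measure_pmf.prob (binomial_random_graph n p) \<G> = real (card \<G>) * P0"
    by (auto intro!: mult_left_mono)
  then show ?thesis unfolding \<G>_def[symmetric] by (simp add: mult_ac)
qed

lemma card_all_edges_le: "card (all_edges n) \<le> n\<^sup>2"
proof -
  have "all_edges n \<subseteq> (\<lambda>(u, v). {u, v}) ` ({1..n} \<times> {1..n})"
    unfolding all_edges_def by (auto simp: card_2_iff)
  then have "card (all_edges n) \<le> card ((\<lambda>(u, v). {u, v :: nat}) ` ({1..n} \<times> {1..n}))"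
    by (intro card_mono) auto
  also have "\<dots> \<le> card ({1..n} \<times> {1..n})" by (rule card_image_le) auto
  finally show ?thesis by (simp add: power2_eq_square)
qed

text \<open>With \<open>\<zeta> = \<epsilon>\<^sup>2 / 8\<close>, the binomial graph is irregular
  with probability at most \<open>2 * 4 ^ n * exp (- 2 * \<zeta> * n\<^sup>2)\<close>, while it has
  degrees \<open>d\<close> with probability at least \<open>exp (- \<zeta> * n\<^sup>2) / 2\<close>.
  The quotient is the stated bound.\<close>

lemma degree_graphs_cut_regular:
  fixes c \<epsilon> :: real
  assumes c: "0 < c" and \<epsilon>: "0 < \<epsilon>"
  shows "\<exists>\<delta>>0. \<exists>n0. \<forall>n\<ge>n0. \<forall>p d. c \<le> p \<longrightarrow> p \<le> 1 - c \<longrightarrow>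
    (\<forall>j\<in>{1..n}. (p - \<delta>) * real n \<le> real (d j) \<and> real (d j) \<le> p * real n) \<longrightarrow>
    even (\<Sum>j\<in>{1..n}. d j) \<longrightarrow>
    real (card {G \<in> graphs_with_degrees n d. \<not> cut_regular n p \<epsilon> G})
      \<le> 4 * 4 ^ n * exp (- (\<epsilon>\<^sup>2 / 8) * (real n)\<^sup>2) * real (card (graphs_with_degrees n d))"
proof (cases "c \<le> 1")
  case False
  then show ?thesis by (intro exI[of _ 1] conjI exI[of _ 0]) auto
next
  case c1: True
  define \<zeta> where "\<zeta> = \<epsilon>\<^sup>2 / 8"
  \<comment> \<open>The budget \<open>\<zeta>\<close> is split in two.
    \<open>x \<le> \<zeta> / 2\<close> limits the number of edit sets, via
    \<open>1 + x \<le> exp x\<close>. \<open>L\<close> bounds the logarithmic cost of one edit, the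
    added 1 keeping it positive, and \<open>\<delta>\<close> makes
    \<open>10 * \<delta> * n\<^sup>2\<close> edits cost at most the other half;
    \<open>c ^ 3 / 20\<close> is what the repair of degrees demands.\<close>
  define x where "x = min 1 (\<zeta> / 2)"
  define L where "L = ln (1 / (c * x)) + 1"
  define \<delta> where "\<delta> = min (c ^ 3 / 20) (\<zeta> / (20 * L))"
  have \<zeta>: "0 < \<zeta>" using \<epsilon> by (simp add: \<zeta>_def)
  have x: "0 < x" "x \<le> 1" "x \<le> \<zeta> / 2" using \<zeta> by (auto simp: x_def)
  have cx: "0 < c * x" "c * x \<le> 1" using x c c1 by (auto intro: mult_le_one)
  have L: "0 < L" "ln (1 / (c * x)) \<le> L" using cx by (auto simp: L_def add_nonneg_pos)
  have \<delta>: "0 < \<delta>" using c L \<zeta> by (simp add: \<delta>_def)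
  have "\<delta> \<le> c ^ 3 / 20" by (simp add: \<delta>_def)
  moreover have "0 < c ^ 3" using c by simp
  ultimately have \<delta>c: "10 * \<delta> < c ^ 3" by linarith
  have \<delta>L: "10 * \<delta> * L \<le> \<zeta> / 2"
  proof -
    have "\<delta> * L \<le> \<zeta> / (20 * L) * L" using L by (intro mult_right_mono) (auto simp: \<delta>_def)
    also have "\<dots> = \<zeta> / 20" using L by simp
    finally show ?thesis by simp
  qed
  have "(\<lambda>n. 2 * 4 ^ n * exp (- (\<delta> / 2)\<^sup>2 * (real n)\<^sup>2)) \<longlonglongrightarrow> 0"
    using \<delta> by real_asymp
  then have "eventually (\<lambda>n. 2 * 4 ^ n * exp (- (\<delta> / 2)\<^sup>2 * (real n)\<^sup>2) < 1 / 2) sequentially"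
    by (rule order_tendstoD) simp
  moreover have "eventually (\<lambda>n. 2 / \<delta> \<le> real n) sequentially" by real_asymp
  moreover have "eventually (\<lambda>n. 2 / \<epsilon> \<le> real n) sequentially" by real_asymp
  ultimately have "eventually (\<lambda>n. 2 * 4 ^ n * exp (- (\<delta> / 2)\<^sup>2 * (real n)\<^sup>2) < 1 / 2 \<and>
     2 / \<delta> \<le> real n \<and> 2 / \<epsilon> \<le> real n \<and> 0 < n) sequentially"
    using eventually_gt_at_top[of "0::nat"] by eventually_elim auto
  then obtain n0 where n0: "\<And>n. n \<ge> n0 \<Longrightarrow> 2 * 4 ^ n * exp (- (\<delta> / 2)\<^sup>2 * (real n)\<^sup>2) < 1 / 2 \<and>
     2 / \<delta> \<le> real n \<and> 2 / \<epsilon> \<le> real n \<and> 0 < n"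
    unfolding eventually_sequentially by blast
  have "real (card {G \<in> graphs_with_degrees n d. \<not> cut_regular n p \<epsilon> G})
      \<le> 4 * 4 ^ n * exp (- \<zeta> * (real n)\<^sup>2) * real (card (graphs_with_degrees n d))"
    if n: "n \<ge> n0" and p: "c \<le> p" "p \<le> 1 - c"
      and d: "\<forall>j\<in>{1..n}. (p - \<delta>) * real n \<le> real (d j) \<and> real (d j) \<le> p * real n"
      and ev: "even (\<Sum>j\<in>{1..n}. d j)" for n p d
  proof -
    define M where "M = binomial_random_graph n p"
    define \<G> where "\<G> = graphs_with_degrees n d"
    define k where "k = nat \<lfloor>10 * \<delta> * (real n)\<^sup>2\<rfloor>"
    have n': "2 * 4 ^ n * exp (- (\<delta> / 2)\<^sup>2 * (real n)\<^sup>2) < 1 / 2"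
     "2 / \<delta> \<le> real n" "2 / \<epsilon> \<le> real n" "0 < n" using n0[OF n] by auto
    have p01: "0 < p" "p < 1" using p c by auto
    \<comment> \<open>Two tolerances are at work: the \<open>\<delta>\<close>-regular graphs, at
      least half of the binomial measure, can be repaired and so bound the probability of the degree
      class from below; \<open>\<epsilon>\<close> is the tolerance proved for its members.\<close>
    have "measure_pmf.prob M {W. \<not> cut_regular n p \<delta> W} \<le> 1 / 2"
      unfolding M_def using cut_regular_whp[of p \<delta> n] p01 \<delta> n' by linarith
    moreover have "measure_pmf.prob M {W. cut_regular n p \<delta> W} = 1 - measure_pmf.prob M {W. \<not> cut_regular n p \<delta> W}"
      using measure_pmf.prob_compl[of "{W. \<not> cut_regular n p \<delta> W}" M] by (simp add: Compl_eq_Diff_UNIV[symmetric] Collect_neg_eq)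
    ultimately have half: "1 / 2 \<le> measure_pmf.prob M {W. cut_regular n p \<delta> W}" by simp
    have near: "\<exists>H\<in>\<G>. card (sym_diff W H) \<le> k" if W: "W \<subseteq> all_edges n" "cut_regular n p \<delta> W" for W
    proof -
      obtain H where "H \<in> \<G>" "real (card (sym_diff W H)) \<le> 10 * \<delta> * (real n)\<^sup>2"
        using cut_regular_near_degree_graph[OF W, of d c] d ev p c \<delta> \<delta>c n' unfolding \<G>_def by blast
      then show ?thesis unfolding k_def by (meson le_nat_floor)
    qed
    have lower: "(c * x) ^ k * measure_pmf.prob M {W. cut_regular n p \<delta> W} \<le>
      (1 + x) ^ card (all_edges n) * measure_pmf.prob M \<G>"
      unfolding M_def by (rule edit_distance_prob[OF c p x(1,2) _ near]) (auto simp: \<G>_def graphs_with_degrees_def)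
    have "(1 + x) ^ card (all_edges n) \<le> exp x ^ card (all_edges n)"
      using x by (intro power_mono) auto
    also have "\<dots> \<le> exp x ^ n\<^sup>2"
      using x card_all_edges_le by (intro power_increasing) auto
    also have "\<dots> = exp (x * (real n)\<^sup>2)" by (simp add: exp_of_nat_mult[symmetric] mult.commute)
    also have "\<dots> \<le> exp (\<zeta> / 2 * (real n)\<^sup>2)" using x mult_right_mono[OF x(3), of "(real n)\<^sup>2"] by simp
    finally have up: "(1 + x) ^ card (all_edges n) \<le> exp (\<zeta> / 2 * (real n)\<^sup>2)" .
    have k_le: "real k \<le> 10 * \<delta> * (real n)\<^sup>2" unfolding k_def using \<delta> by simp
    have "exp (- (\<zeta> / 2) * (real n)\<^sup>2) \<le> exp (- real k * ln (1 / (c * x)))"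
    proof -
      have "real k * ln (1 / (c * x)) \<le> (10 * \<delta> * (real n)\<^sup>2) * L"
        using k_le L cx by (intro mult_mono) auto
      also have "\<dots> = 10 * \<delta> * L * (real n)\<^sup>2" by simp
      also have "\<dots> \<le> \<zeta> / 2 * (real n)\<^sup>2" using \<delta>L by (intro mult_right_mono) auto
      finally show ?thesis by simp
    qed
    also have "\<dots> = (c * x) ^ k"
      using cx c x by (simp add: ln_div exp_of_nat_mult)
    finally have "exp (- (\<zeta> / 2) * (real n)\<^sup>2) * (1 / 2) \<le> (c * x) ^ k * measure_pmf.prob M {W. cut_regular n p \<delta> W}"
      using half cx by (intro mult_mono) auto
    also have "\<dots> \<le> exp (\<zeta> / 2 * (real n)\<^sup>2) * measure_pmf.prob M \<G>"
      using lower mult_right_mono[OF up, of "measure_pmf.prob M \<G>"] by simp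
    finally have "exp (- (\<zeta> / 2) * (real n)\<^sup>2) * (exp (- (\<zeta> / 2) * (real n)\<^sup>2) * (1 / 2)) \<le>
        exp (- (\<zeta> / 2) * (real n)\<^sup>2) * (exp (\<zeta> / 2 * (real n)\<^sup>2) * measure_pmf.prob M \<G>)"
      by (intro mult_left_mono) auto
    then have PG: "exp (- \<zeta> * (real n)\<^sup>2) * (1 / 2) \<le> measure_pmf.prob M \<G>"
      by (simp add: mult.assoc[symmetric] exp_add[symmetric])
    define b where "b = real (card {G \<in> \<G>. \<not> cut_regular n p \<epsilon> G})"
    have "b * (exp (- \<zeta> * (real n)\<^sup>2) * (1 / 2)) \<le> b * measure_pmf.prob M \<G>"
      using PG by (intro mult_left_mono) (auto simp: b_def)
    also have "\<dots> \<le> real (card \<G>) * measure_pmf.prob M {G. \<not> cut_regular n p \<epsilon> G}"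
      unfolding b_def \<G>_def M_def using p01 by (rule uniform_vs_binomial)
    also have "\<dots> \<le> real (card \<G>) * (2 * 4 ^ n * exp (- (\<epsilon> / 2)\<^sup>2 * (real n)\<^sup>2))"
      unfolding M_def using p01 \<epsilon> n' by (intro mult_left_mono cut_regular_whp) auto
    also have "(\<epsilon> / 2)\<^sup>2 = 2 * \<zeta>" by (simp add: \<zeta>_def power2_eq_square)
    also have "exp (- (2 * \<zeta>) * (real n)\<^sup>2) = exp (- \<zeta> * (real n)\<^sup>2) * exp (- \<zeta> * (real n)\<^sup>2)"
      by (simp add: exp_add[symmetric])
    finally have "b * (1 / 2) * exp (- \<zeta> * (real n)\<^sup>2) \<le>
        (2 * 4 ^ n * exp (- \<zeta> * (real n)\<^sup>2) * real (card \<G>)) * exp (- \<zeta> * (real n)\<^sup>2)"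
      by (simp add: mult_ac)
    then have "b * (1 / 2) \<le> 2 * 4 ^ n * exp (- \<zeta> * (real n)\<^sup>2) * real (card \<G>)"
      by (simp only: mult_le_cancel_right_pos exp_gt_zero)
    then show ?thesis unfolding b_def \<G>_def by simp
  qed
  then show ?thesis using \<delta> unfolding \<zeta>_def by blast
qed

section \<open>Random exposure order\<close>

definition edge_labels :: "nat \<Rightarrow> nat \<Rightarrow> (nat set \<Rightarrow> nat) pmf" where
  "edge_labels n L = Pi_pmf (all_edges n) 0 (\<lambda>_. pmf_of_set {..<L})"

definition edges_above :: "nat \<Rightarrow> (nat set \<Rightarrow> nat) \<Rightarrow> nat \<Rightarrow> graph" where
  "edges_above n lab l = {e \<in> all_edges n. l \<le> lab e}"

text \<open>Thresholding labels turns their default 0 into \<open>l \<le> 0\<close>, which is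
  \<open>True\<close> at the lowest level; the default must therefore be free.\<close>

lemma random_subset_default:
  assumes "finite A"
  shows "random_subset A q = map_pmf (\<lambda>f. {e \<in> A. f e}) (Pi_pmf A dflt (\<lambda>e. bernoulli_pmf (q e)))"
proof -
  have "random_subset A q = map_pmf (\<lambda>f. {e \<in> A. f e})
      (map_pmf (\<lambda>f x. if x \<in> A then f x else False) (Pi_pmf A dflt (\<lambda>e. bernoulli_pmf (q e))))"
    unfolding random_subset_def Pi_pmf_default_swap[OF assms] ..
  also have "\<dots> = map_pmf (\<lambda>f. {e \<in> A. f e}) (Pi_pmf A dflt (\<lambda>e. bernoulli_pmf (q e)))"
    unfolding pmf.map_comp by (rule pmf.map_cong) auto
  finally show ?thesis .
qed

lemma map_pmf_threshold:
  assumes "0 < L" "l \<le> L"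
  shows "map_pmf (\<lambda>i. l \<le> i) (pmf_of_set {..<L}) = bernoulli_pmf (1 - real l / real L)"
proof (rule pmf_eqI)
  fix b
  have ne: "{..<L} \<noteq> {}" using assms by auto
  have c1: "card ({..<L} \<inter> {i. l \<le> i}) = L - l"
  proof -
    have "{..<L} \<inter> {i. l \<le> i} = {l..<L}" by auto
    then show ?thesis by simp
  qed
  have c2: "card ({..<L} \<inter> {i. \<not> l \<le> i}) = l"
  proof -
    have "{..<L} \<inter> {i. \<not> l \<le> i} = {..<l}" using assms by auto
    then show ?thesis by simp
  qed
  have "0 \<le> 1 - real l / real L" "1 - real l / real L \<le> 1" using assms by auto
  moreover have "(\<lambda>i. l \<le> i) -` {True} = {i. l \<le> i}" "(\<lambda>i. l \<le> i) -` {False} = {i. \<not> l \<le> i}" by auto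
  ultimately show "pmf (map_pmf (\<lambda>i. l \<le> i) (pmf_of_set {..<L})) b = pmf (bernoulli_pmf (1 - real l / real L)) b"
    using assms ne by (cases b) (simp_all only: pmf_map measure_pmf_of_set[OF ne finite_lessThan] c1 c2
        pmf_bernoulli_True pmf_bernoulli_False, auto simp: of_nat_diff field_simps)
qed

lemma edges_above_distribution:
  assumes "0 < L" "l \<le> L"
  shows "map_pmf (\<lambda>lab. edges_above n lab l) (edge_labels n L) = binomial_random_graph n (1 - real l / real L)"
proof -
  have "binomial_random_graph n (1 - real l / real L) =
     map_pmf (\<lambda>f. {e \<in> all_edges n. f e})
       (Pi_pmf (all_edges n) (l \<le> 0) (\<lambda>_. map_pmf (\<lambda>i. l \<le> i) (pmf_of_set {..<L})))"
    unfolding map_pmf_threshold[OF assms] binomial_random_graph_eq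
    by (rule random_subset_default) simp
  also have "Pi_pmf (all_edges n) (l \<le> 0) (\<lambda>_. map_pmf (\<lambda>i. l \<le> i) (pmf_of_set {..<L})) =
      map_pmf (\<lambda>h. (\<lambda>i. l \<le> i) \<circ> h) (edge_labels n L)"
    unfolding edge_labels_def by (rule Pi_pmf_map) auto
  finally show ?thesis by (simp add: pmf.map_comp o_def edges_above_def)
qed

text \<open>Single rows are listed separately because an error of
  \<open>\<epsilon> * n\<^sup>2\<close> says nothing about one vertex. Their failure probability is
  only exponentially small in \<open>n\<close>, which suffices for a union bound over
  \<open>n\<close> vertices.\<close>

definition label_regular :: "nat \<Rightarrow> nat \<Rightarrow> real \<Rightarrow> graph \<Rightarrow> (nat set \<Rightarrow> nat) \<Rightarrow> bool" where
  "label_regular n L \<epsilon> E lab \<longleftrightarrow> (\<forall>l\<le>L.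
     (\<forall>A B. A \<subseteq> {1..n} \<longrightarrow> B \<subseteq> {1..n} \<longrightarrow>
        \<bar>real (ecount (E \<inter> edges_above n lab l) A B) - (1 - real l / real L) * real (ecount E A B)\<bar> < \<epsilon> * (real n)\<^sup>2) \<and>
     (\<forall>j\<in>{1..n}. \<bar>real (ecount (E \<inter> edges_above n lab l) {j} {1..n}) -
        (1 - real l / real L) * real (ecount E {j} {1..n})\<bar> < \<epsilon> * real n))"

lemma label_regular_whp:
  assumes L: "0 < L" and \<epsilon>: "0 < \<epsilon>" and n: "0 < n" and E: "E \<subseteq> all_edges n"
  shows "measure_pmf.prob (edge_labels n L) {lab. \<not> label_regular n L \<epsilon> E lab}
    \<le> (real L + 1) * (2 * 4 ^ n * exp (- \<epsilon>\<^sup>2 * (real n)\<^sup>2) + 2 * real n * exp (- \<epsilon>\<^sup>2 * real n))"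
proof -
  define r where "r = (\<lambda>l. 1 - real l / real L)"
  define S1 where "S1 = (\<lambda>l. {R. \<exists>A B. A \<subseteq> {1..n} \<and> B \<subseteq> {1..n} \<and>
        \<epsilon> * (real n)\<^sup>2 \<le> \<bar>real (ecount (E \<inter> R) A B) - r l * real (ecount E A B)\<bar>})"
  define S2 where "S2 = (\<lambda>l j. {R. \<epsilon> * real n \<le>
        \<bar>real (ecount (E \<inter> R) {j} {1..n}) - r l * real (ecount E {j} {1..n})\<bar>})"
  define M where "M = edge_labels n L"
  have r: "0 \<le> r l" "r l \<le> 1" if "l \<le> L" for l using that L by (auto simp: r_def)
  have tr: "measure_pmf.prob M {lab. edges_above n lab l \<in> S} = measure_pmf.prob (binomial_random_graph n (r l)) S"
    if "l \<le> L" for l S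
    unfolding r_def edges_above_distribution[OF L that, symmetric] M_def by (simp add: vimage_def)
  have "{lab. \<not> label_regular n L \<epsilon> E lab} \<subseteq>
    (\<Union>l\<in>{..L}. {lab. edges_above n lab l \<in> S1 l} \<union> (\<Union>j\<in>{1..n}. {lab. edges_above n lab l \<in> S2 l j}))"
  proof
    fix lab assume "lab \<in> {lab. \<not> label_regular n L \<epsilon> E lab}"
    then obtain l where l: "l \<le> L" and
      "\<not> ((\<forall>A B. A \<subseteq> {1..n} \<longrightarrow> B \<subseteq> {1..n} \<longrightarrow>
        \<bar>real (ecount (E \<inter> edges_above n lab l) A B) - r l * real (ecount E A B)\<bar> < \<epsilon> * (real n)\<^sup>2) \<and>
       (\<forall>j\<in>{1..n}. \<bar>real (ecount (E \<inter> edges_above n lab l) {j} {1..n}) -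
        r l * real (ecount E {j} {1..n})\<bar> < \<epsilon> * real n))"
      unfolding label_regular_def r_def by blast
    then have "edges_above n lab l \<in> S1 l \<or> (\<exists>j\<in>{1..n}. edges_above n lab l \<in> S2 l j)"
      unfolding S1_def S2_def mem_Collect_eq by (meson not_le)
    then show "lab \<in> (\<Union>l\<in>{..L}. {lab. edges_above n lab l \<in> S1 l} \<union> (\<Union>j\<in>{1..n}. {lab. edges_above n lab l \<in> S2 l j}))"
      using l by blast
  qed
  then have "measure_pmf.prob M {lab. \<not> label_regular n L \<epsilon> E lab} \<le>
    measure_pmf.prob M (\<Union>l\<in>{..L}. {lab. edges_above n lab l \<in> S1 l} \<union> (\<Union>j\<in>{1..n}. {lab. edges_above n lab l \<in> S2 l j}))"
    by (intro measure_pmf.finite_measure_mono) auto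
  also have "\<dots> \<le> (\<Sum>l\<in>{..L}. measure_pmf.prob M ({lab. edges_above n lab l \<in> S1 l} \<union> (\<Union>j\<in>{1..n}. {lab. edges_above n lab l \<in> S2 l j})))"
    by (rule measure_pmf.finite_measure_subadditive_finite) auto
  also have "\<dots> \<le> (\<Sum>l\<in>{..L}. 2 * 4 ^ n * exp (- \<epsilon>\<^sup>2 * (real n)\<^sup>2) + 2 * real n * exp (- \<epsilon>\<^sup>2 * real n))"
  proof (rule sum_mono)
    fix l assume "l \<in> {..L}"
    then have l: "l \<le> L" by simp
    have "measure_pmf.prob M ({lab. edges_above n lab l \<in> S1 l} \<union> (\<Union>j\<in>{1..n}. {lab. edges_above n lab l \<in> S2 l j}))
      \<le> measure_pmf.prob M {lab. edges_above n lab l \<in> S1 l} + measure_pmf.prob M (\<Union>j\<in>{1..n}. {lab. edges_above n lab l \<in> S2 l j})"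
      by (rule measure_Un_le) auto
    also have "measure_pmf.prob M (\<Union>j\<in>{1..n}. {lab. edges_above n lab l \<in> S2 l j}) \<le>
        (\<Sum>j\<in>{1..n}. measure_pmf.prob M {lab. edges_above n lab l \<in> S2 l j})"
      by (rule measure_pmf.finite_measure_subadditive_finite) auto
    also have "\<dots> \<le> (\<Sum>j\<in>{1..n}. 2 * exp (- \<epsilon>\<^sup>2 * real n))"
    proof (rule sum_mono)
      fix j
      have "measure_pmf.prob (binomial_random_graph n (r l)) (S2 l j) \<le> 2 * exp (- (\<epsilon> * real n)\<^sup>2 / real n)"
        unfolding S2_def using r[OF l] \<epsilon> n E by (intro ecount_concentration) auto
      also have "- (\<epsilon> * real n)\<^sup>2 / real n = - \<epsilon>\<^sup>2 * real n" using n by (simp add: power2_eq_square)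
      finally show "measure_pmf.prob M {lab. edges_above n lab l \<in> S2 l j} \<le> 2 * exp (- \<epsilon>\<^sup>2 * real n)"
        unfolding tr[OF l] .
    qed
    also have "measure_pmf.prob M {lab. edges_above n lab l \<in> S1 l} \<le> 2 * 4 ^ n * exp (- \<epsilon>\<^sup>2 * (real n)\<^sup>2)"
      unfolding tr[OF l] S1_def using r[OF l] \<epsilon> n E by (intro ecount_concentration_uniform)
    finally show "measure_pmf.prob M ({lab. edges_above n lab l \<in> S1 l} \<union> (\<Union>j\<in>{1..n}. {lab. edges_above n lab l \<in> S2 l j}))
      \<le> 2 * 4 ^ n * exp (- \<epsilon>\<^sup>2 * (real n)\<^sup>2) + 2 * real n * exp (- \<epsilon>\<^sup>2 * real n)"
      by simp
  qed
  also have "\<dots> = (real L + 1) * (2 * 4 ^ n * exp (- \<epsilon>\<^sup>2 * (real n)\<^sup>2) + 2 * real n * exp (- \<epsilon>\<^sup>2 * real n))"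
    by (simp add: add.commute)
  finally show ?thesis unfolding M_def .
qed

section \<open>Switching counts for typical graphs and labellings\<close>

lemma abs_mult_diff_le:
  fixes a b a' b' :: real
  assumes "\<bar>a - a'\<bar> \<le> s" "\<bar>b - b'\<bar> \<le> t" "\<bar>b\<bar> \<le> m" "\<bar>a'\<bar> \<le> m"
  shows "\<bar>a * b - a' * b'\<bar> \<le> s * m + m * t"
proof -
  have "\<bar>a * b - a' * b'\<bar> = \<bar>(a - a') * b + a' * (b - b')\<bar>" by (simp add: algebra_simps)
  also have "\<dots> \<le> \<bar>a - a'\<bar> * \<bar>b\<bar> + \<bar>a'\<bar> * \<bar>b - b'\<bar>" using abs_triangle_ineq by (metis abs_mult)
  also have "\<dots> \<le> s * m + m * t" using assms by (intro add_mono mult_mono) auto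
  finally show ?thesis .
qed

text \<open>The count is the number of ordered pairs of \<open>E \<inter> U\<close> between the
  \<open>E' \<inter> U\<close>-neighbourhoods of \<open>j\<close> and \<open>k\<close>. Each
  neighbourhood has about \<open>r * q' * n\<close> vertices, cut regularity of \<open>E\<close>
  contributes the density \<open>q\<close>, and the labels contribute a third factor
  \<open>r\<close>. The neighbourhoods themselves depend on the labels, so label regularity has to
  hold for all cuts simultaneously.\<close>

lemma alternating_pairs_count:
  assumes n: "0 < n" and L: "0 < L" "l \<le> L" and E': "E' \<subseteq> all_edges n"
    and reg: "label_regular n L \<epsilon> E lab" and reg': "label_regular n L \<epsilon> E' lab"
    and cut: "cut_regular n q \<epsilon>1 E"
    and deg: "\<And>i. i \<in> {1..n} \<Longrightarrow> \<bar>real (vertex_degree E' i) - q' * real n\<bar> \<le> \<epsilon>2 * real n"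
    and q: "0 \<le> q" "q \<le> 1" "0 \<le> q'" "q' \<le> 1" and jk: "j \<in> {1..n}" "k \<in> {1..n}"
  defines "r \<equiv> 1 - real l / real L" and "U \<equiv> edges_above n lab l"
  shows "\<bar>real (card (alternating_pairs (E \<inter> U) (E' \<inter> U) j k)) - q * q'\<^sup>2 * r ^ 3 * (real n)\<^sup>2\<bar>
     \<le> (\<epsilon> + \<epsilon>1 + 2 * (\<epsilon> + \<epsilon>2)) * (real n)\<^sup>2"
proof -
  define S where "S = (\<lambda>j. {u. {j, u} \<in> E' \<inter> U})"
  have r: "0 \<le> r" "r \<le> 1" using L by (auto simp: r_def)
  have S_sub: "S i \<subseteq> {1..n}" for i
  proof
    fix u assume "u \<in> S i"
    then have "{i, u} \<in> all_edges n" using E' by (auto simp: S_def)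
    then show "u \<in> {1..n}" by (auto simp: all_edges_iff)
  qed
  have rq: "0 \<le> r * q'" "r * q' \<le> 1" using r q by (auto intro: mult_le_one)
  have card_S: "\<bar>real (card (S i)) - r * q' * real n\<bar> \<le> (\<epsilon> + \<epsilon>2) * real n" if "i \<in> {1..n}" for i
  proof -
    have "S i = {v \<in> {1..n}. {i, v} \<in> E' \<inter> U}" using S_sub[of i] by (auto simp: S_def)
    then have "card (S i) = ecount (E' \<inter> U) {i} {1..n}"
      by (simp add: ecount_eq_sum_rows)
    moreover have "vertex_degree E' i = ecount E' {i} {1..n}"
      using sum_vertex_degree[OF E', of "{i}"] that by simp
    moreover have "\<bar>real (ecount (E' \<inter> U) {i} {1..n}) - r * real (ecount E' {i} {1..n})\<bar> < \<epsilon> * real n"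
      using reg' that L unfolding label_regular_def r_def U_def by blast
    ultimately have 1: "\<bar>real (card (S i)) - r * real (vertex_degree E' i)\<bar> \<le> \<epsilon> * real n" by simp
    have "\<bar>r * real (vertex_degree E' i) - r * (q' * real n)\<bar> = r * \<bar>real (vertex_degree E' i) - q' * real n\<bar>"
      using r by (simp add: abs_mult right_diff_distrib[symmetric])
    also have "\<dots> \<le> 1 * (\<epsilon>2 * real n)" using deg[OF that] r by (intro mult_mono) auto
    finally show ?thesis using 1 by (simp add: algebra_simps)
  qed
  have le_n: "\<bar>real (card (S i))\<bar> \<le> real n" for i using card_subset_interval_le[OF S_sub] by simp
  have "\<bar>r * q' * real n\<bar> \<le> real n" using rq by (simp add: abs_mult mult_left_le_one_le)
  then have "\<bar>real (card (S j)) * real (card (S k)) - (r * q' * real n) * (r * q' * real n)\<bar>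
      \<le> ((\<epsilon> + \<epsilon>2) * real n) * real n + real n * ((\<epsilon> + \<epsilon>2) * real n)"
    using card_S jk le_n by (intro abs_mult_diff_le) auto
  then have 1: "\<bar>real (card (S j)) * real (card (S k)) - r\<^sup>2 * q'\<^sup>2 * (real n)\<^sup>2\<bar> \<le> 2 * (\<epsilon> + \<epsilon>2) * (real n)\<^sup>2"
    by (simp add: power2_eq_square algebra_simps)
  have "\<bar>r * q * (real (card (S j)) * real (card (S k))) - r * q * (r\<^sup>2 * q'\<^sup>2 * (real n)\<^sup>2)\<bar> =
     r * q * \<bar>real (card (S j)) * real (card (S k)) - r\<^sup>2 * q'\<^sup>2 * (real n)\<^sup>2\<bar>"
    using r q by (simp add: abs_mult right_diff_distrib[symmetric])
  also have "\<dots> \<le> 1 * (2 * (\<epsilon> + \<epsilon>2) * (real n)\<^sup>2)"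
    using r q 1 by (intro mult_mono) (auto intro: mult_le_one)
  finally have A: "\<bar>r * q * (real (card (S j)) * real (card (S k))) - q * q'\<^sup>2 * r ^ 3 * (real n)\<^sup>2\<bar>
      \<le> 2 * (\<epsilon> + \<epsilon>2) * (real n)\<^sup>2"
    by (simp add: power2_eq_square power3_eq_cube mult_ac)
  have "\<bar>real (ecount E (S j) (S k)) - q * real (card (S j)) * real (card (S k))\<bar> \<le> \<epsilon>1 * (real n)\<^sup>2"
    using cut S_sub unfolding cut_regular_def by blast
  then have "r * \<bar>real (ecount E (S j) (S k)) - q * real (card (S j)) * real (card (S k))\<bar> \<le> 1 * (\<epsilon>1 * (real n)\<^sup>2)"
    using r by (intro mult_mono) auto
  moreover have "r * \<bar>real (ecount E (S j) (S k)) - q * real (card (S j)) * real (card (S k))\<bar> =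
    \<bar>r * (real (ecount E (S j) (S k)) - q * real (card (S j)) * real (card (S k)))\<bar>"
    using r by (simp add: abs_mult)
  moreover have "\<dots> = \<bar>r * real (ecount E (S j) (S k)) - r * q * (real (card (S j)) * real (card (S k)))\<bar>"
    by (simp add: right_diff_distrib mult.assoc)
  ultimately have B: "\<bar>r * real (ecount E (S j) (S k)) - r * q * (real (card (S j)) * real (card (S k)))\<bar> \<le> \<epsilon>1 * (real n)\<^sup>2"
    by simp
  have C: "\<bar>real (ecount (E \<inter> U) (S j) (S k)) - r * real (ecount E (S j) (S k))\<bar> < \<epsilon> * (real n)\<^sup>2"
    using reg L S_sub unfolding label_regular_def r_def U_def by blast
  have "card (alternating_pairs (E \<inter> U) (E' \<inter> U) j k) = ecount (E \<inter> U) (S j) (S k)"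
    unfolding card_alternating_pairs S_def ..
  moreover have "(\<epsilon> + \<epsilon>1 + 2 * (\<epsilon> + \<epsilon>2)) * (real n)\<^sup>2 = \<epsilon> * (real n)\<^sup>2 + \<epsilon>1 * (real n)\<^sup>2 + 2 * (\<epsilon> + \<epsilon>2) * (real n)\<^sup>2"
    by (simp add: algebra_simps)
  ultimately show ?thesis using A B C by linarith
qed

text \<open>The tolerance doubles because the diagonal belongs neither to \<open>G\<close> nor to
  its complement.\<close>

lemma cut_regular_complement:
  assumes cut: "cut_regular n p \<epsilon> G" and G: "G \<subseteq> all_edges n" and n: "real n \<le> \<epsilon> * (real n)\<^sup>2"
  shows "cut_regular n (1 - p) (2 * \<epsilon>) (all_edges n - G)"
  unfolding cut_regular_def
proof (intro allI impI)
  fix A B assume AB: "A \<subseteq> {1..n}" "B \<subseteq> {1..n}"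
  have fin: "finite A" "finite B" using AB finite_subset by auto
  have "ecount (all_edges n) A B = ecount (all_edges n - G) A B + ecount G A B"
    unfolding ecount_eq_sum[OF finite_all_edges fin] ecount_eq_sum[OF finite_graph[OF G] fin]
      ecount_eq_sum[OF finite_Diff[OF finite_all_edges] fin]
    by (rule sum.subset_diff[OF G finite_all_edges])
  then have "real (ecount (all_edges n) A B) = real (ecount (all_edges n - G) A B) + real (ecount G A B)" by simp
  moreover have "\<bar>real (ecount G A B) - p * real (card A) * real (card B)\<bar> \<le> \<epsilon> * (real n)\<^sup>2"
    using cut AB unfolding cut_regular_def by blast
  moreover have "(1 - p) * real (card A) * real (card B) = real (card A) * real (card B) - p * real (card A) * real (card B)"
    by (simp add: algebra_simps)
  moreover have "2 * \<epsilon> * (real n)\<^sup>2 = \<epsilon> * (real n)\<^sup>2 + \<epsilon> * (real n)\<^sup>2" by simp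
  ultimately show "\<bar>real (ecount (all_edges n - G) A B) - (1 - p) * real (card A) * real (card B)\<bar> \<le> 2 * \<epsilon> * (real n)\<^sup>2"
    using ecount_all_edges[OF AB] n by linarith
qed

lemma vertex_degree_complement:
  assumes G: "G \<subseteq> all_edges n" and j: "j \<in> {1..n}"
  shows "vertex_degree (all_edges n - G) j + vertex_degree G j = n - 1"
proof -
  have "vertex_degree (all_edges n - G) j + vertex_degree G j = vertex_degree (all_edges n) j"
    unfolding vertex_degree_def using G finite_graph[OF G]
    by (subst card_Un_disjoint[symmetric]) (auto intro!: arg_cong[where f = card])
  also have "\<dots> = card {v \<in> {1..n}. {j, v} \<in> all_edges n}"
    using j by (intro vertex_degree_eq_card) auto
  also have "{v \<in> {1..n}. {j, v} \<in> all_edges n} = {1..n} - {j}"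
    using j by (auto simp: all_edges_iff)
  finally show ?thesis using j by simp
qed

text \<open>Cut regularity passes from \<open>G\<close> to its complement, but label regularity of
  \<open>G\<close> does not control the labels of non-edges; hence the third condition.\<close>

definition typical :: "nat \<Rightarrow> nat \<Rightarrow> real \<Rightarrow> real \<Rightarrow> (nat set \<Rightarrow> nat) \<Rightarrow> graph \<Rightarrow> bool" where
  "typical n L p \<epsilon> lab G \<longleftrightarrow> cut_regular n p \<epsilon> G \<and> label_regular n L \<epsilon> G lab \<and>
     label_regular n L \<epsilon> (all_edges n - G) lab"

text \<open>In the complement both tolerances double: for cuts because of the diagonal, for degrees
  because the two degrees of a vertex add up to \<open>n - 1\<close>. The total errors are
  \<open>8 * \<epsilon>\<close> and \<open>7 * \<epsilon>\<close>, covered by one common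
  bound.\<close>

lemma typical_counts:
  assumes tpc: "typical n L p \<epsilon> lab G" and G: "G \<in> graphs_with_degrees n d"
    and d: "\<And>j. j \<in> {1..n} \<Longrightarrow> (p - \<epsilon>) * real n \<le> real (d j) \<and> real (d j) \<le> p * real n"
    and p: "0 \<le> p" "p \<le> 1" and n: "0 < n" "1 \<le> \<epsilon> * real n" and L: "0 < L" "l \<le> L"
    and jk: "j \<in> {1..n}" "k \<in> {1..n}"
  defines "r \<equiv> 1 - real l / real L" and "U \<equiv> edges_above n lab l"
  shows "\<bar>real (card (alternating_pairs (U \<inter> G) (U - G) j k)) - p * (1 - p)\<^sup>2 * r ^ 3 * (real n)\<^sup>2\<bar> \<le> 9 * \<epsilon> * (real n)\<^sup>2"
    "\<bar>real (card (alternating_pairs (U - G) (U \<inter> G) j k)) - p\<^sup>2 * (1 - p) * r ^ 3 * (real n)\<^sup>2\<bar> \<le> 9 * \<epsilon> * (real n)\<^sup>2"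
proof -
  have Gs: "G \<subseteq> all_edges n" and Gd: "\<And>i. i \<in> {1..n} \<Longrightarrow> vertex_degree G i = d i"
    using G by (auto simp: graphs_with_degrees_def)
  have \<epsilon>: "0 \<le> \<epsilon>" using n by (smt (verit) mult_nonneg_nonneg of_nat_0_le_iff mult_neg_pos of_nat_0_less_iff)
  have deg: "\<bar>real (vertex_degree G i) - p * real n\<bar> \<le> \<epsilon> * real n" if "i \<in> {1..n}" for i
    using d[OF that] Gd[OF that] by (simp add: algebra_simps)
  have degc: "\<bar>real (vertex_degree (all_edges n - G) i) - (1 - p) * real n\<bar> \<le> 2 * \<epsilon> * real n" if "i \<in> {1..n}" for i
  proof -
    have "vertex_degree (all_edges n - G) i + vertex_degree G i + 1 = n"
      using vertex_degree_complement[OF Gs that] n by simp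
    then have "real (vertex_degree (all_edges n - G) i) = real n - 1 - real (vertex_degree G i)"
      by linarith
    then show ?thesis using deg[OF that] n by (simp add: algebra_simps abs_le_iff)
  qed
  have nn: "real n \<le> \<epsilon> * (real n)\<^sup>2"
    using mult_right_mono[OF n(2), of "real n"] by (simp add: power2_eq_square mult_ac)
  have cut: "cut_regular n p \<epsilon> G" "cut_regular n (1 - p) (2 * \<epsilon>) (all_edges n - G)"
    using tpc cut_regular_complement[OF _ Gs nn] by (auto simp: typical_def)
  have reg: "label_regular n L \<epsilon> G lab" "label_regular n L \<epsilon> (all_edges n - G) lab"
    using tpc by (auto simp: typical_def)
  have sets: "U \<inter> G = G \<inter> U" "U - G = (all_edges n - G) \<inter> U" by (auto simp: U_def edges_above_def)
  have mono: "x * (real n)\<^sup>2 \<le> 9 * \<epsilon> * (real n)\<^sup>2" if "x \<le> 9 * \<epsilon>" for x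
    using that by (intro mult_right_mono) auto
  have "\<bar>real (card (alternating_pairs (G \<inter> U) ((all_edges n - G) \<inter> U) j k)) - p * (1 - p)\<^sup>2 * r ^ 3 * (real n)\<^sup>2\<bar>
     \<le> (\<epsilon> + \<epsilon> + 2 * (\<epsilon> + 2 * \<epsilon>)) * (real n)\<^sup>2"
    unfolding r_def U_def
    by (rule alternating_pairs_count[OF n(1) L _ reg cut(1) degc]) (use p jk in auto)
  also have "\<dots> \<le> 9 * \<epsilon> * (real n)\<^sup>2" using \<epsilon> by (intro mono) simp
  finally show "\<bar>real (card (alternating_pairs (U \<inter> G) (U - G) j k)) - p * (1 - p)\<^sup>2 * r ^ 3 * (real n)\<^sup>2\<bar> \<le> 9 * \<epsilon> * (real n)\<^sup>2"
    unfolding sets .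
  have "\<bar>real (card (alternating_pairs ((all_edges n - G) \<inter> U) (G \<inter> U) j k)) - (1 - p) * p\<^sup>2 * r ^ 3 * (real n)\<^sup>2\<bar>
     \<le> (\<epsilon> + 2 * \<epsilon> + 2 * (\<epsilon> + \<epsilon>)) * (real n)\<^sup>2"
    unfolding r_def U_def
    by (rule alternating_pairs_count[OF n(1) L Gs reg(2,1) cut(2) deg]) (use p jk in auto)
  also have "\<dots> \<le> 9 * \<epsilon> * (real n)\<^sup>2" using \<epsilon> by (intro mono) simp
  finally show "\<bar>real (card (alternating_pairs (U - G) (U \<inter> G) j k)) - p\<^sup>2 * (1 - p) * r ^ 3 * (real n)\<^sup>2\<bar> \<le> 9 * \<epsilon> * (real n)\<^sup>2"
    unfolding sets by (simp add: mult.commute)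
qed

text \<open>Markov's inequality over the history classes: a class in which more than a proportion \<open>\<eta>\<close> is bad
  is charged to its bad members.\<close>

lemma deviating_card_le:
  fixes \<G> :: "'e set set"
  assumes fin: "finite \<G>" and \<eta>: "0 < \<eta>" and bad: "bad \<subseteq> \<G>"
    and ratio: "\<And>i g. i < length es \<Longrightarrow> g \<in> \<G> \<Longrightarrow>
       real (card (history_class \<G> (set (take i es)) g \<inter> bad)) \<le> \<eta> * real (card (history_class \<G> (set (take i es)) g)) \<Longrightarrow>
       real (card {G \<in> history_class \<G> (set (take i es)) g. es ! i \<in> G}) /
       real (card (history_class \<G> (set (take i es)) g)) \<in> {q1 (es ! i)..q2 (es ! i)}"
  shows "real (card (deviating \<G> q1 q2 es)) \<le> real (length es) * (real (card bad) / \<eta>)"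
proof -
  define cls where "cls = (\<lambda>i. history_class \<G> (set (take i es)))"
  define D where "D = (\<lambda>i. {g \<in> \<G>. \<eta> * real (card (cls i g)) < real (card (cls i g \<inter> bad))})"
  have fb: "finite bad" using bad fin finite_subset by blast
  have D_le: "real (card (D i)) \<le> real (card bad) / \<eta>" for i
  proof -
    have cls_eq: "cls i g' = cls i g" if "g' \<in> cls i g" for g g'
      using that by (auto simp: cls_def history_class_def)
    have self: "g \<in> cls i g" if "g \<in> \<G>" for g using that by (auto simp: cls_def history_class_def)
    have sub: "cls i g \<subseteq> \<G>" for g by (auto simp: cls_def history_class_def)
    have finc: "finite (cls i g)" for g using sub fin finite_subset by blast
    have disj: "\<And>X Y. X \<in> cls i ` D i \<Longrightarrow> Y \<in> cls i ` D i \<Longrightarrow> X \<noteq> Y \<Longrightarrow> X \<inter> Y = {}"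
      using cls_eq by (metis disjoint_iff imageE)
    \<comment> \<open>Membership in \<open>D i\<close> depends only on the history class, so
      \<open>D i\<close> is a disjoint union of whole classes.\<close>
    have un: "\<Union> (cls i ` D i) = D i"
    proof (intro equalityI subsetI)
      fix g' assume "g' \<in> \<Union> (cls i ` D i)"
      then obtain g where g: "g \<in> D i" "g' \<in> cls i g" by blast
      then show "g' \<in> D i" using cls_eq[OF g(2)] sub[of g] unfolding D_def by auto
    next
      fix g assume "g \<in> D i"
      then show "g \<in> \<Union> (cls i ` D i)" using self by (auto simp: D_def)
    qed
    have fD: "finite (D i)" using fin by (auto simp: D_def)
    have "card (\<Union> (cls i ` D i)) = (\<Sum>C\<in>cls i ` D i. card C)"
      using disj finc by (intro card_Union_disjoint) (auto simp: pairwise_def disjnt_def)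
    then have "\<eta> * real (card (D i)) = (\<Sum>C\<in>cls i ` D i. \<eta> * real (card C))"
      unfolding un by (simp add: sum_distrib_left)
    also have "\<dots> \<le> (\<Sum>C\<in>cls i ` D i. real (card (C \<inter> bad)))"
      by (rule sum_mono) (auto simp: D_def)
    also have "\<dots> = real (card (\<Union>C\<in>cls i ` D i. C \<inter> bad))"
    proof (subst card_UN_disjoint)
      show "\<forall>X\<in>cls i ` D i. \<forall>Y\<in>cls i ` D i. X \<noteq> Y \<longrightarrow> X \<inter> bad \<inter> (Y \<inter> bad) = {}"
        using disj by blast
    qed (use fD fb in auto)
    also have "\<dots> \<le> real (card bad)" using fb by (intro of_nat_mono card_mono) auto
    finally show ?thesis using \<eta> by (simp add: field_simps)
  qed
  have "deviating \<G> q1 q2 es \<subseteq> (\<Union>i\<in>{..<length es}. D i)"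
  proof
    fix g assume "g \<in> deviating \<G> q1 q2 es"
    then obtain i where i: "i < length es" "g \<in> \<G>"
      "real (card {G \<in> history_class \<G> (set (take i es)) g. es ! i \<in> G}) /
       real (card (history_class \<G> (set (take i es)) g)) \<notin> {q1 (es ! i)..q2 (es ! i)}"
      unfolding deviating_def by blast
    then have "g \<in> D i" using ratio[OF i(1,2)] unfolding D_def cls_def by force
    then show "g \<in> (\<Union>i\<in>{..<length es}. D i)" using i by blast
  qed
  then have "card (deviating \<G> q1 q2 es) \<le> card (\<Union>i\<in>{..<length es}. D i)"
    using fin by (intro card_mono) (auto simp: D_def)
  also have "\<dots> \<le> (\<Sum>i<length es. card (D i))" by (rule card_UN_le) simp
  finally have "real (card (deviating \<G> q1 q2 es)) \<le> (\<Sum>i<length es. real (card (D i)))"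
    by (simp flip: of_nat_sum)
  also have "\<dots> \<le> (\<Sum>i<length es. real (card bad) / \<eta>)" by (intro sum_mono D_le)
  finally show ?thesis by simp
qed

section \<open>The sandwich\<close>

text \<open>The unexposed density \<open>r\<close> is at least \<open>1 / K\<close>, and one level
  has width \<open>h = 1 / K\<^sup>2\<close>. Hence
  \<open>\<sigma> - \<tau> \<le> 3 * r\<^sup>2 * h\<close> is at most \<open>3 / K\<close> times
  \<open>\<sigma> = r ^ 3\<close>, while \<open>\<sigma> \<ge> 1 / K ^ 3\<close> dominates
  \<open>9 * \<epsilon> + \<eta>\<close>. Each error takes half of
  \<open>c\<^sup>2 * \<theta> * \<sigma>\<close>, and
  \<open>p * (1 - p) \<ge> c\<^sup>2\<close>.\<close>

lemma label_levels_arith: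
  fixes c \<theta> \<epsilon> \<eta> p :: real and K L l :: nat
  assumes K: "0 < K" and L: "L = K * K" and l: "l + K < L" and c: "0 < c" "c \<le> p" "p \<le> 1 - c"
    and \<theta>: "0 < \<theta>" and K\<theta>: "3 / real K \<le> c\<^sup>2 * \<theta> / 2" and \<epsilon>\<eta>: "9 * \<epsilon> + \<eta> \<le> c\<^sup>2 * \<theta> / (2 * real K ^ 3)"
  defines "\<sigma> \<equiv> (1 - real l / real L) ^ 3" and "\<tau> \<equiv> (1 - real (Suc l) / real L) ^ 3"
  assumes x: "p * (1 - p) * \<sigma> * x \<le> 9 * \<epsilon> + \<eta> + (\<sigma> - \<tau>)" and x0: "0 \<le> x"
  shows "x \<le> \<theta>"
proof -
  define r where "r = 1 - real l / real L"
  define h where "h = 1 / real L"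
  have L0: "real L > 0" using K L by simp
  have "real l + real K \<le> real L" using l by linarith
  then have "real K / real L \<le> r" unfolding r_def using L0 by (simp add: field_simps)
  moreover have "real K / real L = 1 / real K" using K L by (simp add: field_simps)
  ultimately have r: "1 / real K \<le> r" by simp
  have K1: "1 / real K > 0" using K by simp
  have h: "h = 1 / real K * (1 / real K)" unfolding h_def L by simp
  have r0: "0 < r" using r K1 by linarith
  have r1: "r \<le> 1" unfolding r_def by simp
  have "1 / real K \<le> 1" using K by simp
  then have "h \<le> 1 * (1 / real K)" unfolding h using K1 by (intro mult_right_mono) auto
  then have hr: "h \<le> r" "0 \<le> h" using r K1 h by auto
  have sr: "\<sigma> = r ^ 3" by (simp add: \<sigma>_def r_def)
  have tr: "\<tau> = (r - h) ^ 3" by (simp add: \<tau>_def r_def h_def add_divide_distrib algebra_simps)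
  have "\<sigma> - \<tau> = 3 * r\<^sup>2 * h - 3 * r * h\<^sup>2 + h ^ 3"
    unfolding sr tr by (simp add: power2_eq_square power3_eq_cube algebra_simps)
  also have "h ^ 3 \<le> 3 * r * h\<^sup>2"
  proof -
    have "h * h\<^sup>2 \<le> 3 * r * h\<^sup>2" using hr by (intro mult_right_mono) auto
    then show ?thesis by (simp add: power2_eq_square power3_eq_cube)
  qed
  finally have "\<sigma> - \<tau> \<le> 3 * r\<^sup>2 * h" by simp
  also have "3 * r\<^sup>2 * h = 3 * r\<^sup>2 * (1 / real K) * (1 / real K)" by (simp add: h)
  also have "\<dots> \<le> 3 * r\<^sup>2 * (1 / real K) * r" using r K1 by (intro mult_left_mono) auto
  also have "\<dots> = \<sigma> * (3 / real K)" by (simp add: sr power2_eq_square power3_eq_cube)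
  also have "\<dots> \<le> \<sigma> * (c\<^sup>2 * \<theta> / 2)" using K\<theta> r0 by (intro mult_left_mono) (auto simp: sr)
  finally have st: "\<sigma> - \<tau> \<le> \<sigma> * (c\<^sup>2 * \<theta> / 2)" .
  have "(1 / real K) ^ 3 \<le> \<sigma>" unfolding sr using r K1 by (intro power_mono) auto
  then have "c\<^sup>2 * \<theta> / 2 * (1 / real K) ^ 3 \<le> c\<^sup>2 * \<theta> / 2 * \<sigma>" using c \<theta> by (intro mult_left_mono) auto
  moreover have "c\<^sup>2 * \<theta> / 2 * (1 / real K) ^ 3 = c\<^sup>2 * \<theta> / (2 * real K ^ 3)"
    by (simp add: power_one_over)
  ultimately have e: "9 * \<epsilon> + \<eta> \<le> \<sigma> * (c\<^sup>2 * \<theta> / 2)" using \<epsilon>\<eta> by (simp add: mult.commute)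
  have \<sigma>0: "0 < \<sigma>" using r0 by (simp add: sr)
  have "c\<^sup>2 \<le> p * (1 - p)" unfolding power2_eq_square using c by (intro mult_mono) auto
  then have "c\<^sup>2 * (\<sigma> * x) \<le> p * (1 - p) * (\<sigma> * x)" using \<sigma>0 x0 by (intro mult_right_mono) auto
  also have "\<dots> \<le> \<sigma> * (c\<^sup>2 * \<theta> / 2) + \<sigma> * (c\<^sup>2 * \<theta> / 2)" using x st e by (simp only: mult.assoc)
  also have "\<dots> = c\<^sup>2 * (\<sigma> * \<theta>)" by simp
  finally show ?thesis using c \<sigma>0 by (simp add: mult_le_cancel_left_pos)
qed

section \<open>Exposure by increasing label, for a fixed labelling\<close>

lemma sorted_edge_list:
  obtains es where "set es = all_edges n" "distinct es" "sorted (map lab es)"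
proof -
  obtain xs where "set xs = all_edges n" "distinct xs" using finite_distinct_list[OF finite_all_edges] by blast
  then show thesis using that[of "sort_key lab xs"] by simp
qed

lemma finite_graphs_with_degrees: "finite (graphs_with_degrees n d)"
  by (rule finite_subset[of _ "Pow (all_edges n)"]) (auto simp: graphs_with_degrees_def)

text \<open>Pairs sharing a label are exposed in arbitrary order, so the unexposed set is pinned
  down only between two consecutive levels.\<close>

lemma sorted_exposure:
  assumes es: "set es = all_edges n" "distinct es" "sorted (map lab es)" and i: "i < length es"
  shows "es ! i \<in> all_edges n - set (take i es)"
    "edges_above n lab (Suc (lab (es ! i))) \<subseteq> all_edges n - set (take i es)"
    "all_edges n - set (take i es) \<subseteq> edges_above n lab (lab (es ! i))"
proof -
  have before: "lab e \<le> lab (es ! i)" if e: "e \<in> set (take i es)" for e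
  proof -
    obtain m where "m < length (take i es)" "take i es ! m = e"
      using e unfolding in_set_conv_nth by blast
    then have "m < i" "e = es ! m" by auto
    then show ?thesis using sorted_nth_mono[OF es(3), of m i] i by simp
  qed
  have after: "lab (es ! i) \<le> lab e" if e: "e \<in> all_edges n" "e \<notin> set (take i es)" for e
  proof -
    obtain m where m: "m < length es" "e = es ! m" using e(1) es(1) by (metis in_set_conv_nth)
    have "\<not> m < i"
    proof
      assume "m < i"
      then have "take i es ! m \<in> set (take i es)" using m(1) by (intro nth_mem) simp
      then show False using \<open>m < i\<close> m(2) e(2) by simp
    qed
    then show ?thesis using sorted_nth_mono[OF es(3), of i m] m by simp
  qed
  have "es ! i \<notin> set (take i es)"
  proof
    assume "es ! i \<in> set (take i es)"
    then obtain m where "m < length (take i es)" "take i es ! m = es ! i"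
      unfolding in_set_conv_nth by blast
    then have "m < i" "es ! m = es ! i" by auto
    then show False using es(2) i by (simp add: nth_eq_iff_index_eq)
  qed
  moreover from nth_mem[OF i] have "es ! i \<in> all_edges n" unfolding es(1) .
  ultimately show "es ! i \<in> all_edges n - set (take i es)" by (rule DiffI[rotated])
  show "edges_above n lab (Suc (lab (es ! i))) \<subseteq> all_edges n - set (take i es)"
  proof
    fix e assume "e \<in> edges_above n lab (Suc (lab (es ! i)))"
    then have "e \<in> all_edges n" "lab (es ! i) < lab e" by (auto simp: edges_above_def)
    then show "e \<in> all_edges n - set (take i es)" using before[of e] by auto
  qed
  show "all_edges n - set (take i es) \<subseteq> edges_above n lab (lab (es ! i))"
  proof
    fix e assume "e \<in> all_edges n - set (take i es)"
    then show "e \<in> edges_above n lab (lab (es ! i))" using after[of e] by (simp add: edges_above_def)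
  qed
qed

text \<open>Pairs labelled \<open>L - K\<close> or more have the window \<open>{0..1}\<close> and
  can never deviate. For the others, a history class with few atypical members has edge probability
  within \<open>\<theta>\<close> of \<open>p\<close>. The factor \<open>n\<^sup>2 / \<eta>\<close>
  comes from Markov's inequality over the at most \<open>n\<^sup>2\<close> exposure steps.\<close>

lemma labelled_coupling:
  fixes c \<theta> \<epsilon> \<eta> p :: real and K L n :: nat
  assumes K: "0 < K" and L: "L = K * K" and c: "0 < c" "c \<le> p" "p \<le> 1 - c"
    and \<theta>: "0 < \<theta>" "\<theta> \<le> c" and K\<theta>: "3 / real K \<le> c\<^sup>2 * \<theta> / 2"
    and \<epsilon>\<eta>: "9 * \<epsilon> + \<eta> \<le> c\<^sup>2 * \<theta> / (2 * real K ^ 3)" "0 < \<eta>" "0 < \<epsilon>"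
    and n: "0 < n" "1 \<le> \<epsilon> * real n"
    and d: "\<And>j. j \<in> {1..n} \<Longrightarrow> (p - \<epsilon>) * real n \<le> real (d j) \<and> real (d j) \<le> p * real n"
    and ne: "graphs_with_degrees n d \<noteq> {}"
  defines "\<G> \<equiv> graphs_with_degrees n d"
  shows "\<exists>J. is_coupling3 J (random_subset (all_edges n) (\<lambda>e. if lab e < L - K then p - \<theta> else 0))
       (pmf_of_set \<G>) (random_subset (all_edges n) (\<lambda>e. if lab e < L - K then p + \<theta> else 1)) \<and>
     measure_pmf.prob J {(X, G, Y). \<not> (X \<subseteq> G \<and> G \<subseteq> Y)} \<le>
       (real n)\<^sup>2 / \<eta> * real (card {G \<in> \<G>. \<not> typical n L p \<epsilon> lab G}) / real (card \<G>)"
proof -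
  obtain es where es: "set es = all_edges n" "distinct es" "sorted (map lab es)"
    by (rule sorted_edge_list)
  define q1 where "q1 = (\<lambda>e. if lab e < L - K then p - \<theta> else 0)"
  define q2 where "q2 = (\<lambda>e. if lab e < L - K then p + \<theta> else 1)"
  define bad where "bad = {G \<in> \<G>. \<not> typical n L p \<epsilon> lab G}"
  have fin: "finite \<G>" unfolding \<G>_def by (rule finite_graphs_with_degrees)
  have p01: "0 \<le> p" "p \<le> 1" using c by auto
  have L0: "0 < L" using K L by simp
  have dev: "real (card (deviating \<G> q1 q2 es)) \<le> real (length es) * (real (card bad) / \<eta>)"
  proof (rule deviating_card_le[OF fin \<epsilon>\<eta>(2)])
    show "bad \<subseteq> \<G>" by (auto simp: bad_def)
    fix i g assume i: "i < length es" and g: "g \<in> \<G>"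
    define T where "T = set (take i es)"
    define C where "C = history_class \<G> T g"
    define l where "l = lab (es ! i)"
    define a where "a = real (card {G \<in> C. es ! i \<in> G}) / real (card C)"
    assume "real (card (history_class \<G> (set (take i es)) g \<inter> bad)) \<le> \<eta> * real (card (history_class \<G> (set (take i es)) g))"
    then have few: "real (card (C \<inter> bad)) \<le> \<eta> * real (card C)" by (simp add: C_def T_def)
    have finC: "finite C" using fin by (simp add: C_def history_class_def)
    have gC: "g \<in> C" using g by (simp add: C_def history_class_def)
    have a01: "0 \<le> a" "a \<le> 1"
    proof -
      have "card {G \<in> C. es ! i \<in> G} \<le> card C" using finC by (intro card_mono) auto
      then show "a \<le> 1" unfolding a_def by (cases "card C = 0") (auto simp: divide_le_eq_1)
    qed (simp add: a_def)
    have "a \<in> {q1 (es ! i)..q2 (es ! i)}"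
    proof (cases "l < L - K")
      case False
      then show ?thesis using a01 by (simp add: q1_def q2_def l_def)
    next
      case True
      then have lK: "l + K < L" by simp
      then have lL: "l \<le> L" "Suc l \<le> L" by auto
      note expo = sorted_exposure[OF es i, folded T_def l_def]
      obtain j k where jk: "es ! i = {j, k}" "j \<in> {1..n}" "k \<in> {1..n}"
        using expo(1) by (auto simp: all_edges_def card_2_iff)
      define \<sigma> where "\<sigma> = (1 - real l / real L) ^ 3"
      define \<tau> where "\<tau> = (1 - real (Suc l) / real L) ^ 3"
      have base: "0 \<le> 1 - real (Suc l) / real L" "1 - real (Suc l) / real L \<le> 1 - real l / real L" "1 - real l / real L \<le> 1"
        using lL L0 by (auto simp: field_simps)
      have st: "0 \<le> \<tau>" "\<tau> \<le> \<sigma>" "\<sigma> \<le> 1"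
        unfolding \<sigma>_def \<tau>_def using base by (auto intro!: power_mono power_le_one)
      have counts: "\<bar>real (card (alternating_pairs (edges_above n lab m \<inter> G) (edges_above n lab m - G) j k)) -
           p * (1 - p)\<^sup>2 * (1 - real m / real L) ^ 3 * (real n)\<^sup>2\<bar> \<le> 9 * \<epsilon> * (real n)\<^sup>2"
        "\<bar>real (card (alternating_pairs (edges_above n lab m - G) (edges_above n lab m \<inter> G) j k)) -
           p\<^sup>2 * (1 - p) * (1 - real m / real L) ^ 3 * (real n)\<^sup>2\<bar> \<le> 9 * \<epsilon> * (real n)\<^sup>2"
        if "G \<in> C - bad" "m \<le> L" for G m
      proof -
        have "G \<in> \<G>" "typical n L p \<epsilon> lab G" using that(1) by (auto simp: bad_def C_def history_class_def)
        then show "\<bar>real (card (alternating_pairs (edges_above n lab m \<inter> G) (edges_above n lab m - G) j k)) -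
           p * (1 - p)\<^sup>2 * (1 - real m / real L) ^ 3 * (real n)\<^sup>2\<bar> \<le> 9 * \<epsilon> * (real n)\<^sup>2"
        "\<bar>real (card (alternating_pairs (edges_above n lab m - G) (edges_above n lab m \<inter> G) j k)) -
           p\<^sup>2 * (1 - p) * (1 - real m / real L) ^ 3 * (real n)\<^sup>2\<bar> \<le> 9 * \<epsilon> * (real n)\<^sup>2"
          using typical_counts[where d = d, OF _ _ d p01 n L0 that(2) jk(2,3)] unfolding \<G>_def by blast+
      qed
      have "p * (1 - p) * \<sigma> * \<bar>real (card {G \<in> C. {j, k} \<in> G}) / real (card C) - p\<bar> \<le> 9 * \<epsilon> + \<eta> + (\<sigma> - \<tau>)"
        unfolding C_def \<G>_def
      proof (rule class_edge_ratio[where Ulo = "edges_above n lab (Suc l)" and Uhi = "edges_above n lab l" and bad = bad])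
        show "{j, k} \<in> all_edges n - T" using expo(1) jk by simp
        show "history_class (graphs_with_degrees n d) T g \<noteq> {}" using gC by (auto simp: C_def \<G>_def)
        show "edges_above n lab l \<subseteq> all_edges n" by (auto simp: edges_above_def)
        show "real (card (history_class (graphs_with_degrees n d) T g \<inter> bad)) \<le>
            \<eta> * real (card (history_class (graphs_with_degrees n d) T g))" using few by (simp add: C_def \<G>_def)
        fix G assume "G \<in> history_class (graphs_with_degrees n d) T g - bad"
        then have G: "G \<in> C - bad" by (simp add: C_def \<G>_def)
        show "real (card (alternating_pairs (edges_above n lab l \<inter> G) (edges_above n lab l - G) j k))
                   \<le> (p * (1 - p)\<^sup>2 * \<sigma> + 9 * \<epsilon>) * (real n)\<^sup>2"
          using counts(1)[OF G lL(1)] unfolding \<sigma>_def distrib_right by linarith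
        show "(p * (1 - p)\<^sup>2 * \<tau> - 9 * \<epsilon>) * (real n)\<^sup>2 \<le>
            real (card (alternating_pairs (edges_above n lab (Suc l) \<inter> G) (edges_above n lab (Suc l) - G) j k))"
          using counts(1)[OF G lL(2)] unfolding \<tau>_def left_diff_distrib by linarith
        show "real (card (alternating_pairs (edges_above n lab l - G) (edges_above n lab l \<inter> G) j k))
                   \<le> (p\<^sup>2 * (1 - p) * \<sigma> + 9 * \<epsilon>) * (real n)\<^sup>2"
          using counts(2)[OF G lL(1)] unfolding \<sigma>_def distrib_right by linarith
        show "(p\<^sup>2 * (1 - p) * \<tau> - 9 * \<epsilon>) * (real n)\<^sup>2 \<le>
            real (card (alternating_pairs (edges_above n lab (Suc l) - G) (edges_above n lab (Suc l) \<inter> G) j k))"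
          using counts(2)[OF G lL(2)] unfolding \<tau>_def left_diff_distrib by linarith
      qed (use expo n p01 st \<epsilon>\<eta> in auto)
      then have "p * (1 - p) * \<sigma> * \<bar>a - p\<bar> \<le> 9 * \<epsilon> + \<eta> + (\<sigma> - \<tau>)" by (simp add: a_def jk)
      then have "\<bar>a - p\<bar> \<le> \<theta>"
        unfolding \<sigma>_def \<tau>_def by (intro label_levels_arith[OF K L lK c \<theta>(1) K\<theta> \<epsilon>\<eta>(1)]) auto
      then show ?thesis using True by (auto simp: q1_def q2_def l_def)
    qed
    then show "real (card {G \<in> history_class \<G> (set (take i es)) g. es ! i \<in> G}) /
       real (card (history_class \<G> (set (take i es)) g)) \<in> {q1 (es ! i)..q2 (es ! i)}"
      by (simp add: a_def C_def T_def)
  qed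
  have "\<exists>J. is_coupling3 J (random_subset (set es) q1) (pmf_of_set \<G>) (random_subset (set es) q2) \<and>
    measure_pmf.prob J {(X, G, Y). \<not> (X \<subseteq> G \<and> G \<inter> set es \<subseteq> Y)}
      \<le> real (card (deviating \<G> q1 q2 es)) / real (card \<G>)"
    using fin ne es(2) c \<theta> by (intro sequential_coupling) (auto simp: \<G>_def q1_def q2_def)
  then obtain J where J: "is_coupling3 J (random_subset (all_edges n) q1) (pmf_of_set \<G>) (random_subset (all_edges n) q2)"
    and fail: "measure_pmf.prob J {(X, G, Y). \<not> (X \<subseteq> G \<and> G \<inter> set es \<subseteq> Y)}
      \<le> real (card (deviating \<G> q1 q2 es)) / real (card \<G>)"
    unfolding es(1) by blast
  have supp: "G \<subseteq> set es" if "(X, G, Y) \<in> set_pmf J" for X G Y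
  proof -
    have "G \<in> set_pmf (map_pmf (\<lambda>(x, y, z). y) J)"
      using imageI[OF that, of "\<lambda>(x, y, z). y"] by simp
    then have "G \<in> \<G>" using J fin ne unfolding is_coupling3_def \<G>_def by simp
    then show ?thesis unfolding es(1) by (auto simp: \<G>_def graphs_with_degrees_def)
  qed
  have "measure_pmf.prob J {(X, G, Y). \<not> (X \<subseteq> G \<and> G \<subseteq> Y)} \<le>
      measure_pmf.prob J {(X, G, Y). \<not> (X \<subseteq> G \<and> G \<inter> set es \<subseteq> Y)}"
  proof (rule measure_pmf.finite_measure_mono_AE)
    show "AE z in measure_pmf J. z \<in> {(X, G, Y). \<not> (X \<subseteq> G \<and> G \<subseteq> Y)} \<longrightarrow>
       z \<in> {(X, G, Y). \<not> (X \<subseteq> G \<and> G \<inter> set es \<subseteq> Y)}"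
      unfolding AE_measure_pmf_iff
    proof (intro ballI impI)
      fix z assume z: "z \<in> set_pmf J" "z \<in> {(X, G, Y). \<not> (X \<subseteq> G \<and> G \<subseteq> Y)}"
      obtain X G Y where zz: "z = (X, G, Y)" by (cases z)
      then have "G \<inter> set es = G" using supp z by blast
      then show "z \<in> {(X, G, Y). \<not> (X \<subseteq> G \<and> G \<inter> set es \<subseteq> Y)}" using z zz by simp
    qed
  qed simp
  also note fail
  also have "real (card (deviating \<G> q1 q2 es)) / real (card \<G>) \<le> (real n)\<^sup>2 / \<eta> * real (card bad) / real (card \<G>)"
  proof (rule divide_right_mono)
    have "real (length es) \<le> (real n)\<^sup>2"
      using card_all_edges_le[of n] distinct_card[OF es(2)] es(1) by (simp flip: of_nat_power)
    then have "real (length es) * (real (card bad) / \<eta>) \<le> (real n)\<^sup>2 * (real (card bad) / \<eta>)"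
      using \<epsilon>\<eta> by (intro mult_right_mono) auto
    then show "real (card (deviating \<G> q1 q2 es)) \<le> (real n)\<^sup>2 / \<eta> * real (card bad)" using dev by simp
  qed simp
  finally show ?thesis using J unfolding q1_def q2_def bad_def by blast
qed

section \<open>Averaging over the labels\<close>

lemma bind_uniform_bernoulli:
  assumes L: "0 < L" "m \<le> L" and ab: "0 \<le> a" "a \<le> 1" "0 \<le> b" "b \<le> 1"
  shows "bind_pmf (pmf_of_set {..<L}) (\<lambda>i. bernoulli_pmf (if i < m then a else b)) =
    bernoulli_pmf (a * (real m / real L) + b * (1 - real m / real L))"
proof -
  define s where "s = real m / real L"
  have s: "0 \<le> s" "s \<le> 1" using L by (auto simp: s_def)
  have conv: "0 \<le> a * s + b * (1 - s)" "a * s + b * (1 - s) \<le> 1"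
    using s ab mult_mono[of a 1 s s] mult_mono[of b 1 "1 - s" "1 - s"] by auto
  have "bind_pmf (pmf_of_set {..<L}) (\<lambda>i. bernoulli_pmf (if i < m then a else b)) =
      bind_pmf (map_pmf (\<lambda>i. m \<le> i) (pmf_of_set {..<L})) (\<lambda>z. bernoulli_pmf (if z then b else a))"
    unfolding bind_map_pmf by (intro bind_pmf_cong refl) auto
  also have "\<dots> = bind_pmf (bernoulli_pmf (1 - s)) (\<lambda>z. bernoulli_pmf (if z then b else a))"
    using map_pmf_threshold[OF L] by (simp add: s_def)
  also have "\<dots> = bernoulli_pmf (a * s + b * (1 - s))"
  proof (rule pmf_eqI)
    fix z
    show "pmf (bernoulli_pmf (1 - s) \<bind> (\<lambda>z. bernoulli_pmf (if z then b else a))) z =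
        pmf (bernoulli_pmf (a * s + b * (1 - s))) z"
      using s ab conv by (cases z) (simp_all add: pmf_bind, simp_all add: algebra_simps)
  qed
  finally show ?thesis by (simp add: s_def)
qed

text \<open>The labels of different pairs are independent, so the mixture can be computed pair by
  pair and each pair just receives its averaged probability. This is what makes the outer marginals
  exactly binomial.\<close>

lemma edge_labels_mixture:
  assumes L: "0 < L" "m \<le> L" and ab: "0 \<le> a" "a \<le> 1" "0 \<le> b" "b \<le> 1"
  shows "bind_pmf (edge_labels n L) (\<lambda>lab. random_subset (all_edges n) (\<lambda>e. if lab e < m then a else b)) =
    binomial_random_graph n (a * (real m / real L) + b * (1 - real m / real L))"
proof -
  have "binomial_random_graph n (a * (real m / real L) + b * (1 - real m / real L)) =
    map_pmf (\<lambda>f. {e \<in> all_edges n. f e}) (Pi_pmf (all_edges n) False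
      (\<lambda>_. bind_pmf (pmf_of_set {..<L}) (\<lambda>i. bernoulli_pmf (if i < m then a else b))))"
    unfolding bind_uniform_bernoulli[OF assms] binomial_random_graph_def ..
  also have "\<dots> = map_pmf (\<lambda>f. {e \<in> all_edges n. f e}) (bind_pmf (edge_labels n L)
      (\<lambda>lab. Pi_pmf (all_edges n) False (\<lambda>e. bernoulli_pmf (if lab e < m then a else b))))"
    unfolding edge_labels_def by (subst Pi_pmf_bind[where d' = 0]) auto
  finally show ?thesis unfolding map_bind_pmf random_subset_def ..
qed

text \<open>Summation over \<open>G\<close> and expectation over the labels are exchanged. A
  cut-regular \<open>G\<close> is then spoiled only by the labels, which fail for \<open>G\<close>
  or for its complement; an irregular one is counted in full.\<close>

lemma expected_atypical:
  assumes L: "0 < L" and \<epsilon>: "0 < \<epsilon>" and n: "0 < n" and \<G>: "\<G> \<subseteq> Pow (all_edges n)"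
  shows "measure_pmf.expectation (edge_labels n L) (\<lambda>lab. real (card {G \<in> \<G>. \<not> typical n L p \<epsilon> lab G})) \<le>
    real (card {G \<in> \<G>. \<not> cut_regular n p \<epsilon> G}) + real (card \<G>) *
     (2 * (real L + 1) * (2 * 4 ^ n * exp (- \<epsilon>\<^sup>2 * (real n)\<^sup>2) + 2 * real n * exp (- \<epsilon>\<^sup>2 * real n)))"
proof -
  define M where "M = edge_labels n L"
  define \<beta> where "\<beta> = (real L + 1) * (2 * 4 ^ n * exp (- \<epsilon>\<^sup>2 * (real n)\<^sup>2) + 2 * real n * exp (- \<epsilon>\<^sup>2 * real n))"
  have fin: "finite \<G>" using \<G> by (simp add: finite_subset)
  have "real (card {G \<in> \<G>. \<not> typical n L p \<epsilon> lab G}) = (\<Sum>G\<in>\<G>. indicator {lab. \<not> typical n L p \<epsilon> lab G} lab)" for lab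
    using fin by (simp add: indicator_def sum.If_cases Int_def)
  then have "measure_pmf.expectation M (\<lambda>lab. real (card {G \<in> \<G>. \<not> typical n L p \<epsilon> lab G})) =
      (\<Sum>G\<in>\<G>. measure_pmf.prob M {lab. \<not> typical n L p \<epsilon> lab G})"
    by (simp only:, subst Bochner_Integration.integral_sum)
       (auto intro!: measure_pmf.integrable_const_bound[where B = 1])
  also have "\<dots> \<le> (\<Sum>G\<in>\<G>. of_bool (\<not> cut_regular n p \<epsilon> G) + 2 * \<beta>)"
  proof (rule sum_mono)
    fix G assume G: "G \<in> \<G>"
    have b0: "0 \<le> \<beta>" by (auto simp: \<beta>_def)
    show "measure_pmf.prob M {lab. \<not> typical n L p \<epsilon> lab G} \<le> of_bool (\<not> cut_regular n p \<epsilon> G) + 2 * \<beta>"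
    proof (cases "cut_regular n p \<epsilon> G")
      case False
      have "measure_pmf.prob M {lab. \<not> typical n L p \<epsilon> lab G} \<le> 1" by (rule measure_pmf.prob_le_1)
      also have "\<dots> \<le> 1 + 2 * \<beta>" using b0 by simp
      finally show ?thesis using False by simp
    next
      case True
      have "{lab. \<not> typical n L p \<epsilon> lab G} =
          {lab. \<not> label_regular n L \<epsilon> G lab} \<union> {lab. \<not> label_regular n L \<epsilon> (all_edges n - G) lab}"
        using True by (auto simp: typical_def)
      then have "measure_pmf.prob M {lab. \<not> typical n L p \<epsilon> lab G} \<le>
          measure_pmf.prob M {lab. \<not> label_regular n L \<epsilon> G lab} +
          measure_pmf.prob M {lab. \<not> label_regular n L \<epsilon> (all_edges n - G) lab}"
        using measure_Un_le[of "{lab. \<not> label_regular n L \<epsilon> G lab}" M] by simp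
      also have "\<dots> \<le> \<beta> + \<beta>"
        unfolding \<beta>_def M_def using G \<G> by (intro add_mono label_regular_whp L \<epsilon> n) auto
      finally show ?thesis using True by simp
    qed
  qed
  also have "\<dots> = real (card {G \<in> \<G>. \<not> cut_regular n p \<epsilon> G}) + real (card \<G>) * (2 * \<beta>)"
    using fin by (simp add: sum.distrib of_bool_def sum.If_cases Int_def)
  finally show ?thesis unfolding M_def \<beta>_def by (simp only: mult.assoc)
qed

text \<open>\<open>\<delta>\<close> and \<open>n0\<close> are chosen before \<open>p\<close> and
  \<open>d\<close>: the estimate must be uniform, since both vary with \<open>n\<close> in the
  limit. One coupling is built for every labelling, and these are mixed over the random
  labels.\<close>

lemma finite_sandwich:
  fixes c \<gamma> :: real
  assumes c: "0 < c" and \<gamma>: "0 < \<gamma>"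
  shows "\<exists>\<delta>>0. \<exists>n0. \<forall>n\<ge>n0. \<forall>p d. c \<le> p \<longrightarrow> p \<le> 1 - c \<longrightarrow>
    (\<forall>j\<in>{1..n}. (p - \<delta>) * real n \<le> real (d j) \<and> real (d j) \<le> p * real n) \<longrightarrow>
    graphs_with_degrees n d \<noteq> {} \<longrightarrow>
    (\<exists>p1 p2 C. p1 \<in> {0..1} \<and> p2 \<in> {0..1} \<and> \<bar>p1 - p\<bar> \<le> \<gamma> \<and> \<bar>p2 - p\<bar> \<le> \<gamma> \<and>
      is_coupling3 C (binomial_random_graph n p1) (degree_random_graph n d) (binomial_random_graph n p2) \<and>
      1 - measure_pmf.prob C {(GL, G, GU). GL \<subseteq> G \<and> G \<subseteq> GU} \<le> \<gamma>)"
proof -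
  \<comment> \<open>\<open>\<theta> \<le> c\<close> keeps \<open>p - \<theta>\<close> and
    \<open>p + \<theta>\<close> inside the unit interval. Of the allowed deviation
    \<open>\<gamma>\<close>, one half is spent on \<open>\<theta>\<close> and the other on the
    proportion \<open>1 / K\<close> of late pairs; the other bound in \<open>K\<close> makes a
    single level thin enough.\<close>
  define \<theta> where "\<theta> = min c (\<gamma> / 2)"
  have \<theta>: "0 < \<theta>" "\<theta> \<le> c" "\<theta> \<le> \<gamma> / 2" using c \<gamma> by (auto simp: \<theta>_def)
  define K where "K = nat \<lceil>max (6 / (c\<^sup>2 * \<theta>)) (2 / \<gamma>)\<rceil> + 1"
  have K: "0 < K" by (simp add: K_def)
  have "max (6 / (c\<^sup>2 * \<theta>)) (2 / \<gamma>) \<le> real K" unfolding K_def by linarith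
  then have "6 / (c\<^sup>2 * \<theta>) \<le> real K" "2 / \<gamma> \<le> real K" by auto
  then have K\<theta>: "3 / real K \<le> c\<^sup>2 * \<theta> / 2" and K\<gamma>: "1 / real K \<le> \<gamma> / 2"
    using K c \<theta> \<gamma> by (simp_all add: field_simps)
  define L where "L = K * K"
  have L: "0 < L" "L - K \<le> L" "K \<le> L" using K by (auto simp: L_def)
  have LK: "real (L - K) / real L = 1 - 1 / real K"
    using K L by (simp add: of_nat_diff field_simps) (simp add: L_def)
  \<comment> \<open>\<open>9 * \<epsilon> = \<eta>\<close>, so the sum
    \<open>9 * \<epsilon> + \<eta>\<close> uses the budget
    \<open>c\<^sup>2 * \<theta> / (2 * K ^ 3)\<close> exactly.\<close>
  define \<eta> where "\<eta> = c\<^sup>2 * \<theta> / (4 * real K ^ 3)"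
  define \<epsilon> where "\<epsilon> = \<eta> / 9"
  have \<epsilon>\<eta>: "9 * \<epsilon> + \<eta> \<le> c\<^sup>2 * \<theta> / (2 * real K ^ 3)" "0 < \<eta>" "0 < \<epsilon>"
    using c \<theta> K by (auto simp: \<epsilon>_def \<eta>_def mult.commute)
  define \<alpha> where "\<alpha> = (\<lambda>n. 4 * 4 ^ n * exp (- (\<epsilon>\<^sup>2 / 8) * (real n)\<^sup>2))"
  define \<beta> where "\<beta> = (\<lambda>n. 2 * (real L + 1) * (2 * 4 ^ n * exp (- \<epsilon>\<^sup>2 * (real n)\<^sup>2) + 2 * real n * exp (- \<epsilon>\<^sup>2 * real n)))"
  obtain \<delta>' n1 where \<delta>': "\<delta>' > 0" and n1: "\<And>n p d. n \<ge> n1 \<Longrightarrow> c \<le> p \<Longrightarrow> p \<le> 1 - c \<Longrightarrow>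
    (\<forall>j\<in>{1..n}. (p - \<delta>') * real n \<le> real (d j) \<and> real (d j) \<le> p * real n) \<Longrightarrow>
    even (\<Sum>j\<in>{1..n}. d j) \<Longrightarrow>
    real (card {G \<in> graphs_with_degrees n d. \<not> cut_regular n p \<epsilon> G})
      \<le> \<alpha> n * real (card (graphs_with_degrees n d))"
    using degree_graphs_cut_regular[OF c \<epsilon>\<eta>(3)] unfolding \<alpha>_def by blast
  define \<delta> where "\<delta> = min \<delta>' \<epsilon>"
  have \<delta>: "0 < \<delta>" "\<delta> \<le> \<delta>'" "\<delta> \<le> \<epsilon>" using \<delta>' \<epsilon>\<eta> by (auto simp: \<delta>_def)
  \<comment> \<open>The loss from Markov's inequality is polynomial, whereas
    \<open>\<beta> n\<close>, whose slowest term comes from the single rows, still decays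
    exponentially.\<close>
  have "(\<lambda>n. (real n)\<^sup>2 / \<eta> * (\<alpha> n + \<beta> n)) \<longlonglongrightarrow> 0"
    unfolding \<alpha>_def \<beta>_def using \<epsilon>\<eta> by real_asymp
  then have "eventually (\<lambda>n. (real n)\<^sup>2 / \<eta> * (\<alpha> n + \<beta> n) < \<gamma>) sequentially"
    using \<gamma> by (rule order_tendstoD)
  moreover have "eventually (\<lambda>n. 1 / \<epsilon> \<le> real n) sequentially" by real_asymp
  ultimately have "eventually (\<lambda>n. (real n)\<^sup>2 / \<eta> * (\<alpha> n + \<beta> n) < \<gamma> \<and> 1 / \<epsilon> \<le> real n \<and> n1 \<le> n \<and> 0 < n) sequentially"
    using eventually_gt_at_top[of "0::nat"] eventually_ge_at_top[of n1] by eventually_elim auto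
  then obtain n0 where n0: "\<And>n. n \<ge> n0 \<Longrightarrow>
      (real n)\<^sup>2 / \<eta> * (\<alpha> n + \<beta> n) < \<gamma> \<and> 1 / \<epsilon> \<le> real n \<and> n1 \<le> n \<and> 0 < n"
    unfolding eventually_sequentially by blast
  have "\<exists>p1 p2 C. p1 \<in> {0..1} \<and> p2 \<in> {0..1} \<and> \<bar>p1 - p\<bar> \<le> \<gamma> \<and> \<bar>p2 - p\<bar> \<le> \<gamma> \<and>
      is_coupling3 C (binomial_random_graph n p1) (degree_random_graph n d) (binomial_random_graph n p2) \<and>
      1 - measure_pmf.prob C {(GL, G, GU). GL \<subseteq> G \<and> G \<subseteq> GU} \<le> \<gamma>"
    if nn: "n \<ge> n0" and p: "c \<le> p" "p \<le> 1 - c"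
      and d: "\<forall>j\<in>{1..n}. (p - \<delta>) * real n \<le> real (d j) \<and> real (d j) \<le> p * real n"
      and ne: "graphs_with_degrees n d \<noteq> {}" for n p d
  proof -
    have n: "(real n)\<^sup>2 / \<eta> * (\<alpha> n + \<beta> n) < \<gamma>" "1 / \<epsilon> \<le> real n" "n1 \<le> n" "0 < n" using n0[OF nn] by auto
    have n\<epsilon>: "1 \<le> \<epsilon> * real n" using n(2) \<epsilon>\<eta> by (simp add: field_simps)
    define \<G> where "\<G> = graphs_with_degrees n d"
    have fin: "finite \<G>" unfolding \<G>_def by (rule finite_graphs_with_degrees)
    have cardG: "0 < real (card \<G>)" using fin ne by (simp add: \<G>_def card_gt_0_iff)
    have dd: "(p - x) * real n \<le> real (d j) \<and> real (d j) \<le> p * real n" if "\<delta> \<le> x" "j \<in> {1..n}" for x j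
    proof -
      have "(p - x) * real n \<le> (p - \<delta>) * real n" using that by (intro mult_right_mono) auto
      then show ?thesis using bspec[OF d that(2)] by linarith
    qed
    have ev: "even (\<Sum>j\<in>{1..n}. d j)"
    proof -
      obtain H where "H \<in> \<G>" using ne by (auto simp: \<G>_def)
      then have "H \<subseteq> all_edges n" "(\<Sum>j\<in>{1..n}. d j) = (\<Sum>j\<in>{1..n}. vertex_degree H j)"
        by (auto simp: \<G>_def graphs_with_degrees_def)
      then show ?thesis using handshake by simp
    qed
    define F where "F = {(X, G, Y). \<not> (X \<subseteq> G \<and> G \<subseteq> (Y :: graph))}"
    define P where "P = (\<lambda>lab J. is_coupling3 J (random_subset (all_edges n) (\<lambda>e. if lab e < L - K then p - \<theta> else 0))
       (pmf_of_set \<G>) (random_subset (all_edges n) (\<lambda>e. if lab e < L - K then p + \<theta> else 1)) \<and>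
     measure_pmf.prob J F \<le>
       (real n)\<^sup>2 / \<eta> * real (card {G \<in> \<G>. \<not> typical n L p \<epsilon> lab G}) / real (card \<G>))"
    have "\<exists>J. P lab J" for lab
      unfolding P_def F_def \<G>_def
      by (rule labelled_coupling[OF K L_def c p \<theta>(1,2) K\<theta> \<epsilon>\<eta> n(4) n\<epsilon> dd[OF \<delta>(3)] ne])
    then have "\<exists>J. \<forall>lab. P lab (J lab)" by (intro choice allI)
    then obtain J where J: "\<And>lab. P lab (J lab)" by blast
    define M where "M = edge_labels n L"
    \<comment> \<open>The middle marginal of \<open>J lab\<close> is the same for every labelling,
      so mixing leaves \<open>G\<close> uniform.\<close>
    define C where "C = bind_pmf M J"
    \<comment> \<open>A proportion \<open>1 / K\<close> of the labels is late; such pairs are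
      present with probability 0 below and 1 above.\<close>
    define p1 where "p1 = (p - \<theta>) * (1 - 1 / real K) + 0 * (1 - (1 - 1 / real K))"
    define p2 where "p2 = (p + \<theta>) * (1 - 1 / real K) + 1 * (1 - (1 - 1 / real K))"
    have pth: "0 \<le> p - \<theta>" "p - \<theta> \<le> 1" "0 \<le> p + \<theta>" "p + \<theta> \<le> 1" using p \<theta> c by auto
    have K01: "0 \<le> 1 - 1 / real K" "0 \<le> 1 / real K" "1 / real K \<le> 1" using K by auto
    have pK: "0 \<le> (p - \<theta>) * (1 / real K)" "(p - \<theta>) * (1 / real K) \<le> 1 * (1 / real K)"
        "0 \<le> (p + \<theta>) * (1 / real K)" "(p + \<theta>) * (1 / real K) \<le> 1 * (1 / real K)"
      using pth K01 by (intro mult_nonneg_nonneg mult_right_mono; simp)+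
    have p1': "p1 = (p - \<theta>) - (p - \<theta>) * (1 / real K)" "p2 = (p + \<theta>) - (p + \<theta>) * (1 / real K) + 1 / real K"
      by (simp_all add: p1_def p2_def algebra_simps)
    have p1: "p1 \<in> {0..1}" "\<bar>p1 - p\<bar> \<le> \<gamma>"
    proof -
      have "0 \<le> (p - \<theta>) * (1 - 1 / real K)" using pth K01 by (intro mult_nonneg_nonneg) auto
      then have "0 \<le> p1" by (simp add: p1_def)
      moreover have "p1 \<le> 1" "p1 - p \<le> \<gamma>" "- (p1 - p) \<le> \<gamma>" using p1' pK pth K\<gamma> \<theta> \<gamma> by linarith+
      ultimately show "p1 \<in> {0..1}" "\<bar>p1 - p\<bar> \<le> \<gamma>" by (auto simp: abs_le_iff)
    qed
    have p2: "p2 \<in> {0..1}" "\<bar>p2 - p\<bar> \<le> \<gamma>"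
    proof -
      have "0 \<le> (1 - (p + \<theta>)) * (1 - 1 / real K)" using pth K01 by (intro mult_nonneg_nonneg) auto
      moreover have "(1 - (p + \<theta>)) * (1 - 1 / real K) = 1 - p2" by (simp add: p2_def algebra_simps)
      ultimately have "p2 \<le> 1" by simp
      moreover have "0 \<le> p2" "p2 - p \<le> \<gamma>" "- (p2 - p) \<le> \<gamma>" using p1' pK pth K01 K\<gamma> \<theta> \<gamma> by linarith+
      ultimately show "p2 \<in> {0..1}" "\<bar>p2 - p\<bar> \<le> \<gamma>" by (auto simp: abs_le_iff)
    qed
    have coup: "is_coupling3 C (binomial_random_graph n p1) (degree_random_graph n d) (binomial_random_graph n p2)"
    proof -
      have "map_pmf (\<lambda>(x, y, z). x) (J lab) = random_subset (all_edges n) (\<lambda>e. if lab e < L - K then p - \<theta> else 0)"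
        "map_pmf (\<lambda>(x, y, z). y) (J lab) = pmf_of_set \<G>"
        "map_pmf (\<lambda>(x, y, z). z) (J lab) = random_subset (all_edges n) (\<lambda>e. if lab e < L - K then p + \<theta> else 1)" for lab
        using J[of lab] unfolding P_def is_coupling3_def by auto
      then show ?thesis
        unfolding is_coupling3_def C_def map_bind_pmf M_def
        using edge_labels_mixture[OF L(1,2) pth(1,2), of 0 n] edge_labels_mixture[OF L(1,2) pth(3,4), of 1 n]
        unfolding LK p1_def[symmetric] p2_def[symmetric] by (simp add: degree_random_graph_def \<G>_def)
    qed
    have "1 - measure_pmf.prob C {(GL, G, GU). GL \<subseteq> G \<and> G \<subseteq> GU} = measure_pmf.prob C F"
    proof -
      have "F = UNIV - {(GL, G, GU). GL \<subseteq> G \<and> G \<subseteq> GU}" by (auto simp: F_def)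
      then show ?thesis using measure_pmf.prob_compl[of "{(GL, G, GU). GL \<subseteq> G \<and> G \<subseteq> GU}" C] by simp
    qed
    also have "measure_pmf.prob C F = measure_pmf.expectation M (\<lambda>lab. measure_pmf.prob (J lab) F)"
      unfolding C_def by (rule prob_bind_pmf)
    also have "\<dots> \<le> measure_pmf.expectation M
        (\<lambda>lab. (real n)\<^sup>2 / \<eta> / real (card \<G>) * real (card {G \<in> \<G>. \<not> typical n L p \<epsilon> lab G}))"
    proof (rule integral_mono)
      show "integrable (measure_pmf M) (\<lambda>lab. measure_pmf.prob (J lab) F)"
        by (rule measure_pmf.integrable_const_bound[where B = 1]) auto
      have "card {G \<in> \<G>. \<not> typical n L p \<epsilon> lab G} \<le> card \<G>" for lab
        using fin by (intro card_mono) auto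
      then show "integrable (measure_pmf M)
        (\<lambda>lab. (real n)\<^sup>2 / \<eta> / real (card \<G>) * real (card {G \<in> \<G>. \<not> typical n L p \<epsilon> lab G}))"
        by (intro integrable_mult_right measure_pmf.integrable_const_bound[where B = "real (card \<G>)"]) auto
      show "measure_pmf.prob (J lab) F \<le>
        (real n)\<^sup>2 / \<eta> / real (card \<G>) * real (card {G \<in> \<G>. \<not> typical n L p \<epsilon> lab G})" for lab
        using J[of lab] unfolding P_def by simp
    qed
    also have "\<dots> = (real n)\<^sup>2 / \<eta> / real (card \<G>) *
        measure_pmf.expectation M (\<lambda>lab. real (card {G \<in> \<G>. \<not> typical n L p \<epsilon> lab G}))"
      by (rule integral_mult_right_zero)
    also have "\<dots> \<le> (real n)\<^sup>2 / \<eta> / real (card \<G>) * (real (card {G \<in> \<G>. \<not> cut_regular n p \<epsilon> G}) + real (card \<G>) * \<beta> n)"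
      unfolding M_def \<beta>_def using \<epsilon>\<eta>
      by (intro mult_left_mono expected_atypical L n) (auto simp: \<G>_def graphs_with_degrees_def)
    also have "\<dots> \<le> (real n)\<^sup>2 / \<eta> / real (card \<G>) * (\<alpha> n * real (card \<G>) + real (card \<G>) * \<beta> n)"
      using \<epsilon>\<eta> n1[OF n(3) p _ ev] dd[OF \<delta>(2)] unfolding \<G>_def
      by (intro mult_left_mono add_right_mono) auto
    also have "\<alpha> n * real (card \<G>) + real (card \<G>) * \<beta> n = real (card \<G>) * (\<alpha> n + \<beta> n)"
      by (simp add: algebra_simps)
    also have "(real n)\<^sup>2 / \<eta> / real (card \<G>) * (real (card \<G>) * (\<alpha> n + \<beta> n)) = (real n)\<^sup>2 / \<eta> * (\<alpha> n + \<beta> n)"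
      using cardG by simp
    also have "\<dots> \<le> \<gamma>" using n(1) by simp
    finally show ?thesis using p1 p2 coup by blast
  qed
  then show ?thesis using \<delta>(1) by blast
qed

text \<open>At \<open>n\<close> the best tolerance \<open>1 / (k + 1)\<close> whose threshold
  \<open>N k\<close> has been passed is used; restricting to \<open>k \<le> n\<close> ensures that a
  best one exists.\<close>

lemma diagonal_tolerance:
  fixes Q :: "real \<Rightarrow> nat \<Rightarrow> bool"
  assumes "\<And>\<gamma>. 0 < \<gamma> \<Longrightarrow> eventually (Q \<gamma>) sequentially"
  obtains g :: "nat \<Rightarrow> real" where "g \<longlonglongrightarrow> 0" "eventually (\<lambda>n. Q (g n) n) sequentially"
proof -
  have "\<exists>N. \<forall>n\<ge>N. Q (1 / real (Suc k)) n" for k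
    using assms[of "1 / real (Suc k)"] by (simp add: eventually_sequentially)
  then obtain N where N: "\<And>k n. n \<ge> N k \<Longrightarrow> Q (1 / real (Suc k)) n" by metis
  define S where "S = (\<lambda>n. {k. k \<le> n \<and> N k \<le> n})"
  define g where "g = (\<lambda>n. 1 / real (Suc (Max (S n))))"
  have fin: "finite (S n)" for n by (rule finite_subset[of _ "{..n}"]) (auto simp: S_def)
  have "Q (g n) n" if "N 0 \<le> n" for n
  proof -
    have "S n \<noteq> {}" using that by (auto simp: S_def)
    then have "Max (S n) \<in> S n" using fin by (intro Max_in)
    then show ?thesis unfolding g_def S_def using N by simp
  qed
  then have "eventually (\<lambda>n. Q (g n) n) sequentially" unfolding eventually_sequentially by blast
  moreover have "g \<longlonglongrightarrow> 0"
  proof (rule LIMSEQ_I)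
    fix r :: real assume "0 < r"
    then obtain k where k: "1 / real (Suc k) < r" using nat_approx_posE by blast
    have "norm (g n - 0) < r" if "max k (N k) \<le> n" for n
    proof -
      have "k \<le> Max (S n)" using that fin by (intro Max_ge) (auto simp: S_def)
      then have "g n \<le> 1 / real (Suc k)" unfolding g_def by (intro divide_left_mono) auto
      then show ?thesis using k by (simp add: g_def)
    qed
    then show "\<exists>no. \<forall>n\<ge>no. norm (g n - 0) < r" by blast
  qed
  ultimately show thesis using that by blast
qed

text \<open>Near-regularity and density eventually provide the hypotheses of the sandwich for
  \<open>p = \<Delta> / n\<close>, at every fixed tolerance. A diagonal choice makes the tolerance
  vanish, and the lower bound \<open>c \<le> p\<close> turns additive errors into relative
  ones.\<close>

theorem theorem2p1:
  fixes d :: "nat \<Rightarrow> nat \<Rightarrow> nat"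
  assumes "\<And>n j. j \<in> {1..n} \<Longrightarrow> d n j \<in> {0..n - 1}"
    and "\<And>n. graphs_with_degrees n (d n) \<noteq> {}"
    and "near_regular d"
    and "dense_degrees d"
  shows "\<exists>(p1 :: nat \<Rightarrow> real) (p2 :: nat \<Rightarrow> real)
            (\<epsilon>1 :: nat \<Rightarrow> real) (\<epsilon>2 :: nat \<Rightarrow> real)
            (C :: nat \<Rightarrow> (graph \<times> graph \<times> graph) pmf).
           \<epsilon>1 \<in> o(\<lambda>_. 1) \<and> \<epsilon>2 \<in> o(\<lambda>_. 1) \<and>
           (\<forall>n. p1 n \<in> {0..1} \<and> p1 n = (1 - \<epsilon>1 n) * real (max_degree n (d n)) / real n) \<and>
           (\<forall>n. p2 n \<in> {0..1} \<and> p2 n = (1 + \<epsilon>2 n) * real (max_degree n (d n)) / real n) \<and>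
           (\<forall>n. is_coupling3 (C n)
                  (binomial_random_graph n (p1 n))
                  (degree_random_graph n (d n))
                  (binomial_random_graph n (p2 n))) \<and>
           (\<lambda>n. 1 - measure_pmf.prob (C n) {(GL, G, GU). GL \<subseteq> G \<and> G \<subseteq> GU}) \<in> o(\<lambda>_. 1)"
proof -
  define \<Delta> where "\<Delta> = (\<lambda>n. max_degree n (d n))"
  define p where "p = (\<lambda>n. real (\<Delta> n) / real n)"
  have deg_le: "d n j \<le> \<Delta> n" "min_degree n (d n) \<le> d n j" if "j \<in> {1..n}" for n j
    using that unfolding \<Delta>_def max_degree_def min_degree_def by (auto intro!: Max_ge Min_le)
  have \<Delta>_le: "\<Delta> n \<le> n" if "0 < n" for n
  proof -
    have "d n ` {1..n} \<noteq> {}" using that by auto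
    then have "\<Delta> n \<in> d n ` {1..n}" unfolding \<Delta>_def max_degree_def by (intro Max_in) auto
    then obtain j where "j \<in> {1..n}" "\<Delta> n = d n j" by blast
    then show ?thesis using assms(1)[of j n] by auto
  qed
  \<comment> \<open>For \<open>n = 0\<close> the maximum degree is unspecified, but division by zero
    makes \<open>p 0\<close> equal to 0.\<close>
  have p01: "p n \<in> {0..1}" for n
    using \<Delta>_le[of n] by (cases "n = 0") (auto simp: p_def)
  obtain c where c: "c > 0" and
    c_ev: "eventually (\<lambda>n. c * norm (real n) \<le> norm (min (real (\<Delta> n)) (real n - real (\<Delta> n)))) sequentially"
  proof -
    have "(\<lambda>n. min (real (\<Delta> n)) (real n - real (\<Delta> n))) \<in> \<Omega>(\<lambda>n. real n)"
      using assms(4) unfolding dense_degrees_def \<Delta>_def by (rule bigthetaD2)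
    then show thesis using that by (elim landau_omega.bigE) blast
  qed
  have p_ev: "eventually (\<lambda>n. 0 < n \<and> c \<le> p n \<and> p n \<le> 1 - c) sequentially"
    using c_ev eventually_gt_at_top[of 0]
  proof eventually_elim
    case (elim n)
    then have "c * real n \<le> real (\<Delta> n)" "c * real n \<le> real n - real (\<Delta> n)"
      using \<Delta>_le[of n] by auto
    then show ?case using elim by (auto simp: p_def field_simps)
  qed
  have range_ev: "eventually (\<lambda>n. degree_range n (d n) \<le> \<delta> * real n) sequentially" if "0 < \<delta>" for \<delta>
  proof -
    have "eventually (\<lambda>n. norm (degree_range n (d n)) \<le> \<delta> * norm (real (\<Delta> n))) sequentially"
      using assms(3) that unfolding near_regular_def \<Delta>_def by (intro landau_o.smallD) auto
    then show ?thesis using eventually_gt_at_top[of 0]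
    proof eventually_elim
      case (elim n)
      have "\<delta> * real (\<Delta> n) \<le> \<delta> * real n" using \<Delta>_le elim that by (intro mult_left_mono) auto
      then show ?case using elim by simp
    qed
  qed
  define Q where "Q = (\<lambda>\<gamma> n. c \<le> p n \<and>
    (\<exists>p1 p2 C. p1 \<in> {0..1} \<and> p2 \<in> {0..1} \<and> \<bar>p1 - p n\<bar> \<le> \<gamma> \<and> \<bar>p2 - p n\<bar> \<le> \<gamma> \<and>
      is_coupling3 C (binomial_random_graph n p1) (degree_random_graph n (d n)) (binomial_random_graph n p2) \<and>
      1 - measure_pmf.prob C {(GL, G, GU). GL \<subseteq> G \<and> G \<subseteq> GU} \<le> \<gamma>))"
  have "eventually (Q \<gamma>) sequentially" if \<gamma>: "0 < \<gamma>" for \<gamma>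
  proof -
    obtain \<delta> n0 where \<delta>: "\<delta> > 0" and n0: "\<And>n p d. n \<ge> n0 \<Longrightarrow> c \<le> p \<Longrightarrow> p \<le> 1 - c \<Longrightarrow>
      (\<forall>j\<in>{1..n}. (p - \<delta>) * real n \<le> real (d j) \<and> real (d j) \<le> p * real n) \<Longrightarrow>
      graphs_with_degrees n d \<noteq> {} \<Longrightarrow>
      (\<exists>p1 p2 C. p1 \<in> {0..1} \<and> p2 \<in> {0..1} \<and> \<bar>p1 - p\<bar> \<le> \<gamma> \<and> \<bar>p2 - p\<bar> \<le> \<gamma> \<and>
        is_coupling3 C (binomial_random_graph n p1) (degree_random_graph n d) (binomial_random_graph n p2) \<and>
        1 - measure_pmf.prob C {(GL, G, GU). GL \<subseteq> G \<and> G \<subseteq> GU} \<le> \<gamma>)"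
      using finite_sandwich[OF c \<gamma>] by blast
    show ?thesis
      using p_ev range_ev[OF \<delta>] eventually_ge_at_top[of n0]
    proof eventually_elim
      case (elim n)
      have "(p n - \<delta>) * real n \<le> real (d n j) \<and> real (d n j) \<le> p n * real n" if "j \<in> {1..n}" for j
      proof -
        have "p n * real n = real (\<Delta> n)" using elim by (simp add: p_def)
        moreover have "real (\<Delta> n) - real (min_degree n (d n)) \<le> \<delta> * real n"
          using elim by (simp add: degree_range_def \<Delta>_def)
        ultimately show ?thesis using deg_le[OF that] by (auto simp: left_diff_distrib)
      qed
      then show ?case unfolding Q_def using elim n0[of n "p n" "d n"] assms(2)[of n] by blast
    qed
  qed
  then obtain g where g: "g \<longlonglongrightarrow> 0" and Qg: "eventually (\<lambda>n. Q (g n) n) sequentially"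
    by (rule diagonal_tolerance)
  \<comment> \<open>Where \<open>Q (g n) n\<close> fails, which happens for finitely many
    \<open>n\<close> only, \<open>p n\<close> itself and an independent coupling are used. The
    clause for \<open>p n = 0\<close> secures the exact formulas for \<open>p1\<close> and
    \<open>p2\<close> there, where dividing by \<open>p n\<close> loses information.\<close>
  define R where "R = (\<lambda>n (p1, p2, C). p1 \<in> {0..1} \<and> p2 \<in> {0..1} \<and>
      is_coupling3 C (binomial_random_graph n p1) (degree_random_graph n (d n)) (binomial_random_graph n p2) \<and>
      (p n = 0 \<longrightarrow> p1 = 0 \<and> p2 = 0) \<and>
      (Q (g n) n \<longrightarrow> c \<le> p n \<and> \<bar>p1 - p n\<bar> \<le> g n \<and> \<bar>p2 - p n\<bar> \<le> g n \<and>
        1 - measure_pmf.prob C {(GL, G, GU). GL \<subseteq> G \<and> G \<subseteq> GU} \<le> g n))"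
  have "\<exists>x. R n x" for n
  proof (cases "Q (g n) n")
    case True
    then obtain p1 p2 C where *: "c \<le> p n" "p1 \<in> {0..1}" "p2 \<in> {0..1}" "\<bar>p1 - p n\<bar> \<le> g n" "\<bar>p2 - p n\<bar> \<le> g n"
      "is_coupling3 C (binomial_random_graph n p1) (degree_random_graph n (d n)) (binomial_random_graph n p2)"
      "1 - measure_pmf.prob C {(GL, G, GU). GL \<subseteq> G \<and> G \<subseteq> GU} \<le> g n"
      unfolding Q_def by blast
    then have "R n (p1, p2, C)" using c unfolding R_def by auto
    then show ?thesis by blast
  next
    case False
    have "R n (p n, p n, pair_pmf (binomial_random_graph n (p n)) (pair_pmf (degree_random_graph n (d n)) (binomial_random_graph n (p n))))"
      unfolding R_def using False p01[of n] is_coupling3_independent by auto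
    then show ?thesis by blast
  qed
  then have "\<exists>x. \<forall>n. R n (x n)" by (intro choice allI)
  then obtain x where x: "\<And>n. R n (x n)" by blast
  define p1 p2 C where "p1 = (\<lambda>n. fst (x n))" and "p2 = (\<lambda>n. fst (snd (x n)))" and "C = (\<lambda>n. snd (snd (x n)))"
  have R: "R n (p1 n, p2 n, C n)" for n using x[of n] by (simp add: p1_def p2_def C_def)
  \<comment> \<open>The relative errors are read off from the chosen parameters; once
    \<open>c \<le> p n\<close>, they are at most \<open>g n / c\<close>.\<close>
  define \<epsilon>1 \<epsilon>2 where "\<epsilon>1 = (\<lambda>n. 1 - p1 n / p n)" and "\<epsilon>2 = (\<lambda>n. p2 n / p n - 1)"
  have small: "f \<in> o(\<lambda>_. 1)" if "eventually (\<lambda>n. norm (f n) \<le> g n / c) sequentially" for f :: "nat \<Rightarrow> real"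
  proof -
    have "(\<lambda>n. g n / c) \<longlonglongrightarrow> 0" using tendsto_divide[OF g tendsto_const[of c]] c by simp
    then have "f \<longlonglongrightarrow> 0" using that by (rule Lim_null_comparison[rotated])
    then show ?thesis by (intro smalloI_tendsto) auto
  qed
  have dev: "\<bar>1 - y / p n\<bar> \<le> g n / c" if "c \<le> p n" "\<bar>y - p n\<bar> \<le> g n" for y n
  proof -
    have pn: "p n > 0" using c that by linarith
    then have "\<bar>1 - y / p n\<bar> = \<bar>y - p n\<bar> / p n" by (simp add: field_simps abs_if)
    also have "\<dots> \<le> g n / c" using that c pn by (intro frac_le) auto
    finally show ?thesis .
  qed
  have e1: "\<epsilon>1 \<in> o(\<lambda>_. 1)"
    by (rule small, rule eventually_mono[OF Qg]) (use R dev in \<open>auto simp: R_def \<epsilon>1_def\<close>)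
  have e2: "\<epsilon>2 \<in> o(\<lambda>_. 1)"
    by (rule small, rule eventually_mono[OF Qg])
       (use R dev in \<open>auto simp: R_def \<epsilon>2_def abs_minus_commute\<close>)
  have e3: "(\<lambda>n. 1 - measure_pmf.prob (C n) {(GL, G, GU). GL \<subseteq> G \<and> G \<subseteq> GU}) \<in> o(\<lambda>_. 1)"
  proof -
    have "eventually (\<lambda>n. norm (1 - measure_pmf.prob (C n) {(GL, G, GU). GL \<subseteq> G \<and> G \<subseteq> GU}) \<le> g n) sequentially"
      by (rule eventually_mono[OF Qg]) (use R in \<open>auto simp: R_def\<close>)
    then have "(\<lambda>n. 1 - measure_pmf.prob (C n) {(GL, G, GU). GL \<subseteq> G \<and> G \<subseteq> GU}) \<longlonglongrightarrow> 0"
      using g by (rule Lim_null_comparison)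
    then show ?thesis by (intro smalloI_tendsto) auto
  qed
  have p1: "p1 n \<in> {0..1} \<and> p1 n = (1 - \<epsilon>1 n) * real (max_degree n (d n)) / real n" for n
  proof -
    have "(1 - \<epsilon>1 n) * real (max_degree n (d n)) / real n = (1 - \<epsilon>1 n) * p n" by (simp add: p_def \<Delta>_def)
    also have "\<dots> = p1 n" using R[of n] by (auto simp: R_def \<epsilon>1_def)
    finally show ?thesis using R[of n] by (simp add: R_def)
  qed
  have p2: "p2 n \<in> {0..1} \<and> p2 n = (1 + \<epsilon>2 n) * real (max_degree n (d n)) / real n" for n
  proof -
    have "(1 + \<epsilon>2 n) * real (max_degree n (d n)) / real n = (1 + \<epsilon>2 n) * p n" by (simp add: p_def \<Delta>_def)
    also have "\<dots> = p2 n" using R[of n] by (auto simp: R_def \<epsilon>2_def)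
    finally show ?thesis using R[of n] by (simp add: R_def)
  qed
  have coup: "is_coupling3 (C n) (binomial_random_graph n (p1 n)) (degree_random_graph n (d n))
      (binomial_random_graph n (p2 n))" for n
    using R[of n] by (simp add: R_def)
  show ?thesis
    by (rule exI[of _ p1], rule exI[of _ p2], rule exI[of _ \<epsilon>1], rule exI[of _ \<epsilon>2], rule exI[of _ C])
       (intro conjI[OF e1] conjI[OF e2] conjI[OF allI[OF p1]] conjI[OF allI[OF p2]] conjI[OF allI[OF coup]] e3)
qed

end
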